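(* There is an isomorphism of graded rings $$R^*_{\mathbb C}(\mathbb Z/4\times\mathbb Z/2)\cong\frac{\mathbb Z[x,y]}{(4x,\ 2y,\ xy^3+x^2y^2)},\qquad |x|=|y|=1.$$
   Context: Let $G$ be a finite group. $R_{\mathbb C}(G)$ is the ring of virtual complex characters of $G$ (the free abelian group on the irreducible complex characters, with product induced by tensor product), with augmentation $\epsilon:R_{\mathbb C}(G)\to\mathbb Z$ the degree map and $I=\ker\epsilon$. Exterior powers of representations give maps $\lambda^n$ on characters, extended to $R_{\mathbb C}(G)$ by requiring $\lambda^0=1$ and $\lambda^n(x+y)=\sum_{i+j=n}\lambda^i(x)\lambda^j(y)$. Put $\gamma^n(x)=\lambda^n(x+n-1)$. Let $\Gamma^n\subseteq R_{\mathbb C}(G)$ be the additive subgroup generated by all products $\gamma^{i_1}(x_1)\cdots\gamma^{i_r}(x_r)$ with $x_j\in I$ and $\sum_j i_j\ge n$; then $\Gamma^0=R_{\mathbb C}(G)$, $\Gamma^1=I$, $\Gamma^m\Gamma^n\subseteq\Gamma^{m+n}$. The graded character ring is $R^*_{\mathbb C}(G)=\bigoplus_{n\ge0}\Gamma^n/\Gamma^{n+1}$. $|x|$ denotes the degree of a homogeneous element $x$. *)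

theory Defs
  imports
    "HOL-Algebra.Elementary_Groups"
    "HOL-Algebra.Product_Groups"
    "HOL-Algebra.QuotRing"
    "HOL-Computational_Algebra.Polynomial"
    "Jordan_Normal_Form.VS_Connect"
    "Jordan_Normal_Form.DL_Submatrix"
begin

section \<open>Complex representations and their characters\<close>

definition GL :: "nat \<Rightarrow> complex mat monoid" where
  "GL d = units_of (ring_mat TYPE(complex) d ())"

definition is_rep :: "('g, 'b) monoid_scheme \<Rightarrow> nat \<Rightarrow> ('g \<Rightarrow> complex mat) \<Rightarrow> bool" where
  "is_rep G d \<rho> \<longleftrightarrow> \<rho> \<in> hom G (GL d)"

definition irreducible_rep :: "('g, 'b) monoid_scheme \<Rightarrow> nat \<Rightarrow> ('g \<Rightarrow> complex mat) \<Rightarrow> bool" where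
  "irreducible_rep G d \<rho> \<longleftrightarrow> is_rep G d \<rho> \<and> d > 0 \<and>
     (\<forall>W. VectorSpace.subspace class_ring W (module_vec TYPE(complex) d) \<and>
          (\<forall>g\<in>carrier G. \<forall>w\<in>W. \<rho> g *\<^sub>v w \<in> W) \<longrightarrow>
          W = {0\<^sub>v d} \<or> W = carrier_vec d)"

definition mat_trace :: "'a::comm_monoid_add mat \<Rightarrow> 'a" where
  "mat_trace A = (\<Sum>i<dim_row A. A $$ (i, i))"

definition rep_char :: "('g, 'b) monoid_scheme \<Rightarrow> ('g \<Rightarrow> complex mat) \<Rightarrow> 'g \<Rightarrow> complex" where
  "rep_char G \<rho> = (\<lambda>g\<in>carrier G. mat_trace (\<rho> g))"

definition irr_chars :: "('g, 'b) monoid_scheme \<Rightarrow> ('g \<Rightarrow> complex) set" where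
  "irr_chars G = {rep_char G \<rho> | d \<rho>. irreducible_rep G d \<rho>}"

text \<open>
  If \<open>A\<close> is the matrix of an endomorphism of \<open>V\<close> in a basis \<open>e\<^sub>0, e\<^sub>1, \<dots>\<close>, then \<open>ext_power n A\<close> is the
  matrix of the induced endomorphism of the \<open>n\<close>-th exterior power of \<open>V\<close> in the basis of wedge
  products \<open>e\<^sub>I\<close>, where \<open>I\<close> runs through the \<open>n\<close>-element sets of indices: its entries are the minors
  of \<open>A\<close> of size \<open>n\<close>. The order in which the sets \<open>I\<close> are listed is immaterial.
\<close>

definition index_subsets :: "nat \<Rightarrow> nat \<Rightarrow> nat set list" where
  "index_subsets n d = map set (filter (\<lambda>xs. length xs = n) (subseqs [0..<d]))"

definition ext_power :: "nat \<Rightarrow> 'a::comm_ring_1 mat \<Rightarrow> 'a mat" where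
  "ext_power n A = (let Is = index_subsets n (dim_row A) in
     mat (length Is) (length Is) (\<lambda>(i, j). det (submatrix A (Is ! i) (Is ! j))))"


section \<open>The ring of virtual characters\<close>

text \<open>
  Virtual characters are realised as complex functions on the group. The irreducible characters of
  a finite group are linearly independent, so the additive group they generate is free on them, and
  the character of a tensor product is the pointwise product of the characters.
\<close>

definition fun_ring :: "('g, 'b) monoid_scheme \<Rightarrow> ('g \<Rightarrow> complex) ring" where
  "fun_ring G =
    \<lparr>carrier = (carrier G \<rightarrow>\<^sub>E UNIV),
     monoid.mult = (\<lambda>x y. \<lambda>g\<in>carrier G. x g * y g),
     one = (\<lambda>g\<in>carrier G. 1),
     zero = (\<lambda>g\<in>carrier G. 0),
     add = (\<lambda>x y. \<lambda>g\<in>carrier G. x g + y g)\<rparr>"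

definition char_ring :: "('g, 'b) monoid_scheme \<Rightarrow> ('g \<Rightarrow> complex) ring" where
  "char_ring G = (fun_ring G)\<lparr>carrier := generate (add_monoid (fun_ring G)) (irr_chars G)\<rparr>"

text \<open>The degree of a virtual character is its value at the identity.\<close>

definition augmentation_ideal :: "('g, 'b) monoid_scheme \<Rightarrow> ('g \<Rightarrow> complex) set" where
  "augmentation_ideal G = {x \<in> carrier (char_ring G). x \<one>\<^bsub>G\<^esub> = 0}"


section \<open>Lambda and gamma operations\<close>

definition is_lambda_family ::
    "('g, 'b) monoid_scheme \<Rightarrow> (nat \<Rightarrow> ('g \<Rightarrow> complex) \<Rightarrow> 'g \<Rightarrow> complex) \<Rightarrow> bool" where
  "is_lambda_family G L \<longleftrightarrow>
     (\<forall>n. L n \<in> carrier (char_ring G) \<rightarrow>\<^sub>E carrier (char_ring G)) \<and>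
     (\<forall>n d \<rho>. is_rep G d \<rho> \<longrightarrow> L n (rep_char G \<rho>) = rep_char G (\<lambda>g. ext_power n (\<rho> g))) \<and>
     (\<forall>x\<in>carrier (char_ring G). L 0 x = \<one>\<^bsub>char_ring G\<^esub>) \<and>
     (\<forall>n. \<forall>x\<in>carrier (char_ring G). \<forall>y\<in>carrier (char_ring G).
        L n (x \<oplus>\<^bsub>char_ring G\<^esub> y) =
          (\<Oplus>\<^bsub>char_ring G\<^esub>i\<in>{..n}. L i x \<otimes>\<^bsub>char_ring G\<^esub> L (n - i) y))"

text \<open>
  For a finite group there is exactly one such family: every virtual character is a difference of
  two characters. It is extensional, i.e. undefined outside the ring of virtual characters.
\<close>

definition lambda_op ::
    "('g, 'b) monoid_scheme \<Rightarrow> nat \<Rightarrow> ('g \<Rightarrow> complex) \<Rightarrow> 'g \<Rightarrow> complex" where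
  "lambda_op G = (THE L. is_lambda_family G L)"

definition gamma_op ::
    "('g, 'b) monoid_scheme \<Rightarrow> nat \<Rightarrow> ('g \<Rightarrow> complex) \<Rightarrow> 'g \<Rightarrow> complex" where
  "gamma_op G n x =
     lambda_op G n (x \<oplus>\<^bsub>char_ring G\<^esub> add_pow (char_ring G) (int n - 1) \<one>\<^bsub>char_ring G\<^esub>)"

text \<open>A list \<open>[(i\<^sub>1, x\<^sub>1), \<dots>, (i\<^sub>r, x\<^sub>r)]\<close> stands for the product of the \<open>\<gamma>\<close>-operations \<open>i\<^sub>j\<close> at \<open>x\<^sub>j\<close>.\<close>

definition gamma_prod ::
    "('g, 'b) monoid_scheme \<Rightarrow> (nat \<times> ('g \<Rightarrow> complex)) list \<Rightarrow> 'g \<Rightarrow> complex" where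
  "gamma_prod G ps =
     foldr (\<lambda>(i, x) z. gamma_op G i x \<otimes>\<^bsub>char_ring G\<^esub> z) ps \<one>\<^bsub>char_ring G\<^esub>"

definition gamma_filtration :: "('g, 'b) monoid_scheme \<Rightarrow> nat \<Rightarrow> ('g \<Rightarrow> complex) set" where
  "gamma_filtration G n = generate (add_monoid (char_ring G))
     {gamma_prod G ps | ps. snd ` set ps \<subseteq> augmentation_ideal G \<and> n \<le> sum_list (map fst ps)}"


section \<open>Associated graded rings\<close>

text \<open>
  Let \<open>F 0 = R \<supseteq> F 1 \<supseteq> \<dots>\<close> be additive subgroups of \<open>R\<close> with \<open>F m F n \<subseteq> F (m + n)\<close>. An element of the
  associated graded ring is a finitely supported family of cosets, the \<open>n\<close>-th one lying in
  \<open>F n / F (n + 1)\<close>.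
\<close>

definition gr_component :: "'a ring \<Rightarrow> (nat \<Rightarrow> 'a set) \<Rightarrow> nat \<Rightarrow> 'a set monoid" where
  "gr_component R F n = ((add_monoid R)\<lparr>carrier := F n\<rparr>) Mod F (Suc n)"

definition gr_ring :: "'a ring \<Rightarrow> (nat \<Rightarrow> 'a set) \<Rightarrow> (nat \<Rightarrow> 'a set) ring" where
  "gr_ring R F =
    \<lparr>carrier = carrier (sum_group UNIV (gr_component R F)),
     monoid.mult = (\<lambda>f g n. finprod (gr_component R F n)
                      (\<lambda>i. rcoset_mult R (F (Suc n)) (f i) (g (n - i))) {..n}),
     one = (\<lambda>n. if n = 0 then F 1 +>\<^bsub>R\<^esub> \<one>\<^bsub>R\<^esub> else F (Suc n)),
     zero = \<one>\<^bsub>sum_group UNIV (gr_component R F)\<^esub>,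
     add = monoid.mult (sum_group UNIV (gr_component R F))\<rparr>"

definition gr_degree :: "'a ring \<Rightarrow> (nat \<Rightarrow> 'a set) \<Rightarrow> nat \<Rightarrow> (nat \<Rightarrow> 'a set) set" where
  "gr_degree R F n = {f \<in> carrier (gr_ring R F). \<forall>m. m \<noteq> n \<longrightarrow> f m = F (Suc m)}"

definition graded_char_ring :: "('g, 'b) monoid_scheme \<Rightarrow> (nat \<Rightarrow> ('g \<Rightarrow> complex) set) ring" where
  "graded_char_ring G = gr_ring (char_ring G) (gamma_filtration G)"

definition graded_char_ring_degree ::
    "('g, 'b) monoid_scheme \<Rightarrow> nat \<Rightarrow> (nat \<Rightarrow> ('g \<Rightarrow> complex) set) set" where
  "graded_char_ring_degree G = gr_degree (char_ring G) (gamma_filtration G)"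

text \<open>\<open>A n\<close> and \<open>B n\<close> are the homogeneous parts of degree \<open>n\<close> of \<open>R\<close> and \<open>S\<close>.\<close>

definition graded_ring_iso ::
    "('a, 'm) ring_scheme \<Rightarrow> (nat \<Rightarrow> 'a set) \<Rightarrow> ('c, 'k) ring_scheme \<Rightarrow> (nat \<Rightarrow> 'c set) \<Rightarrow> ('a \<Rightarrow> 'c) set"
  where "graded_ring_iso R A S B = {\<phi> \<in> ring_iso R S. \<forall>n. \<phi> ` A n = B n}"


section \<open>Graded quotients of the polynomial ring in two variables\<close>

abbreviation ZXY :: "int poly poly ring" where
  "ZXY \<equiv> class_ring"

definition X_var :: "int poly poly" where
  "X_var = [:[:0, 1:]:]"

definition Y_var :: "int poly poly" where
  "Y_var = [:0, 1:]"

text \<open>\<open>coeff (coeff p j) i\<close> is the coefficient of the monomial \<open>x\<^sup>i y\<^sup>j\<close>.\<close>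

definition homogeneous_polys :: "nat \<Rightarrow> int poly poly set" where
  "homogeneous_polys n = {p. \<forall>i j. coeff (coeff p j) i \<noteq> 0 \<longrightarrow> i + j = n}"

definition quot_degree :: "int poly poly set \<Rightarrow> nat \<Rightarrow> int poly poly set set" where
  "quot_degree J n = (\<lambda>p. J +>\<^bsub>ZXY\<^esub> p) ` homogeneous_polys n"

end

theory Submission
  imports
    Defs
    "Jordan_Normal_Form.Schur_Decomposition"
    "HOL-Computational_Algebra.Polynomial_FPS"
begin

text \<open>
  Write \<open>X = a - 1\<close> and \<open>Y = b - 1\<close> for generating characters \<open>a\<close>, \<open>b\<close> of orders 4 and 2. For a
  character \<open>\<chi>\<close> of degree one \<open>\<Sum>n. \<gamma>\<^sup>n(\<chi> - 1) t\<^sup>n = 1 + (\<chi> - 1) t\<close>, and this series turns sums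
  into products, so \<open>\<Gamma>\<^sup>n\<close> is the \<open>n\<close>-th power of the augmentation ideal \<open>(X, Y)\<close>: the values of the
  polynomials in \<open>X\<close> and \<open>Y\<close> without terms of degree below \<open>n\<close>. Sending a polynomial to the classes
  of its homogeneous parts maps \<open>\<int>[x, y]\<close> onto the graded ring. The relations follow from
  \<open>(1 + X)\<^sup>4 = 1\<close> and \<open>(1 + Y)\<^sup>2 = 1\<close>. Conversely, if a form \<open>\<Sum>i. c\<^sub>i X\<^sup>i Y\<^bsup>n-i\<^esup>\<close> lies in \<open>\<Gamma>\<^bsup>n+1\<^esup>\<close>,
  then putting \<open>Y = 0\<close> (\<open>b = 1\<close>) and \<open>Y = X (X + 2)\<close> (\<open>b = a\<^sup>2\<close>) and evaluating at \<open>(0, -2)\<close> and \<open>(-2, -2)\<close>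
  shows that \<open>4\<close> divides \<open>c\<^sub>n\<close> and that \<open>2\<close> divides \<open>c\<^sub>0\<close>, \<open>c\<^bsub>n-1\<^esub>\<close> and \<open>\<Sum>i. c\<^sub>i\<close>; such a form is in the
  ideal of relations.

  The operations \<open>\<lambda>\<^sup>n\<close> exist because the series \<open>\<Sum>n. \<lambda>\<^sup>n(x)(g) t\<^sup>n\<close> is recovered from the values
  \<open>x(g\<^sup>k)\<close> by Newton's identities.
\<close>


section \<open>Traces of exterior powers\<close>

text \<open>The tests on a form are restrictions to cyclic subgroups. The curve \<open>Y = 0\<close>
  belongs to the subgroup of order 4 generated by (1, 0), the curve \<open>Y = X (X + 2)\<close> to
  the one generated by (1, 1), and the points (0, -2) and (-2, -2) are the elements (0, 1) and (2,
  1) of order 2. Along the second curve y is 2 x to first order, so the test there reads c_n + 2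
  c_(n-1) modulo 4, and this detects c_(n-1).

  Two obstacles shape the rest. \<open>lambda_op\<close> is a definite description, so no
  \<gamma>-operation can be computed before existence and uniqueness of the family are known.
  Existence requires that the character of every representation, not only of an irreducible one, is
  a virtual character; in place of complete reducibility this uses that multiplicities, being traces
  of idempotents, are integers. Moreover, a virtual character is the value of many polynomials:
  membership in \<Gamma>^(n+1) only provides some polynomial of higher order with the same values on
  the group, and the tests have to be insensitive to its choice.\<close>

lemma bij_betw_pick:
  assumes "I \<subseteq> {..<d}"
  shows "bij_betw (pick I) {0..<card I} I"
proof -
  have fin: "finite I" using assms finite_subset by blast
  have inj: "inj_on (pick I) {0..<card I}"
    by (rule inj_onI) (metis atLeastLessThan_iff card_pick)
  have "pick I ` {0..<card I} \<subseteq> I" by (auto intro: pick_in_set)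
  moreover have "card (pick I ` {0..<card I}) = card I" using inj by (simp add: card_image)
  ultimately have "pick I ` {0..<card I} = I" using fin by (simp add: card_subset_eq)
  with inj show ?thesis by (simp add: bij_betw_def)
qed

lemma bij_betw_map_permutation:
  assumes f: "bij_betw f A B"
  shows "bij_betw (map_permutation A f) {p. p permutes A} {p. p permutes B}"
proof -
  have inj: "inj_on f A" and im: "f ` A = B" using f by (auto simp: bij_betw_def)
  let ?g = "inv_into A f"
  have g: "bij_betw ?g B A" using f by (rule bij_betw_inv_into)
  show ?thesis
  proof (rule bij_betwI)
    show "map_permutation A f \<in> {p. p permutes A} \<rightarrow> {p. p permutes B}"
      using map_permutation_permutes[OF f] by auto
    show "map_permutation B ?g \<in> {p. p permutes B} \<rightarrow> {p. p permutes A}"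
      using map_permutation_permutes[OF g] by auto
    fix p assume "p \<in> {p. p permutes A}"
    then show "map_permutation B ?g (map_permutation A f p) = p"
      using map_permutation_compose_inv[OF f, of p ?g] inj by simp
  next
    fix p assume p: "p \<in> {p. p permutes B}"
    then show "map_permutation A f (map_permutation B ?g p) = p"
      using map_permutation_compose_inv[OF g, of p f] f by (simp add: bij_betw_inv_into_right)
  qed
qed

text \<open>The Leibniz formula of the submatrix runs over permutations of the positions
  \<open>0..<card I\<close>. The enumeration \<open>pick I\<close> transports them to permutations
  of \<open>I\<close> by conjugation, which preserves the sign. In this form a principal minor is
  visible inside the Leibniz sum of \<open>A\<close> itself.\<close>

lemma det_principal_submatrix:
  fixes A :: "'a :: comm_ring_1 mat"
  assumes A: "A \<in> carrier_mat d d" and I: "I \<subseteq> {..<d}"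
  shows "det (submatrix A I I) = (\<Sum>p | p permutes I. signof p * (\<Prod>i\<in>I. A $$ (i, p i)))"
proof -
  let ?k = "card I" and ?K = "{0..<card I}"
  have fin: "finite I" using I finite_subset by blast
  have dim: "{i. i < d \<and> i \<in> I} = I" using I by auto
  have sub: "submatrix A I I \<in> carrier_mat ?k ?k"
    using A dim by (auto simp: submatrix_def)
  have bij: "bij_betw (pick I) ?K I" by (rule bij_betw_pick[OF I])
  then have inj: "inj_on (pick I) ?K" by (simp add: bij_betw_def)
  have "det (submatrix A I I) = (\<Sum>p | p permutes ?K. signof p * (\<Prod>i=0..<?k. submatrix A I I $$ (i, p i)))"
    by (rule det_def'[OF sub])
  also have "\<dots> = (\<Sum>p | p permutes ?K. signof (map_permutation ?K (pick I) p) *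
                     (\<Prod>i\<in>I. A $$ (i, map_permutation ?K (pick I) p i)))"
  proof (rule sum.cong[OF refl])
    fix p assume "p \<in> {p. p permutes ?K}"
    then have p: "p permutes ?K" by simp
    have "(\<Prod>i=0..<?k. submatrix A I I $$ (i, p i)) = (\<Prod>i=0..<?k. A $$ (pick I i, pick I (p i)))"
    proof (rule prod.cong[OF refl])
      fix i assume i: "i \<in> ?K"
      then have "p i \<in> ?K" using p by (simp add: permutes_in_image)
      with i show "submatrix A I I $$ (i, p i) = A $$ (pick I i, pick I (p i))"
        using A dim by (simp add: submatrix_def)
    qed
    also have "\<dots> = (\<Prod>i=0..<?k. A $$ (pick I i, map_permutation ?K (pick I) p (pick I i)))"
      by (intro prod.cong refl) (simp add: map_permutation_apply[OF inj])
    also have "\<dots> = (\<Prod>i\<in>I. A $$ (i, map_permutation ?K (pick I) p i))"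
      by (rule prod.reindex_bij_betw[OF bij])
    finally show "signof p * (\<Prod>i=0..<?k. submatrix A I I $$ (i, p i)) =
      signof (map_permutation ?K (pick I) p) * (\<Prod>i\<in>I. A $$ (i, map_permutation ?K (pick I) p i))"
      using sign_map_permutation[OF inj p] by simp
  qed
  also have "\<dots> = (\<Sum>p | p permutes I. signof p * (\<Prod>i\<in>I. A $$ (i, p i)))"
    by (rule sum.reindex_bij_betw[OF bij_betw_map_permutation[OF bij],
          of "\<lambda>p. signof p * (\<Prod>i\<in>I. A $$ (i, p i))"])
  finally show ?thesis .
qed

text \<open>Expanding every factor \<open>t * A $$ (i, p i) + of_bool (i = p i)\<close> sorts the
  Leibniz terms by the set \<open>I\<close> of rows where the first summand is chosen. The other
  rows contribute Kronecker deltas, so only permutations fixing the complement of \<open>I\<close>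
  survive, and these make up the minor on \<open>I\<close>.\<close>

lemma det_one_plus_smult:
  fixes A :: "'a :: comm_ring_1 mat"
  assumes A: "A \<in> carrier_mat d d"
  shows "det (1\<^sub>m d + t \<cdot>\<^sub>m A) = (\<Sum>I\<in>Pow {0..<d}. t ^ card I * det (submatrix A I I))"
proof -
  let ?U = "{0..<d}"
  have M: "1\<^sub>m d + t \<cdot>\<^sub>m A \<in> carrier_mat d d" using A by auto
  have "det (1\<^sub>m d + t \<cdot>\<^sub>m A) =
     (\<Sum>p | p permutes ?U. signof p * (\<Prod>i\<in>?U. (1\<^sub>m d + t \<cdot>\<^sub>m A) $$ (i, p i)))"
    by (rule det_def'[OF M])
  also have "\<dots> = (\<Sum>p | p permutes ?U. signof p * (\<Prod>i\<in>?U. t * A $$ (i, p i) + of_bool (i = p i)))"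
  proof (intro sum.cong refl arg_cong2[where f="(*)"] prod.cong)
    fix p i assume "p \<in> {p. p permutes ?U}" and i: "i \<in> ?U"
    then have "p i \<in> ?U" by (simp add: permutes_in_image)
    with i A show "(1\<^sub>m d + t \<cdot>\<^sub>m A) $$ (i, p i) = t * A $$ (i, p i) + of_bool (i = p i)"
      by auto
  qed
  also have "\<dots> = (\<Sum>p | p permutes ?U. \<Sum>I\<in>Pow ?U.
      signof p * ((\<Prod>i\<in>I. t * A $$ (i, p i)) * (\<Prod>i\<in>?U - I. of_bool (i = p i))))"
    by (simp add: prod_add sum_distrib_left)
  also have "\<dots> = (\<Sum>I\<in>Pow ?U. \<Sum>p | p permutes ?U.
      signof p * ((\<Prod>i\<in>I. t * A $$ (i, p i)) * (\<Prod>i\<in>?U - I. of_bool (i = p i))))"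
    by (rule sum.swap)
  also have "\<dots> = (\<Sum>I\<in>Pow ?U. t ^ card I * det (submatrix A I I))"
  proof (rule sum.cong[OF refl])
    fix I assume "I \<in> Pow ?U"
    then have I: "I \<subseteq> ?U" and fin: "finite I" using finite_subset by auto
    have "(\<Sum>p | p permutes ?U.
        signof p * ((\<Prod>i\<in>I. t * A $$ (i, p i)) * (\<Prod>i\<in>?U - I. of_bool (i = p i)))) =
      (\<Sum>p | p permutes I. signof p * ((\<Prod>i\<in>I. t * A $$ (i, p i)) * (\<Prod>i\<in>?U - I. of_bool (i = p i))))"
    proof (rule sum.mono_neutral_right)
      show "finite {p. p permutes ?U}" by (rule finite_permutations) simp
      show "{p. p permutes I} \<subseteq> {p. p permutes ?U}" using I permutes_subset by blast
      show "\<forall>p\<in>{p. p permutes ?U} - {p. p permutes I}.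
        signof p * ((\<Prod>i\<in>I. t * A $$ (i, p i)) * (\<Prod>i\<in>?U - I. of_bool (i = p i))) = 0"
      proof
        fix p assume p: "p \<in> {p. p permutes ?U} - {p. p permutes I}"
        have "\<exists>i\<in>?U - I. i \<noteq> p i"
        proof (rule ccontr)
          assume "\<not> ?thesis"
          then have "p permutes I" using p by (intro permutes_superset[of p ?U I]) auto
          with p show False by simp
        qed
        then have "(\<Prod>i\<in>?U - I. of_bool (i = p i)) = (0 :: 'a)"
          by (intro prod_zero) auto
        then show "signof p * ((\<Prod>i\<in>I. t * A $$ (i, p i)) * (\<Prod>i\<in>?U - I. of_bool (i = p i))) = 0"
          by simp
      qed
    qed
    also have "\<dots> = (\<Sum>p | p permutes I. t ^ card I * (signof p * (\<Prod>i\<in>I. A $$ (i, p i))))"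
    proof (rule sum.cong[OF refl])
      fix p assume "p \<in> {p. p permutes I}"
      then have "(\<Prod>i\<in>?U - I. of_bool (i = p i)) = (1 :: 'a)"
        by (intro prod.neutral) (auto simp: permutes_not_in)
      then show "signof p * ((\<Prod>i\<in>I. t * A $$ (i, p i)) * (\<Prod>i\<in>?U - I. of_bool (i = p i))) =
        t ^ card I * (signof p * (\<Prod>i\<in>I. A $$ (i, p i)))"
        by (simp add: prod.distrib ac_simps)
    qed
    also have "\<dots> = t ^ card I * det (submatrix A I I)"
      using det_principal_submatrix[OF A, of I] I by (simp add: sum_distrib_left lessThan_atLeast0)
    finally show "(\<Sum>p | p permutes ?U.
        signof p * ((\<Prod>i\<in>I. t * A $$ (i, p i)) * (\<Prod>i\<in>?U - I. of_bool (i = p i)))) =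
        t ^ card I * det (submatrix A I I)" .
  qed
  finally show ?thesis .
qed

lemma sum_index_subsets:
  "(\<Sum>I\<leftarrow>index_subsets n d. f I) = (\<Sum>I | I \<subseteq> {0..<d} \<and> card I = n. f I)"
proof -
  have d: "distinct (map set (subseqs [0..<d]))"
    by (rule distinct_set_subseqs) simp
  then have "distinct (index_subsets n d)"
    unfolding index_subsets_def by (rule distinct_map_filter)
  moreover have "set (index_subsets n d) = {I. I \<subseteq> {0..<d} \<and> card I = n}"
  proof -
    have "set (index_subsets n d) = set ` {xs \<in> set (subseqs [0..<d]). card (set xs) = n}"
      by (auto simp: index_subsets_def distinct_card subseqs_distinctD intro!: image_eqI)
    also have "\<dots> = {I \<in> set ` set (subseqs [0..<d]). card I = n}" by auto
    also have "\<dots> = {I. I \<subseteq> {0..<d} \<and> card I = n}" by (auto simp: subseqs_powset)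
    finally show ?thesis .
  qed
  ultimately show ?thesis by (simp add: sum_list_distinct_conv_sum_set)
qed

lemma mat_trace_ext_power:
  fixes A :: "'a :: comm_ring_1 mat"
  assumes "A \<in> carrier_mat d d"
  shows "mat_trace (ext_power n A) = (\<Sum>I | I \<subseteq> {0..<d} \<and> card I = n. det (submatrix A I I))"
proof -
  have "mat_trace (ext_power n A) = (\<Sum>I\<leftarrow>index_subsets n d. det (submatrix A I I))"
    using assms by (simp add: mat_trace_def ext_power_def Let_def sum_list_sum_nth lessThan_atLeast0)
  then show ?thesis by (simp only: sum_index_subsets)
qed

lemma det_one_plus_smult_ext_power:
  fixes A :: "'a :: comm_ring_1 mat"
  assumes A: "A \<in> carrier_mat d d"
  shows "det (1\<^sub>m d + t \<cdot>\<^sub>m A) = (\<Sum>n\<le>d. mat_trace (ext_power n A) * t ^ n)"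
proof -
  have card_le: "card I \<le> d" if "I \<subseteq> {0..<d}" for I
    using card_mono[OF _ that] by simp
  have "det (1\<^sub>m d + t \<cdot>\<^sub>m A) = (\<Sum>I\<in>Pow {0..<d}. t ^ card I * det (submatrix A I I))"
    by (rule det_one_plus_smult[OF A])
  also have "\<dots> = (\<Sum>n\<le>d. \<Sum>I | I \<in> Pow {0..<d} \<and> card I = n. t ^ card I * det (submatrix A I I))"
    by (rule sum.group[symmetric]) (auto intro: card_le)
  also have "\<dots> = (\<Sum>n\<le>d. mat_trace (ext_power n A) * t ^ n)"
    by (simp add: mat_trace_ext_power[OF A] sum_distrib_left mult.commute)
  finally show ?thesis .
qed

lemma mat_trace_ext_power_eq_0:
  assumes A: "A \<in> carrier_mat d d" and n: "n > d"
  shows "mat_trace (ext_power n A) = 0"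
proof -
  have "{I. I \<subseteq> {0..<d} \<and> card I = n} = {}"
    using n by (auto dest!: card_mono[OF finite_atLeastLessThan])
  then show ?thesis by (simp only: mat_trace_ext_power[OF A] sum.empty)
qed

section \<open>Eigenvalue lists read off a triangular form\<close>

lemma mat_trace_mult_commute:
  fixes A B :: "'a :: comm_ring_1 mat"
  assumes "A \<in> carrier_mat n m" "B \<in> carrier_mat m n"
  shows "mat_trace (A * B) = mat_trace (B * A)"
proof -
  have "mat_trace (A * B) = (\<Sum>i<n. \<Sum>j<m. A $$ (i, j) * B $$ (j, i))"
    using assms by (simp add: mat_trace_def scalar_prod_def lessThan_atLeast0)
  also have "\<dots> = (\<Sum>j<m. \<Sum>i<n. A $$ (i, j) * B $$ (j, i))" by (rule sum.swap)
  also have "\<dots> = mat_trace (B * A)"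
    using assms by (simp add: mat_trace_def scalar_prod_def lessThan_atLeast0 mult.commute)
  finally show ?thesis .
qed

lemma mat_trace_similar:
  fixes A B :: "'a :: comm_ring_1 mat"
  assumes "similar_mat_wit A B P Q"
  shows "mat_trace A = mat_trace B"
proof -
  define n where "n = dim_row A"
  note w = similar_mat_witD[OF n_def assms]
  have "mat_trace A = mat_trace (P * (B * Q))"
    using w by (simp add: assoc_mult_mat)
  also have "\<dots> = mat_trace (B * Q * P)"
    using w by (intro mat_trace_mult_commute[of _ n n]) auto
  also have "B * Q * P = B"
    using w by (simp add: assoc_mult_mat[of _ n n _ n _ n])
  finally show ?thesis .
qed

lemma upper_triangular_mult:
  fixes A B :: "'a :: comm_ring_1 mat"
  assumes A: "A \<in> carrier_mat n n" "upper_triangular A"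
    and B: "B \<in> carrier_mat n n" "upper_triangular B"
  shows "upper_triangular (A * B)" "i < n \<Longrightarrow> (A * B) $$ (i, i) = A $$ (i, i) * B $$ (i, i)"
proof -
  have entry: "(A * B) $$ (i, j) = (\<Sum>k<n. A $$ (i, k) * B $$ (k, j))" if "i < n" "j < n" for i j
    using that A(1) B(1) by (simp add: scalar_prod_def lessThan_atLeast0)
  have zero: "A $$ (i, k) = 0 \<or> B $$ (k, j) = 0" if "i < n" "j < n" "k < n" "j \<le> i" "k \<noteq> i \<or> k \<noteq> j" for i j k
  proof (cases "k < i")
    case True
    then show ?thesis using A that by (auto intro: upper_triangularD)
  next
    case False
    then have "j < k" using that by auto
    then show ?thesis using B that by (auto intro: upper_triangularD)
  qed
  show "upper_triangular (A * B)"
  proof (rule upper_triangularI)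
    fix i j assume "j < i" "i < dim_row (A * B)"
    then have ij: "i < n" "j < n" "j < i" using A by auto
    show "(A * B) $$ (i, j) = 0"
      unfolding entry[OF ij(1,2)] using zero[of i j] ij by (intro sum.neutral) fastforce
  qed
  show "(A * B) $$ (i, i) = A $$ (i, i) * B $$ (i, i)" if i: "i < n"
  proof -
    have "(A * B) $$ (i, i) = (\<Sum>k\<in>{i}. A $$ (i, k) * B $$ (k, i))"
      unfolding entry[OF i i] using zero[of i i] i by (intro sum.mono_neutral_right) fastforce+
    then show ?thesis by simp
  qed
qed

lemma upper_triangular_pow:
  fixes A :: "'a :: comm_ring_1 mat"
  assumes A: "A \<in> carrier_mat n n" "upper_triangular A"
  shows "upper_triangular (A ^\<^sub>m k) \<and> (\<forall>i<n. (A ^\<^sub>m k) $$ (i, i) = (A $$ (i, i)) ^ k)"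
proof (induction k)
  case 0
  then show ?case using A by auto
next
  case (Suc k)
  then show ?case
    using upper_triangular_mult[of "A ^\<^sub>m k" n A] A by auto
qed

text \<open>One list \<open>es\<close>, the diagonal of a Schur triangular form \<open>B\<close>,
  serves for all three conclusions; this links exterior powers, seen by the determinant, to power
  sums, seen by the traces of powers. For the last conclusion the diagonals of
  \<open>B ^\<^sub>m 2\<close> and \<open>c \<cdot>\<^sub>m B\<close> are compared: each entry
  solves e^2 = c e.\<close>

lemma complex_mat_eigenvalues:
  fixes A :: "complex mat"
  assumes A: "A \<in> carrier_mat d d"
  obtains es where
    "\<And>t. det (1\<^sub>m d + t \<cdot>\<^sub>m A) = (\<Prod>e\<leftarrow>es. 1 + t * e)"
    "\<And>k. mat_trace (A ^\<^sub>m k) = (\<Sum>e\<leftarrow>es. e ^ k)"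
    "\<And>c. A * A = c \<cdot>\<^sub>m A \<Longrightarrow> set es \<subseteq> {0, c}"
proof -
  obtain es where cp: "char_poly A = (\<Prod>a\<leftarrow>es. [:- a, 1:])"
    using char_poly_factorized[OF A] by blast
  obtain B P Q where schur: "schur_decomposition A es = (B, P, Q)"
    by (cases "schur_decomposition A es")
  from schur_decomposition[OF A cp schur]
  have sim: "similar_mat_wit A B P Q" and ut: "upper_triangular B" and diag: "diag_mat B = es" by auto
  note w = similar_mat_witD2[OF A sim]
  have B: "B \<in> carrier_mat d d" by (rule w(5))
  have es: "es = map (\<lambda>i. B $$ (i, i)) [0..<d]"
    using diag B by (simp add: diag_mat_def)
  show thesis
  proof (rule that)
    fix t
    have "1\<^sub>m d + t \<cdot>\<^sub>m A = P * (1\<^sub>m d + t \<cdot>\<^sub>m B) * Q"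
    proof -
      have "P * (1\<^sub>m d + t \<cdot>\<^sub>m B) * Q = (P * 1\<^sub>m d + P * (t \<cdot>\<^sub>m B)) * Q"
        using w by (simp add: mult_add_distrib_mat[of _ d d _ d])
      also have "\<dots> = P * 1\<^sub>m d * Q + P * (t \<cdot>\<^sub>m B) * Q"
        using w by (intro add_mult_distrib_mat[of _ d d _ _ d]) auto
      also have "\<dots> = 1\<^sub>m d + t \<cdot>\<^sub>m (P * B * Q)"
        using w by (simp add: mult_smult_distrib[of _ d d _ d] mult_smult_assoc_mat[of _ d d _ d])
      finally show ?thesis using w by simp
    qed
    then have "similar_mat (1\<^sub>m d + t \<cdot>\<^sub>m A) (1\<^sub>m d + t \<cdot>\<^sub>m B)"
      using w by (intro similar_matI[of _ _ P Q d]) auto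
    then have "det (1\<^sub>m d + t \<cdot>\<^sub>m A) = det (1\<^sub>m d + t \<cdot>\<^sub>m B)" by (rule det_similar)
    also have "\<dots> = prod_list (diag_mat (1\<^sub>m d + t \<cdot>\<^sub>m B))"
    proof (rule det_upper_triangular)
      show "upper_triangular (1\<^sub>m d + t \<cdot>\<^sub>m B)"
        using ut B by (auto intro!: upper_triangularI dest: upper_triangularD)
    qed (use B in auto)
    also have "diag_mat (1\<^sub>m d + t \<cdot>\<^sub>m B) = map (\<lambda>e. 1 + t * e) es"
      using B by (auto simp: diag_mat_def es)
    finally show "det (1\<^sub>m d + t \<cdot>\<^sub>m A) = (\<Prod>e\<leftarrow>es. 1 + t * e)" .
  next
    fix k
    have "mat_trace (A ^\<^sub>m k) = mat_trace (B ^\<^sub>m k)"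
      by (rule mat_trace_similar[OF similar_mat_wit_pow[OF sim]])
    also have "\<dots> = (\<Sum>i<d. (B $$ (i, i)) ^ k)"
      using B upper_triangular_pow[OF B ut, of k] by (simp add: mat_trace_def)
    finally show "mat_trace (A ^\<^sub>m k) = (\<Sum>e\<leftarrow>es. e ^ k)"
      by (simp add: es comp_def interv_sum_list_conv_sum_set_nat lessThan_atLeast0)
  next
    fix c assume AA: "A * A = c \<cdot>\<^sub>m A"
    have B': "B = Q * A * P"
      using similar_mat_witD2(3)[OF B similar_mat_wit_sym[OF sim]] .
    have "similar_mat_wit (A ^\<^sub>m 2) (B ^\<^sub>m 2) P Q" by (rule similar_mat_wit_pow[OF sim])
    then have "B ^\<^sub>m 2 = Q * (A ^\<^sub>m 2) * P"
      using similar_mat_witD2(3)[OF _ similar_mat_wit_sym, of "B ^\<^sub>m 2" d d] B by auto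
    also have "A ^\<^sub>m 2 = c \<cdot>\<^sub>m A" using A AA by (simp add: numeral_2_eq_2)
    also have "Q * (c \<cdot>\<^sub>m A) * P = c \<cdot>\<^sub>m (Q * A * P)"
      using w by (simp add: mult_smult_distrib[of _ d d _ d] mult_smult_assoc_mat[of _ d d _ d])
    finally have "B ^\<^sub>m 2 = c \<cdot>\<^sub>m B" using B' by simp
    then have "(B $$ (i, i)) ^ 2 = c * B $$ (i, i)" if "i < d" for i
      using upper_triangular_pow[OF B ut, of 2] that B by auto
    then show "set es \<subseteq> {0, c}"
      by (force simp: es power2_eq_square)
  qed
qed

text \<open>Both sides come from polynomials that agree at every complex t by the determinant
  formula, hence coincide. Traces in degrees above \<open>d\<close> vanish, so the power series is
  that polynomial.\<close>

lemma ext_power_eigenvalues: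
  fixes A :: "complex mat"
  assumes A: "A \<in> carrier_mat d d"
    and es: "\<And>t. det (1\<^sub>m d + t \<cdot>\<^sub>m A) = (\<Prod>e\<leftarrow>es. 1 + t * e)"
  shows "Abs_fps (\<lambda>n. mat_trace (ext_power n A)) = (\<Prod>e\<leftarrow>es. 1 + fps_const e * fps_X)"
proof -
  define p where "p = (\<Sum>n\<le>d. monom (mat_trace (ext_power n A)) n)"
  have "poly p t = poly (\<Prod>e\<leftarrow>es. [:1, e:]) t" for t
  proof -
    have "poly p t = det (1\<^sub>m d + t \<cdot>\<^sub>m A)"
      by (simp add: det_one_plus_smult_ext_power[OF A] p_def poly_sum poly_monom)
    also have "\<dots> = poly (\<Prod>e\<leftarrow>es. [:1, e:]) t"
      unfolding es by (induction es) (auto simp: algebra_simps)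
    finally show ?thesis .
  qed
  then have "p = (\<Prod>e\<leftarrow>es. [:1, e:])" by (intro poly_eqI_degree_lead_coeff poly_ext) auto
  moreover have "Abs_fps (\<lambda>n. mat_trace (ext_power n A)) = fps_of_poly p"
  proof (rule fps_ext)
    fix n
    show "fps_nth (Abs_fps (\<lambda>n. mat_trace (ext_power n A))) n = fps_nth (fps_of_poly p) n"
      by (cases "n \<le> d") (auto simp: p_def coeff_sum mat_trace_ext_power_eq_0[OF A])
  qed
  moreover have "fps_of_poly (\<Prod>e\<leftarrow>es. [:1, e:]) = (\<Prod>e\<leftarrow>es. 1 + fps_const e * fps_X)"
  proof (induction es)
    case (Cons e es)
    have "fps_of_poly [:1, e:] = 1 + fps_const e * fps_X"
      by (simp add: fps_of_poly_pCons)
    with Cons show ?case by (simp only: list.map prod_list.Cons fps_of_poly_mult)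
  qed simp
  ultimately show ?thesis by simp
qed

text \<open>\<open>n\<close> counts the nonzero eigenvalues, all of which equal \<open>c\<close>.
  With \<open>c\<close> the order of a group this makes multiplicities integers.\<close>

lemma mat_trace_scaled_idempotent:
  fixes A :: "complex mat"
  assumes A: "A \<in> carrier_mat d d" and "A * A = c \<cdot>\<^sub>m A"
  obtains n where "mat_trace A = of_nat n * c"
proof -
  obtain es where tr: "\<And>k. mat_trace (A ^\<^sub>m k) = (\<Sum>e\<leftarrow>es. e ^ k)" and "set es \<subseteq> {0, c}"
    using complex_mat_eigenvalues[OF A] assms(2) by metis
  from this(2) have "\<exists>n. (\<Sum>e\<leftarrow>es. e) = of_nat n * c"
  proof (induction es)
    case Nil
    show ?case by (rule exI[of _ 0]) simp
  next
    case (Cons e es)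
    then obtain n where n: "(\<Sum>e\<leftarrow>es. e) = of_nat n * c" by auto
    show ?case
    proof (cases "e = 0")
      case True
      with n show ?thesis by auto
    next
      case False
      with Cons.prems n show ?thesis by (intro exI[of _ "Suc n"]) (auto simp: algebra_simps)
    qed
  qed
  with tr[of 1] A that show thesis by auto
qed


section \<open>Generating series of the lambda operations\<close>

text \<open>If the \<open>s k\<close> are the power sums of e_1, ..., e_d, this is the expansion of
  \<Sum> e_i / (1 + e_i t), the logarithmic derivative of the product of the 1 + e_i t; hence the
  shift to \<open>Suc k\<close>.\<close>

definition power_sum_series :: "(nat \<Rightarrow> complex) \<Rightarrow> complex fps" where
  "power_sum_series s = Abs_fps (\<lambda>k. (- 1) ^ k * s (Suc k))"

text \<open>
  If \<open>s k\<close> is the \<open>k\<close>-th power sum of \<open>e\<^sub>1, \<dots>, e\<^sub>d\<close>, then this is the product of the \<open>1 + e\<^sub>i t\<close>;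
  the product is recovered from its logarithmic derivative.
\<close>

definition newton_series :: "(nat \<Rightarrow> complex) \<Rightarrow> complex fps" where
  "newton_series s = fps_exp 1 oo fps_integral0 (power_sum_series s)"

lemma newton_series_nth_0 [simp]: "fps_nth (newton_series s) 0 = 1"
  by (simp add: newton_series_def)

lemma newton_series_deriv: "fps_deriv (newton_series s) = power_sum_series s * newton_series s"
  by (simp add: newton_series_def fps_compose_deriv fps_deriv_fps_integral mult.commute)

text \<open>Coefficient m of the equation expresses (m + 1) F_(m+1) through lower coefficients of F,
  and m + 1 can be divided out in characteristic zero. When S is a power sum series, this recursion
  is Newton's identities.\<close>

lemma fps_linear_ODE_unique:
  fixes F G S :: "'a :: field_char_0 fps"
  assumes "fps_deriv F = S * F" "fps_deriv G = S * G" "fps_nth F 0 = fps_nth G 0"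
  shows "F = G"
proof (rule fps_ext)
  fix n
  show "fps_nth F n = fps_nth G n"
  proof (induction n rule: less_induct)
    case (less n)
    show ?case
    proof (cases n)
      case (Suc m)
      have "of_nat (Suc m) * fps_nth F (Suc m) = (\<Sum>i=0..m. fps_nth S i * fps_nth F (m - i))"
        using arg_cong[OF assms(1), of "\<lambda>H. fps_nth H m"] by (simp add: fps_mult_nth)
      also have "\<dots> = (\<Sum>i=0..m. fps_nth S i * fps_nth G (m - i))"
        by (intro sum.cong) (auto simp: less Suc)
      also have "\<dots> = of_nat (Suc m) * fps_nth G (Suc m)"
        using arg_cong[OF assms(2), of "\<lambda>H. fps_nth H m"] by (simp add: fps_mult_nth)
      finally show ?thesis using Suc by (simp del: of_nat_Suc)
    qed (simp add: assms)
  qed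
qed

lemma newton_series_unique:
  "fps_deriv F = power_sum_series s * F \<Longrightarrow> fps_nth F 0 = 1 \<Longrightarrow> newton_series s = F"
  by (rule fps_linear_ODE_unique[OF newton_series_deriv]) auto

lemma newton_series_zero: "newton_series (\<lambda>k. 0) = 1"
  by (rule newton_series_unique) (auto simp: power_sum_series_def fps_eq_iff)

lemma newton_series_add: "newton_series (\<lambda>k. s k + t k) = newton_series s * newton_series t"
proof (rule newton_series_unique)
  have "power_sum_series (\<lambda>k. s k + t k) = power_sum_series s + power_sum_series t"
    by (simp add: power_sum_series_def fps_eq_iff algebra_simps)
  then show "fps_deriv (newton_series s * newton_series t) =
      power_sum_series (\<lambda>k. s k + t k) * (newton_series s * newton_series t)"
    by (simp add: newton_series_deriv algebra_simps)
qed simp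

lemma newton_series_uminus: "newton_series (\<lambda>k. - s k) * newton_series s = 1"
  using newton_series_add[of "\<lambda>k. - s k" s] by (simp add: newton_series_zero)

lemma newton_series_power: "newton_series (\<lambda>k. c ^ k) = 1 + fps_const c * fps_X"
proof (rule newton_series_unique)
  have "power_sum_series (\<lambda>k. c ^ k) * (1 + fps_const c * fps_X) = fps_const c"
  proof (rule fps_ext)
    fix n
    let ?S = "power_sum_series (\<lambda>k. c ^ k)"
    have "?S * (1 + fps_const c * fps_X) = ?S + fps_const c * (fps_X * ?S)"
      by (simp add: algebra_simps)
    then show "fps_nth (?S * (1 + fps_const c * fps_X)) n = fps_nth (fps_const c) n"
      by (cases n) (auto simp: power_sum_series_def)
  qed
  then show "fps_deriv (1 + fps_const c * fps_X) =
      power_sum_series (\<lambda>k. c ^ k) * (1 + fps_const c * fps_X)" by simp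
qed simp

lemma newton_series_sum_list:
  "newton_series (\<lambda>k. \<Sum>e\<leftarrow>es. e ^ k) = (\<Prod>e\<leftarrow>es. 1 + fps_const e * fps_X)"
  by (induction es) (simp_all add: newton_series_zero newton_series_add newton_series_power)

lemma newton_series_of_nat: "newton_series (\<lambda>k. of_nat n) = (1 + fps_X) ^ n"
proof (induction n)
  case (Suc n)
  have "newton_series (\<lambda>k. of_nat (Suc n)) = newton_series (\<lambda>k. 1 ^ k + of_nat n)"
    by simp
  also have "\<dots> = (1 + fps_X) * (1 + fps_X) ^ n"
    by (simp only: newton_series_add newton_series_power Suc) simp
  finally show ?case by simp
qed (simp add: newton_series_zero)

lemma newton_series_nth_1: "fps_nth (newton_series s) 1 = s 1"
proof -
  have "fps_nth (newton_series s) (Suc 0) = fps_nth (fps_deriv (newton_series s)) 0" by simp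
  also have "\<dots> = s 1"
    unfolding newton_series_deriv by (simp add: power_sum_series_def)
  finally show ?thesis by simp
qed

section \<open>From \<lambda>-series to \<gamma>-series\<close>

abbreviation gamma_subst :: "complex fps" where
  "gamma_subst \<equiv> fps_X * inverse (1 - fps_X)"

text \<open>Relates \<open>\<gamma>\<^sup>n(x) = \<lambda>\<^sup>n(x + n - 1)\<close> to the generating series \<open>\<Sum>n. \<gamma>\<^sup>n(x) t\<^sup>n\<close>, which is \<open>\<Sum>n. \<lambda>\<^sup>n(x) (t / (1 - t))\<^sup>n\<close>.\<close>

lemma fps_nth_compose_gamma_subst:
  assumes "n > 0"
  shows "fps_nth (F oo gamma_subst) n = fps_nth (F * (1 + fps_X) ^ (n - 1)) n"
proof -
  have eq: "fps_nth (gamma_subst ^ k) n = fps_nth ((1 + fps_X) ^ (n - 1)) (n - k)" if "k \<le> n" for k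
  proof (cases "k = 0")
    case True
    have "fps_nth ((1 + fps_X :: complex fps) ^ (n - 1)) n = of_nat (n - 1 choose n)"
      by (simp add: fps_binomial_of_nat[symmetric] binomial_gbinomial)
    then show ?thesis using True assms by (simp add: binomial_eq_0)
  next
    case False
    have "gamma_subst ^ k = fps_X ^ k * inverse ((1 - fps_const 1 * fps_X) ^ k)"
      by (simp add: power_mult_distrib fps_inverse_power)
    also have "\<dots> = fps_X ^ k * Abs_fps (\<lambda>j. of_nat ((k + j - 1) choose j))"
      using False by (subst one_minus_const_fps_X_neg_power') simp_all
    finally have "fps_nth (gamma_subst ^ k) n = of_nat ((n - 1) choose (n - k))"
      using that by (simp add: fps_X_power_mult_nth)
    also have "\<dots> = fps_nth ((1 + fps_X :: complex fps) ^ (n - 1)) (n - k)"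
      by (simp add: fps_binomial_of_nat[symmetric] binomial_gbinomial)
    finally show ?thesis .
  qed
  have "fps_nth (F oo gamma_subst) n = (\<Sum>k=0..n. fps_nth F k * fps_nth (gamma_subst ^ k) n)"
    by (simp add: fps_compose_nth)
  also have "\<dots> = fps_nth (F * (1 + fps_X) ^ (n - 1)) n"
    by (simp add: fps_mult_nth eq)
  finally show ?thesis .
qed

text \<open>A character of degree one has \<lambda>-series 1 + c t, and subtracting the trivial
  character divides by 1 + t. In (1 + c t) / (1 + t) the substitution t / (1 - t) yields 1 + (c - 1)
  t.\<close>

lemma gamma_series_line_element:
  "newton_series (\<lambda>k. c ^ k - 1) oo gamma_subst = 1 + fps_const (c - 1) * fps_X"
proof -
  let ?u = "1 - fps_X :: complex fps"
  have u: "inverse ?u * ?u = 1" by (intro inverse_mult_eq_1) simp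
  have g0: "fps_nth gamma_subst 0 = 0" by simp
  have 1: "1 + gamma_subst = inverse ?u"
    using u by (simp add: algebra_simps)
  have "newton_series (\<lambda>k. c ^ k - 1) * newton_series (\<lambda>k. of_nat 1) = newton_series (\<lambda>k. c ^ k)"
    by (subst newton_series_add[symmetric]) simp
  then have "newton_series (\<lambda>k. c ^ k - 1) * (1 + fps_X) = 1 + fps_const c * fps_X"
    by (simp only: newton_series_of_nat newton_series_power) simp
  then have "(newton_series (\<lambda>k. c ^ k - 1) * (1 + fps_X)) oo gamma_subst =
      (1 + fps_const c * fps_X) oo gamma_subst" by simp
  then have "(newton_series (\<lambda>k. c ^ k - 1) oo gamma_subst) * (1 + gamma_subst) = 1 + fps_const c * gamma_subst"
    by (simp add: fps_compose_mult_distrib[OF g0] fps_compose_add_distrib)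
  then have "(newton_series (\<lambda>k. c ^ k - 1) oo gamma_subst) * (inverse ?u * ?u) = (1 + fps_const c * gamma_subst) * ?u"
    unfolding 1 by (simp add: mult.assoc)
  also have "\<dots> = ?u + fps_const c * fps_X * (inverse ?u * ?u)"
    by (simp add: algebra_simps)
  finally show ?thesis unfolding u
    by (simp add: algebra_simps fps_const_sub[symmetric] del: fps_const_sub)
qed

lemma fps_inverse_linear:
  fixes F :: "complex fps"
  assumes "F * (1 + fps_const c * fps_X) = 1"
  shows "F = Abs_fps (\<lambda>n. (- c) ^ n)"
proof -
  let ?u = "1 + fps_const c * fps_X" and ?S = "Abs_fps (\<lambda>n. (- c) ^ n)"
  have "?u * ?S = 1"
  proof (rule fps_ext)
    fix n
    have "?u * ?S = ?S + fps_const c * (fps_X * ?S)"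
      by (simp add: algebra_simps)
    then show "fps_nth (?u * ?S) n = fps_nth 1 n"
      by (cases n) auto
  qed
  then have "F = F * ?u * ?S" by (simp only: mult.assoc mult_1_right)
  then show ?thesis by (simp only: assms mult_1_left)
qed

lemma newton_series_uminus_power: "newton_series (\<lambda>k. - (c ^ k)) = Abs_fps (\<lambda>n. (- c) ^ n)"
  using newton_series_uminus[of "\<lambda>k. c ^ k"]
  by (intro fps_inverse_linear) (simp only: newton_series_power)

text \<open>The inverse of the series 1 + (c - 1) t. It says \<gamma>^n(1 - \<chi>) = (1 -
  \<chi>)^n, and this n-th power keeps the negative of a line element compatible with the
  filtration.\<close>

lemma gamma_series_uminus_line_element:
  "newton_series (\<lambda>k. - (c ^ k - 1)) oo gamma_subst = Abs_fps (\<lambda>n. (1 - c) ^ n)"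
proof -
  have g0: "fps_nth gamma_subst 0 = 0" by simp
  have "(newton_series (\<lambda>k. - (c ^ k - 1)) oo gamma_subst) * (newton_series (\<lambda>k. c ^ k - 1) oo gamma_subst) = 1"
    using newton_series_uminus[of "\<lambda>k. c ^ k - 1"]
    by (simp add: fps_compose_mult_distrib[OF g0, symmetric])
  then show ?thesis
    using fps_inverse_linear[of _ "c - 1"] by (simp only: gamma_series_line_element minus_diff_eq)
qed


section \<open>Lambda operations on virtual characters\<close>

lemma fun_ring_simps:
  "carrier (fun_ring G) = (carrier G \<rightarrow>\<^sub>E UNIV)"
  "x \<otimes>\<^bsub>fun_ring G\<^esub> y = (\<lambda>g\<in>carrier G. x g * y g)"
  "x \<oplus>\<^bsub>fun_ring G\<^esub> y = (\<lambda>g\<in>carrier G. x g + y g)"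
  "\<one>\<^bsub>fun_ring G\<^esub> = (\<lambda>g\<in>carrier G. 1)"
  "\<zero>\<^bsub>fun_ring G\<^esub> = (\<lambda>g\<in>carrier G. 0)"
  by (simp_all add: fun_ring_def)

lemma char_ring_simps:
  "carrier (char_ring G) = generate (add_monoid (fun_ring G)) (irr_chars G)"
  "x \<otimes>\<^bsub>char_ring G\<^esub> y = (\<lambda>g\<in>carrier G. x g * y g)"
  "x \<oplus>\<^bsub>char_ring G\<^esub> y = (\<lambda>g\<in>carrier G. x g + y g)"
  "\<one>\<^bsub>char_ring G\<^esub> = (\<lambda>g\<in>carrier G. 1)"
  "\<zero>\<^bsub>char_ring G\<^esub> = (\<lambda>g\<in>carrier G. 0)"
  by (simp_all add: char_ring_def fun_ring_def)

lemma abelian_group_fun_ring: "abelian_group (fun_ring G)"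
proof (rule abelian_groupI)
  fix x assume "x \<in> carrier (fun_ring G)"
  then show "\<exists>y\<in>carrier (fun_ring G). y \<oplus>\<^bsub>fun_ring G\<^esub> x = \<zero>\<^bsub>fun_ring G\<^esub>"
    by (intro bexI[of _ "\<lambda>g\<in>carrier G. - x g"]) (auto simp: fun_ring_simps fun_eq_iff)
qed (auto simp: fun_ring_simps fun_eq_iff PiE_def extensional_def algebra_simps)

lemma irr_chars_subset: "irr_chars G \<subseteq> carrier (fun_ring G)"
  by (auto simp: irr_chars_def rep_char_def fun_ring_simps)

lemma carrier_char_ring_subset: "carrier (char_ring G) \<subseteq> carrier G \<rightarrow>\<^sub>E UNIV"
proof -
  interpret F: abelian_group "fun_ring G" by (rule abelian_group_fun_ring)
  show ?thesis
    using group.generate_incl[OF F.a_group, of "irr_chars G"] irr_chars_subset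
    by (auto simp: char_ring_simps fun_ring_simps)
qed

lemma fun_ring_a_inv:
  assumes "x \<in> carrier (fun_ring G)"
  shows "inv\<^bsub>add_monoid (fun_ring G)\<^esub> x = (\<lambda>g\<in>carrier G. - x g)"
proof -
  interpret F: abelian_group "fun_ring G" by (rule abelian_group_fun_ring)
  have "\<ominus>\<^bsub>fun_ring G\<^esub> x = (\<lambda>g\<in>carrier G. - x g)"
    using assms by (intro F.minus_equality) (auto simp: fun_ring_simps fun_eq_iff)
  then show ?thesis by (simp add: a_inv_def)
qed

text \<open>A generated subgroup inverts generators only, so the negation case is confined to
  irreducible characters. For an abelian group the \<lambda>- and \<gamma>-series of their negatives
  are explicit geometric series.\<close>

lemma char_ring_induct [consumes 1, case_names zero irr uminus add]:
  assumes "x \<in> carrier (char_ring G)"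
    and "P (\<lambda>g\<in>carrier G. 0)"
    and irr: "\<And>\<chi>. \<chi> \<in> irr_chars G \<Longrightarrow> P \<chi>"
    and uminus: "\<And>\<chi>. \<chi> \<in> irr_chars G \<Longrightarrow> P (\<lambda>g\<in>carrier G. - \<chi> g)"
    and add: "\<And>x y. x \<in> carrier (char_ring G) \<Longrightarrow> y \<in> carrier (char_ring G) \<Longrightarrow> P x \<Longrightarrow> P y \<Longrightarrow>
       P (\<lambda>g\<in>carrier G. x g + y g)"
  shows "P x"
  using assms(1) unfolding char_ring_simps
proof (induction rule: generate.induct)
  case one
  show ?case using assms(2) by (simp add: fun_ring_simps restrict_def)
next
  case (inv h)
  then have "h \<in> carrier (fun_ring G)" using irr_chars_subset by auto
  with uminus[OF inv] show ?case by (simp only: fun_ring_a_inv)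
next
  case (eng h1 h2)
  have "P (\<lambda>g\<in>carrier G. h1 g + h2 g)"
    using eng by (intro add) (auto simp: char_ring_simps)
  then show ?case by (simp add: fun_ring_simps restrict_def)
qed (rule irr)

lemma GL_group: "group (GL d)"
proof -
  interpret M: ring "ring_mat TYPE(complex) d ()" by (rule ring_mat)
  show ?thesis unfolding GL_def by (rule M.units_group)
qed

lemma carrier_GL: "carrier (GL d) \<subseteq> carrier_mat d d"
  by (auto simp: GL_def units_of_def Units_def ring_mat_simps)

section \<open>Existence and uniqueness of the \<lambda>-operations\<close>

context group
begin

lemma is_rep_carrier: "is_rep G d \<rho> \<Longrightarrow> g \<in> carrier G \<Longrightarrow> \<rho> g \<in> carrier_mat d d"
  using carrier_GL by (auto simp: is_rep_def hom_def)

lemma is_rep_mult: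
  "is_rep G d \<rho> \<Longrightarrow> g \<in> carrier G \<Longrightarrow> h \<in> carrier G \<Longrightarrow> \<rho> (g \<otimes> h) = \<rho> g * \<rho> h"
  by (auto simp: is_rep_def hom_def GL_def units_of_def ring_mat_simps)

lemma is_rep_one: "is_rep G d \<rho> \<Longrightarrow> \<rho> \<one> = 1\<^sub>m d"
  using hom_one[of \<rho> G "GL d"] GL_group is_group
  by (simp add: is_rep_def) (simp add: GL_def units_of_def ring_mat_simps)

lemma is_rep_pow: "is_rep G d \<rho> \<Longrightarrow> g \<in> carrier G \<Longrightarrow> \<rho> (g [^] k) = \<rho> g ^\<^sub>m (k::nat)"
proof (induction k)
  case 0
  then show ?case using is_rep_carrier[of d \<rho> g] by (simp add: is_rep_one)
next
  case (Suc k)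
  then show ?case by (simp add: is_rep_mult)
qed

text \<open>\<open>x (g [^] k)\<close> is the Adams operation \<psi>^k x at \<open>g\<close>: for
  the character of \<rho> it is the k-th power sum of the eigenvalues of \<rho>(g). It makes sense
  for every function \<open>x\<close> and is additive in \<open>x\<close>, so one formula covers all
  virtual characters.\<close>

definition lambda_series :: "('a \<Rightarrow> complex) \<Rightarrow> 'a \<Rightarrow> complex fps" where
  "lambda_series x g = newton_series (\<lambda>k. x (g [^] k))"

lemma lambda_series_zero: "g \<in> carrier G \<Longrightarrow> lambda_series (\<lambda>g\<in>carrier G. 0) g = 1"
  by (simp add: lambda_series_def newton_series_zero)

lemma lambda_series_add:
  "g \<in> carrier G \<Longrightarrow> lambda_series (\<lambda>g\<in>carrier G. x g + y g) g = lambda_series x g * lambda_series y g"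
  by (simp add: lambda_series_def newton_series_add)

lemma lambda_series_uminus:
  "g \<in> carrier G \<Longrightarrow> lambda_series (\<lambda>g\<in>carrier G. - x g) g * lambda_series x g = 1"
  by (simp add: lambda_series_def newton_series_uminus)

lemma lambda_series_rep_char:
  assumes \<rho>: "is_rep G d \<rho>" and g: "g \<in> carrier G"
  shows "lambda_series (rep_char G \<rho>) g = Abs_fps (\<lambda>n. rep_char G (\<lambda>g. ext_power n (\<rho> g)) g)"
proof -
  have A: "\<rho> g \<in> carrier_mat d d" by (rule is_rep_carrier[OF \<rho> g])
  obtain es where det: "\<And>t. det (1\<^sub>m d + t \<cdot>\<^sub>m \<rho> g) = (\<Prod>e\<leftarrow>es. 1 + t * e)"
    and tr: "\<And>k. mat_trace (\<rho> g ^\<^sub>m k) = (\<Sum>e\<leftarrow>es. e ^ k)"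
    using complex_mat_eigenvalues[OF A] by metis
  have "lambda_series (rep_char G \<rho>) g = newton_series (\<lambda>k. \<Sum>e\<leftarrow>es. e ^ k)"
    using g by (simp add: lambda_series_def rep_char_def is_rep_pow[OF \<rho> g] tr)
  also have "\<dots> = Abs_fps (\<lambda>n. mat_trace (ext_power n (\<rho> g)))"
    by (simp only: newton_series_sum_list ext_power_eigenvalues[OF A det])
  finally show ?thesis using g by (simp add: rep_char_def)
qed

lemma char_ring_finsum:
  assumes R: "ring (char_ring G)" and "finite A" and "f \<in> A \<rightarrow> carrier (char_ring G)" and g: "g \<in> carrier G"
  shows "finsum (char_ring G) f A g = (\<Sum>i\<in>A. f i g)"
  using assms(2,3)
proof (induction A rule: finite_induct)
  case empty
  interpret R: ring "char_ring G" by (rule R)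
  show ?case using g by (simp add: char_ring_simps)
next
  case (insert a A)
  interpret R: ring "char_ring G" by (rule R)
  from insert show ?case using g by (simp add: R.finsum_insert) (simp add: char_ring_simps)
qed

text \<open>At a fixed \<open>g\<close> the series of any family turns sums into products, just as
  \<open>lambda_series\<close> does, and the two agree on irreducible characters. The constant term
  1 makes the series cancellable, which settles zero and negatives.\<close>

lemma lambda_family_series:
  assumes R: "ring (char_ring G)" and L: "is_lambda_family G L"
    and x: "x \<in> carrier (char_ring G)" and g: "g \<in> carrier G"
  shows "Abs_fps (\<lambda>n. L n x g) = lambda_series x g"
proof -
  interpret R: ring "char_ring G" by (rule R)
  define \<Lambda> where "\<Lambda> = (\<lambda>x. Abs_fps (\<lambda>n. L n x g))"
  have carr: "L n x \<in> carrier (char_ring G)" if "x \<in> carrier (char_ring G)" for n x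
    using L that unfolding is_lambda_family_def by blast
  have \<Lambda>_add: "\<Lambda> (\<lambda>g\<in>carrier G. x g + y g) = \<Lambda> x * \<Lambda> y"
    if "x \<in> carrier (char_ring G)" "y \<in> carrier (char_ring G)" for x y
  proof (rule fps_ext)
    fix n
    have "L n (x \<oplus>\<^bsub>char_ring G\<^esub> y) =
        (\<Oplus>\<^bsub>char_ring G\<^esub>i\<in>{..n}. L i x \<otimes>\<^bsub>char_ring G\<^esub> L (n - i) y)"
      using L that unfolding is_lambda_family_def by blast
    moreover have "(\<Oplus>\<^bsub>char_ring G\<^esub>i\<in>{..n}. L i x \<otimes>\<^bsub>char_ring G\<^esub> L (n - i) y) g =
        (\<Sum>i\<le>n. (L i x \<otimes>\<^bsub>char_ring G\<^esub> L (n - i) y) g)"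
      using carr that by (intro char_ring_finsum[OF R _ _ g]) auto
    ultimately show "fps_nth (\<Lambda> (\<lambda>g\<in>carrier G. x g + y g)) n = fps_nth (\<Lambda> x * \<Lambda> y) n"
      using g by (simp add: \<Lambda>_def fps_mult_nth char_ring_simps atLeast0AtMost)
  qed
  have nth0: "fps_nth (\<Lambda> x) 0 = 1" if "x \<in> carrier (char_ring G)" for x
  proof -
    have "L 0 x = \<one>\<^bsub>char_ring G\<^esub>" using L that unfolding is_lambda_family_def by blast
    then show ?thesis using g by (simp add: \<Lambda>_def char_ring_simps)
  qed
  have zero_carr: "(\<lambda>g\<in>carrier G. 0) \<in> carrier (char_ring G)"
    using R.zero_closed by (simp add: char_ring_simps)
  have \<Lambda>_zero: "\<Lambda> (\<lambda>g\<in>carrier G. 0) = 1"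
  proof -
    let ?z = "\<lambda>g\<in>carrier G. 0 :: complex"
    have "(\<lambda>g\<in>carrier G. ?z g + ?z g) = ?z" by auto
    then have "\<Lambda> ?z = \<Lambda> ?z * \<Lambda> ?z" using \<Lambda>_add[OF zero_carr zero_carr] by simp
    moreover have "\<Lambda> ?z \<noteq> 0" using nth0[OF zero_carr] by force
    ultimately show ?thesis by simp
  qed
  have "\<Lambda> x = lambda_series x g"
    using x
  proof (induction x rule: char_ring_induct)
    case zero
    show ?case using \<Lambda>_zero g by (simp only: lambda_series_zero)
  next
    case (irr \<chi>)
    then obtain d \<rho> where \<rho>: "is_rep G d \<rho>" "\<chi> = rep_char G \<rho>"
      by (auto simp: irr_chars_def irreducible_rep_def)
    then have "L n \<chi> = rep_char G (\<lambda>g. ext_power n (\<rho> g))" for n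
      using L unfolding is_lambda_family_def by blast
    then show ?case by (simp only: \<Lambda>_def \<rho> lambda_series_rep_char[OF \<rho>(1) g])
  next
    case (uminus \<chi>)
    let ?m = "\<lambda>g\<in>carrier G. - \<chi> g"
    have \<chi>: "\<chi> \<in> carrier (char_ring G)"
      using uminus by (auto simp: char_ring_simps intro: generate.incl)
    have m: "?m \<in> carrier (char_ring G)"
      using generate.inv[OF uminus, of "add_monoid (fun_ring G)"] uminus irr_chars_subset[of G]
      unfolding char_ring_simps by (subst fun_ring_a_inv[symmetric]) auto
    obtain d \<rho> where \<rho>: "is_rep G d \<rho>" "\<chi> = rep_char G \<rho>"
      using uminus by (auto simp: irr_chars_def irreducible_rep_def)
    then have "L n \<chi> = rep_char G (\<lambda>g. ext_power n (\<rho> g))" for n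
      using L unfolding is_lambda_family_def by blast
    then have eq: "\<Lambda> \<chi> = lambda_series \<chi> g"
      by (simp only: \<Lambda>_def \<rho> lambda_series_rep_char[OF \<rho>(1) g])
    have "(\<lambda>g\<in>carrier G. ?m g + \<chi> g) = (\<lambda>g\<in>carrier G. 0)" by auto
    then have "\<Lambda> ?m * \<Lambda> \<chi> = 1" using \<Lambda>_add[OF m \<chi>] \<Lambda>_zero by simp
    moreover have "lambda_series ?m g * \<Lambda> \<chi> = 1"
      unfolding eq by (rule lambda_series_uminus[OF g])
    moreover have "\<Lambda> \<chi> \<noteq> 0" using nth0[OF \<chi>] by force
    ultimately show ?case by (metis mult_right_cancel)
  next
    case (add x y)
    show ?case using add(3,4) by (simp only: \<Lambda>_add[OF add(1,2)] lambda_series_add[OF g])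
  qed
  then show ?thesis by (simp add: \<Lambda>_def)
qed

text \<open>The closure hypotheses carry what depends on the group: \<open>coeffs\<close> keeps the
  Newton coefficients inside the character ring, and \<open>reps\<close> puts the character of every
  representation into the domain of the family to be constructed.\<close>

lemma lambda_op_eq:
  assumes R: "ring (char_ring G)"
    and reps: "\<And>d \<rho>. is_rep G d \<rho> \<Longrightarrow> rep_char G \<rho> \<in> carrier (char_ring G)"
    and coeffs: "\<And>n x. x \<in> carrier (char_ring G) \<Longrightarrow>
      (\<lambda>g\<in>carrier G. fps_nth (lambda_series x g) n) \<in> carrier (char_ring G)"
    and x: "x \<in> carrier (char_ring G)"
  shows "lambda_op G n x = (\<lambda>g\<in>carrier G. fps_nth (lambda_series x g) n)"
proof -
  interpret R: ring "char_ring G" by (rule R)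
  define L where "L = (\<lambda>n. \<lambda>x\<in>carrier (char_ring G). \<lambda>g\<in>carrier G. fps_nth (lambda_series x g) n)"
  have L: "is_lambda_family G L"
    unfolding is_lambda_family_def
  proof (intro conjI allI impI ballI)
    show "L n \<in> carrier (char_ring G) \<rightarrow>\<^sub>E carrier (char_ring G)" for n
      using coeffs by (auto simp: L_def)
    show "L n (rep_char G \<rho>) = rep_char G (\<lambda>g. ext_power n (\<rho> g))" if "is_rep G d \<rho>" for n d \<rho>
      using reps[OF that] lambda_series_rep_char[OF that]
      by (auto simp: L_def rep_char_def fun_eq_iff)
    show "L 0 x = \<one>\<^bsub>char_ring G\<^esub>" if "x \<in> carrier (char_ring G)" for x
      using that by (auto simp: L_def char_ring_simps lambda_series_def)
    show "L n (x \<oplus>\<^bsub>char_ring G\<^esub> y) =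
        (\<Oplus>\<^bsub>char_ring G\<^esub>i\<in>{..n}. L i x \<otimes>\<^bsub>char_ring G\<^esub> L (n - i) y)"
      if x: "x \<in> carrier (char_ring G)" and y: "y \<in> carrier (char_ring G)" for n x y
    proof -
      have Lc: "L i z \<in> carrier (char_ring G)" if "z \<in> carrier (char_ring G)" for i z
        using coeffs that by (auto simp: L_def)
      have xy: "x \<oplus>\<^bsub>char_ring G\<^esub> y \<in> carrier (char_ring G)" using x y by (rule R.a_closed)
      have f: "(\<lambda>i. L i x \<otimes>\<^bsub>char_ring G\<^esub> L (n - i) y) \<in> {..n} \<rightarrow> carrier (char_ring G)"
        using Lc x y by auto
      have sum_carr: "(\<Oplus>\<^bsub>char_ring G\<^esub>i\<in>{..n}. L i x \<otimes>\<^bsub>char_ring G\<^esub> L (n - i) y) \<in> carrier (char_ring G)"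
        using f by (rule R.finsum_closed)
      show ?thesis
      proof (rule extensionalityI[of _ "carrier G"])
        show "L n (x \<oplus>\<^bsub>char_ring G\<^esub> y) \<in> extensional (carrier G)"
          using Lc[OF xy] carrier_char_ring_subset by (auto simp: PiE_def)
        show "(\<Oplus>\<^bsub>char_ring G\<^esub>i\<in>{..n}. L i x \<otimes>\<^bsub>char_ring G\<^esub> L (n - i) y) \<in> extensional (carrier G)"
          using sum_carr carrier_char_ring_subset by (auto simp: PiE_def)
        fix g assume g: "g \<in> carrier G"
        have "L n (x \<oplus>\<^bsub>char_ring G\<^esub> y) g = fps_nth (lambda_series x g * lambda_series y g) n"
          using xy g by (simp add: L_def char_ring_simps lambda_series_add[OF g])
        also have "\<dots> = (\<Sum>i\<le>n. (L i x \<otimes>\<^bsub>char_ring G\<^esub> L (n - i) y) g)"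
          using x y g by (simp add: fps_mult_nth atLeast0AtMost L_def char_ring_simps(2))
        also have "\<dots> = (\<Oplus>\<^bsub>char_ring G\<^esub>i\<in>{..n}. L i x \<otimes>\<^bsub>char_ring G\<^esub> L (n - i) y) g"
          by (rule char_ring_finsum[OF R _ f g, symmetric]) simp
        finally show "L n (x \<oplus>\<^bsub>char_ring G\<^esub> y) g =
          (\<Oplus>\<^bsub>char_ring G\<^esub>i\<in>{..n}. L i x \<otimes>\<^bsub>char_ring G\<^esub> L (n - i) y) g" .
      qed
    qed
  qed
  have "L' = L" if L': "is_lambda_family G L'" for L'
  proof (intro ext)
    fix n x g
    have PiE: "L n \<in> carrier (char_ring G) \<rightarrow>\<^sub>E carrier (char_ring G)"
      "L' n \<in> carrier (char_ring G) \<rightarrow>\<^sub>E carrier (char_ring G)"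
      using L L' unfolding is_lambda_family_def by blast+
    show "L' n x g = L n x g"
    \<comment> \<open>The series give agreement only where both \<open>x\<close> and
      \<open>g\<close> are in range. Elsewhere both families are \<open>undefined\<close>: by
      extensionality in \<open>g\<close> if \<open>x\<close> is in the ring, by extensionality in
      \<open>x\<close> otherwise.\<close>
    proof (cases "x \<in> carrier (char_ring G) \<and> g \<in> carrier G")
      case True
      then have "Abs_fps (\<lambda>n. L' n x g) = Abs_fps (\<lambda>n. L n x g)"
        using lambda_family_series[OF R L] lambda_family_series[OF R L'] by simp
      then show ?thesis by (metis fps_nth_Abs_fps)
    next
      case False
      then show ?thesis
      proof (cases "x \<in> carrier (char_ring G)")
        case True
        then have "L n x \<in> carrier G \<rightarrow>\<^sub>E UNIV" "L' n x \<in> carrier G \<rightarrow>\<^sub>E UNIV"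
          using PiE carrier_char_ring_subset by blast+
        then show ?thesis using False True by (auto simp: PiE_def extensional_def)
      next
        case False
        then show ?thesis using PiE by (auto simp: PiE_def extensional_def)
      qed
    qed
  qed
  then have "lambda_op G = L" unfolding lambda_op_def by (rule the_equality[of "is_lambda_family G", OF L])
  then show ?thesis using x by (simp add: L_def)
qed

end


section \<open>Forms in two variables\<close>

text \<open>The target ring is left open because several are used: complex numbers for characters,
  integers and \<open>int poly\<close> for the tests at points and along curves, and polynomials
  over \<open>int poly poly\<close> for the grading.\<close>

definition poly2 :: "int poly poly \<Rightarrow> 'a :: comm_ring_1 \<Rightarrow> 'a \<Rightarrow> 'a" where
  "poly2 p x y = poly (map_poly (\<lambda>q. poly (map_poly of_int q) x) p) y"

lemma poly_map_poly_hom: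
  fixes h :: "'b :: comm_ring_1 \<Rightarrow> 'a :: comm_ring_1"
  assumes h0: "h 0 = 0" and hadd: "\<And>a b. h (a + b) = h a + h b" and hmult: "\<And>a b. h (a * b) = h a * h b"
  shows "poly (map_poly h (p + q)) y = poly (map_poly h p) y + poly (map_poly h q) y"
    and "poly (map_poly h (p * q)) y = poly (map_poly h p) y * poly (map_poly h q) y"
proof -
  have pCons: "poly (map_poly h (pCons a p)) y = h a + y * poly (map_poly h p) y" for a p
    by (simp add: Polynomial.map_poly_pCons h0)
  have add: "poly (map_poly h (p + q)) y = poly (map_poly h p) y + poly (map_poly h q) y" for p q
    by (induction p q rule: poly_induct2) (auto simp: pCons hadd algebra_simps)
  have smult: "poly (map_poly h (Polynomial.smult a q)) y = h a * poly (map_poly h q) y" for a q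
    by (induction q) (auto simp: pCons hmult algebra_simps)
  show "poly (map_poly h (p + q)) y = poly (map_poly h p) y + poly (map_poly h q) y" by (rule add)
  show "poly (map_poly h (p * q)) y = poly (map_poly h p) y * poly (map_poly h q) y"
    by (induction p) (auto simp: pCons add smult h0 algebra_simps)
qed

lemma poly2_add [simp]: "poly2 (p + q) x y = poly2 p x y + poly2 q x y"
  and poly2_mult [simp]: "poly2 (p * q) x y = poly2 p x y * poly2 q x y"
  unfolding poly2_def by (rule poly_map_poly_hom; simp add: poly_map_poly_hom)+

lemma poly2_monom: "poly2 (monom (monom c i) j) x y = of_int c * x ^ i * y ^ j"
  by (simp add: poly2_def map_poly_monom poly_monom)

lemma poly2_0 [simp]: "poly2 0 x y = 0"
  by (simp add: poly2_def)

lemma poly2_of_int [simp]: "poly2 (of_int k) x y = of_int k"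
  using poly2_monom[of k 0 0 x y] by (simp add: monom_0 of_int_poly)

lemma poly2_numeral [simp]: "poly2 (numeral k) x y = numeral k"
  using poly2_of_int[of "numeral k"] by simp

lemma poly2_1 [simp]: "poly2 1 x y = 1"
  using poly2_of_int[of 1] by simp

lemma poly2_uminus [simp]: "poly2 (- p) x y = - poly2 p x y"
  using poly2_mult[of "of_int (- 1)" p x y] by (simp only: poly2_of_int) simp

lemma poly2_diff [simp]: "poly2 (p - q) x y = poly2 p x y - poly2 q x y"
  using poly2_add[of p "- q" x y] by simp

lemma poly2_sum [simp]: "poly2 (\<Sum>i\<in>A. f i) x y = (\<Sum>i\<in>A. poly2 (f i) x y)"
  by (induction A rule: infinite_finite_induct) auto

lemma poly2_power [simp]: "poly2 (p ^ n) x y = poly2 p x y ^ n"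
  by (induction n) auto

lemma poly2_X_var [simp]: "poly2 X_var x y = x"
  using poly2_monom[of 1 1 0 x y] by (simp add: X_var_def monom_altdef)

lemma poly2_Y_var [simp]: "poly2 Y_var x y = y"
  using poly2_monom[of 1 0 1 x y] by (simp add: Y_var_def monom_altdef flip: one_pCons)

lemma monom_monom_eq: "monom (monom c i) j = of_int c * X_var ^ i * Y_var ^ j"
proof -
  have X: "X_var ^ i = monom (monom 1 i) 0"
    by (induction i) (auto simp: X_var_def monom_altdef simp flip: one_pCons)
  have Y: "Y_var ^ j = monom 1 j"
    by (simp add: Y_var_def monom_altdef)
  show ?thesis
    by (simp add: X Y of_int_poly mult_monom smult_monom monom_0[symmetric])
qed

lemma bipoly_induct [case_names monom add]:
  fixes p :: "int poly poly"
  assumes monom: "\<And>c i j. P (of_int c * X_var ^ i * Y_var ^ j)"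
    and add: "\<And>p q. P p \<Longrightarrow> P q \<Longrightarrow> P (p + q)"
  shows "P p"
proof -
  have P0: "P 0" using monom[of 0 0 0] by simp
  have sum: "P (\<Sum>i\<in>A. f i)" if "\<And>i. P (f i)" for f and A :: "nat set"
    by (induction A rule: infinite_finite_induct) (auto simp: P0 add that)
  have "P (monom q j)" for q j
  proof -
    have "monom q j = monom (\<Sum>i\<le>degree q. monom (coeff q i) i) j"
      by (simp add: poly_as_sum_of_monoms)
    also have "\<dots> = (\<Sum>i\<le>degree q. of_int (coeff q i) * X_var ^ i * Y_var ^ j)"
      by (simp add: monom_sum monom_monom_eq)
    finally show ?thesis using sum[of "\<lambda>i. of_int (coeff q i) * X_var ^ i * Y_var ^ j"] monom by simp
  qed
  then have "P (\<Sum>j\<le>degree p. monom (coeff p j) j)" by (rule sum)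
  then show ?thesis by (simp add: poly_as_sum_of_monoms)
qed

lemma poly2_self: "poly2 p X_var Y_var = p"
  by (induction p rule: bipoly_induct) auto

text \<open>A homomorphism need only be compared on monomials. This serves to set t = 1 in
  \<open>graded_poly\<close>, to pass from integers to complex numbers, and to evaluate the
  restriction to a curve at one of its points.\<close>

lemma poly2_comp:
  assumes "h 0 = 0" "h 1 = 1" "\<And>a b. h (a + b) = h a + h b" "\<And>a b. h (a * b) = h a * h b"
    "\<And>k. h (of_int k) = of_int k"
  shows "h (poly2 p x y) = poly2 p (h x) (h y)"
proof -
  have pow: "h (a ^ n) = h a ^ n" for a n
    by (induction n) (auto simp: assms)
  show ?thesis
    by (induction p rule: bipoly_induct) (auto simp: assms pow)
qed

text \<open>The substitution \<open>x \<mapsto> x t\<close>, \<open>y \<mapsto> y t\<close> makes the total degree the degree in \<open>t\<close>.\<close>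

definition graded_poly :: "int poly poly \<Rightarrow> int poly poly poly" where
  "graded_poly p = poly2 p (monom X_var 1) (monom Y_var 1)"

definition hpart :: "nat \<Rightarrow> int poly poly \<Rightarrow> int poly poly" where
  "hpart n p = coeff (graded_poly p) n"

lemma hpart_add [simp]: "hpart n (p + q) = hpart n p + hpart n q"
  and hpart_uminus [simp]: "hpart n (- p) = - hpart n p"
  and hpart_diff [simp]: "hpart n (p - q) = hpart n p - hpart n q"
  and hpart_0 [simp]: "hpart n 0 = 0"
  and hpart_sum: "hpart n (\<Sum>i\<in>A. f i) = (\<Sum>i\<in>A. hpart n (f i))"
  and hpart_1: "hpart n 1 = (if n = 0 then 1 else 0)"
  by (simp_all add: hpart_def graded_poly_def coeff_sum)

lemma hpart_mult: "hpart n (p * q) = (\<Sum>i\<le>n. hpart i p * hpart (n - i) q)"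
  by (simp add: hpart_def graded_poly_def coeff_mult)

lemma of_int_mult_monom: "of_int c * monom a n = monom (of_int c * a :: 'a :: comm_ring_1) n"
  by (simp add: of_int_poly smult_monom)

lemma hpart_monom:
  "hpart n (of_int c * X_var ^ i * Y_var ^ j) = (if n = i + j then of_int c * X_var ^ i * Y_var ^ j else 0)"
proof -
  have "graded_poly (of_int c * X_var ^ i * Y_var ^ j) = monom (of_int c * X_var ^ i * Y_var ^ j) (i + j)"
    by (simp add: graded_poly_def monom_power of_int_mult_monom) (simp add: mult_monom)
  then show ?thesis by (simp add: hpart_def)
qed

lemma hpart_hpart: "hpart m (hpart n p) = (if m = n then hpart n p else 0)"
  by (induction p rule: bipoly_induct) (auto simp: hpart_monom)

lemma hpart_eq_0: "n > degree (graded_poly p) \<Longrightarrow> hpart n p = 0"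
  by (simp add: hpart_def coeff_eq_0)

lemma sum_hpart: "(\<Sum>n\<le>degree (graded_poly p). hpart n p) = p"
proof -
  have "(\<Sum>n\<le>degree (graded_poly p). hpart n p) = poly (graded_poly p) 1"
    by (simp add: poly_altdef hpart_def)
  also have "\<dots> = poly2 p (poly (monom X_var 1) 1) (poly (monom Y_var 1) 1)"
    unfolding graded_poly_def by (rule poly2_comp) auto
  finally show ?thesis by (simp add: poly_monom poly2_self)
qed

lemma coeff_hpart: "coeff (coeff (hpart n p) j) i = (if i + j = n then coeff (coeff p j) i else 0)"
  by (induction p rule: bipoly_induct)
    (auto simp: hpart_monom[folded monom_monom_eq] simp flip: monom_monom_eq)

lemma homogeneous_polys_iff: "p \<in> homogeneous_polys n \<longleftrightarrow> hpart n p = p"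
proof
  assume "p \<in> homogeneous_polys n"
  then show "hpart n p = p"
    by (intro poly_eqI) (auto simp: coeff_hpart homogeneous_polys_def)
next
  assume hom: "hpart n p = p"
  have "coeff (coeff p j) i = 0" if "i + j \<noteq> n" for i j
    using coeff_hpart[of n p j i] that by (simp only: hom if_False)
  then show "p \<in> homogeneous_polys n"
    unfolding homogeneous_polys_def by blast
qed

lemma hpart_expand: "hpart n p = (\<Sum>i\<le>n. of_int (coeff (coeff p (n - i)) i) * X_var ^ i * Y_var ^ (n - i))"
proof (induction p rule: bipoly_induct)
  case (monom c a b)
  have "coeff (coeff (of_int c * X_var ^ a * Y_var ^ b) (n - i)) i = (if b = n - i \<and> a = i then c else 0)" for i
    by (auto simp flip: monom_monom_eq)
  then have "(\<Sum>i\<le>n. of_int (coeff (coeff (of_int c * X_var ^ a * Y_var ^ b) (n - i)) i) * X_var ^ i * Y_var ^ (n - i)) =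
    (\<Sum>i\<le>n. if i = a then (if b = n - a then of_int c * X_var ^ a * Y_var ^ b else 0) else 0)"
    by (intro sum.cong) auto
  also have "\<dots> = hpart n (of_int c * X_var ^ a * Y_var ^ b)"
    by (auto simp: hpart_monom)
  finally show ?case by simp
next
  case (add p q)
  then show ?case by (simp add: sum.distrib distrib_right)
qed

section \<open>The filtration of polynomials by their order at the origin\<close>

definition order_ge :: "nat \<Rightarrow> int poly poly set" where
  "order_ge n = {p. \<forall>k<n. hpart k p = 0}"

lemma order_ge_add: "p \<in> order_ge n \<Longrightarrow> q \<in> order_ge n \<Longrightarrow> p + q \<in> order_ge n"
  and order_ge_diff: "p \<in> order_ge n \<Longrightarrow> q \<in> order_ge n \<Longrightarrow> p - q \<in> order_ge n"
  and order_ge_uminus: "p \<in> order_ge n \<Longrightarrow> - p \<in> order_ge n"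
  and order_ge_zero: "0 \<in> order_ge n"
  and order_ge_0: "p \<in> order_ge 0"
  and order_ge_antimono: "p \<in> order_ge n \<Longrightarrow> m \<le> n \<Longrightarrow> p \<in> order_ge m"
  by (auto simp: order_ge_def)

lemma order_ge_sum: "(\<And>i. i \<in> A \<Longrightarrow> f i \<in> order_ge n) \<Longrightarrow> (\<Sum>i\<in>A. f i) \<in> order_ge n"
  by (auto simp: order_ge_def hpart_sum)

lemma order_ge_mult:
  assumes "p \<in> order_ge m" "q \<in> order_ge n"
  shows "p * q \<in> order_ge (m + n)"
  unfolding order_ge_def
proof (intro CollectI allI impI)
  fix k assume k: "k < m + n"
  have "hpart i p * hpart (k - i) q = 0" if "i \<le> k" for i
  proof (cases "i < m")
    case False
    then have "k - i < n" using k that by auto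
    then show ?thesis using assms by (simp add: order_ge_def)
  qed (use assms in \<open>simp add: order_ge_def\<close>)
  then show "hpart k (p * q) = 0" unfolding hpart_mult by (intro sum.neutral) auto
qed

lemma hpart_order_ge: "hpart n p \<in> order_ge n"
  by (auto simp: order_ge_def hpart_hpart)

lemma diff_hpart_order_ge: "p \<in> order_ge n \<Longrightarrow> p - hpart n p \<in> order_ge (Suc n)"
  by (auto simp: order_ge_def hpart_hpart less_Suc_eq)

lemma monom_order_ge: "X_var ^ i * Y_var ^ j \<in> order_ge (i + j)"
  using hpart_monom[of _ 1 i j] by (simp add: order_ge_def)

lemma poly2_hpart_scale: "poly2 (hpart n p) (u * s) (v * s) = s ^ n * poly2 (hpart n p) u v"
proof (induction p rule: bipoly_induct)
  case (monom c i j)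
  show ?case
    unfolding hpart_monom by (simp add: power_mult_distrib power_add ac_simps)
qed (simp add: distrib_left)

text \<open>A homogeneous part of degree k contributes a factor s^k, and the parts below degree n
  are absent. Later \<open>s\<close> is the coordinate on a curve, -2 at a point, and 0 at the
  origin.\<close>

lemma order_ge_dvd:
  assumes "p \<in> order_ge n"
  shows "s ^ n dvd poly2 p (u * s) (v * s)"
proof -
  have "poly2 p (u * s) (v * s) = (\<Sum>k\<le>degree (graded_poly p). s ^ k * poly2 (hpart k p) u v)"
    by (subst (1) sum_hpart[symmetric]) (simp only: poly2_sum poly2_hpart_scale)
  moreover have "s ^ n dvd s ^ k * poly2 (hpart k p) u v" for k
  proof (cases "k < n")
    case True
    then have "hpart k p = 0" using assms by (simp add: order_ge_def)
    then show ?thesis by simp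
  qed (simp add: le_imp_power_dvd dvd_mult2)
  ultimately show ?thesis by (simp add: dvd_sum)
qed


section \<open>Divisibility conditions on forms\<close>

text \<open>The monic polynomial ((1 + x)^4 - 1) / x = (x + 2) (x^2 + 2 x + 2) vanishes at -2 and
  \<i> - 1 and has constant term 4; \<open>k\<close> is a multiple of it. Instead of dividing, the
  proof writes k = a + x h and reduces modulo the prime \<i> - 1 of Z[\<i>], which lies over 2, so
  that the points \<i> - 1, -2 and 0 become equal.\<close>

lemma int_poly_dvd_4:
  fixes k :: "int poly"
  assumes i: "poly (map_poly of_int k) (\<i> - 1 :: complex) = 0" and m2: "poly k (- 2) = 0"
  shows "4 dvd coeff k 0"
proof -
  obtain a h where k: "k = pCons a h" by (rule pCons_cases)
  \<comment> \<open>u + v \<i> is congruent to u + v modulo \<i> - 1, so both parities compare a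
    value of \<open>h\<close> with its constant term.\<close>
  have "\<exists>u v. poly (map_poly of_int h) (\<i> - 1 :: complex) = of_int u + of_int v * \<i> \<and>
     even (u + v - coeff h 0) \<and> even (poly h (- 2) - coeff h 0)"
  proof (induction h)
    case 0
    show ?case by (intro exI[of _ 0]) simp
  next
    case (pCons b h)
    then obtain u v where "poly (map_poly of_int h) (\<i> - 1 :: complex) = of_int u + of_int v * \<i>" by blast
    then have "poly (map_poly of_int (pCons b h)) (\<i> - 1 :: complex) = of_int (b - u - v) + of_int (u - v) * \<i>"
      by (simp add: Polynomial.map_poly_pCons algebra_simps)
    moreover have "even ((b - u - v) + (u - v) - b)" "even (poly (pCons b h) (- 2) - b)" by auto
    ultimately show ?case by (intro exI[of _ "b - u - v"] exI[of _ "u - v"]) (simp only: coeff_pCons_0)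
  qed
  then obtain u v where h: "poly (map_poly of_int h) (\<i> - 1 :: complex) = of_int u + of_int v * \<i>"
    and uv: "even (u + v - coeff h 0)" "even (poly h (- 2) - coeff h 0)" by blast
  \<comment> \<open>The imaginary part gives u = v. So u + v is even, hence so are h(0) and h(-2),
    and k(-2) = 0 reads a = 2 h(-2).\<close>
  have "of_int (a - u - v) + of_int (u - v) * \<i> = (0 :: complex)"
    using i by (simp add: k Polynomial.map_poly_pCons h algebra_simps)
  then have "of_int (u - v) = (0 :: real)"
    by (simp add: complex_eq_iff)
  then have "u = v" by simp
  then have "even (poly h (- 2))" using uv by presburger
  then obtain w where "poly h (- 2) = 2 * w" by blast
  then show ?thesis using m2 by (simp add: k)
qed

lemma poly2_poly_comp:
  fixes z :: "'a :: comm_ring_1"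
  shows "poly (map_poly of_int (poly2 p a b)) z = poly2 p (poly (map_poly of_int a) z) (poly (map_poly of_int b) z)"
proof -
  have "poly (map_poly of_int (of_int k :: int poly)) z = of_int k" for k :: int
    by (simp add: of_int_poly Polynomial.map_poly_pCons)
  then show ?thesis
    by (intro poly2_comp) (simp_all add: poly_map_poly_hom)
qed

text \<open>The coefficients of a form \<open>f\<close> are tested by restricting to the curves \<open>y = x v(x)\<close> and
  to the points \<open>(0, -2)\<close> and \<open>(-2, -2)\<close>; a form of degree \<open>n\<close> splits off an \<open>n\<close>-th power there.\<close>

lemma form_on_curve:
  fixes c :: "nat \<Rightarrow> int" and v :: "int poly"
  assumes f: "f = (\<Sum>i\<le>n. of_int (c i) * X_var ^ i * Y_var ^ (n - i))" and g: "g \<in> order_ge (Suc n)"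
    and i: "poly2 (f - g) (\<i> - 1) ((\<i> - 1) * poly (map_poly of_int v) (\<i> - 1 :: complex)) = 0"
    and m2: "poly2 (f - g) (- 2) (- 2 * of_int (poly v (- 2)) :: complex) = 0"
  shows "4 dvd (\<Sum>i\<le>n. c i * poly v 0 ^ (n - i))"
proof -
  let ?X = "[:0, 1:] :: int poly"
  obtain h where h: "poly2 g (1 * ?X) (v * ?X) = ?X ^ Suc n * h"
    using order_ge_dvd[OF g, of ?X 1 v] by (elim dvdE)
  \<comment> \<open>Restricted to the curve, the form is x^n times the sum and \<open>g\<close> is
    x^(n+1) h. So \<open>k\<close> is f - g with x^n removed, and its constant term is the number in
    the conclusion.\<close>
  define k where "k = (\<Sum>i\<le>n. of_int (c i) * v ^ (n - i)) - ?X * h"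
  have "poly2 f (1 * ?X) (v * ?X) = (\<Sum>i\<le>n. of_int (c i) * (1 * ?X) ^ i * (v * ?X) ^ (n - i))"
    by (simp only: f poly2_sum poly2_mult poly2_of_int poly2_power poly2_X_var poly2_Y_var)
  also have "\<dots> = (\<Sum>i\<le>n. ?X ^ n * (of_int (c i) * v ^ (n - i)))"
  proof (rule sum.cong[OF refl])
    fix i assume "i \<in> {..n}"
    then have "?X ^ n = ?X ^ i * ?X ^ (n - i)" by (simp flip: power_add)
    then show "of_int (c i) * (1 * ?X) ^ i * (v * ?X) ^ (n - i) = ?X ^ n * (of_int (c i) * v ^ (n - i))"
      by (simp only: power_mult_distrib power_one mult_1_left ac_simps)
  qed
  finally have fg: "poly2 (f - g) ?X (v * ?X) = ?X ^ n * k"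
    using h by (simp add: k_def sum_distrib_left right_diff_distrib del: mult_pCons_left mult_pCons_right)
  have eval: "z ^ n * poly (map_poly of_int k) z = poly2 (f - g) z (z * poly (map_poly of_int v) z)" for z :: complex
  proof -
    have X: "poly (map_poly of_int ?X) z = z" by (simp add: Polynomial.map_poly_pCons)
    have mult: "poly (map_poly of_int (p * q)) z = poly (map_poly of_int p) z * poly (map_poly of_int q) z" for p q :: "int poly"
      by (rule poly_map_poly_hom) auto
    have "poly (map_poly of_int (?X ^ n)) z = z ^ n"
      by (induction n) (simp_all add: mult X del: mult_pCons_left)
    then show ?thesis
      using arg_cong[OF fg, of "\<lambda>p. poly (map_poly of_int p) z"] 
      by (simp only: poly2_poly_comp X mult mult.commute[of _ z])
  qed
  have "\<i> - 1 \<noteq> 0" by (simp add: complex_eq_iff)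
  then have 1: "poly (map_poly of_int k) (\<i> - 1 :: complex) = 0"
    using eval[of "\<i> - 1"] i by simp
  have of_int: "poly (map_poly of_int p) (of_int a) = (of_int (poly p a) :: complex)" for p a
    by (induction p) (auto simp: Polynomial.map_poly_pCons)
  have "of_int (poly k (- 2)) = (0 :: complex)"
    using eval[of "- 2"] m2 of_int[of k "- 2"] of_int[of v "- 2"] by simp
  then have 2: "poly k (- 2) = 0" by simp
  have "4 dvd coeff k 0" by (rule int_poly_dvd_4[OF 1 2])
  moreover have "coeff k 0 = (\<Sum>i\<le>n. c i * poly v 0 ^ (n - i))"
    by (simp add: k_def poly_0_coeff_0[symmetric] poly_sum)
  ultimately show ?thesis by simp
qed

text \<open>At (-2 u, -2 v) the form is (-2)^n times its value at (u, v), while \<open>g\<close> is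
  divisible by (-2)^(n+1); one factor 2 remains.\<close>

lemma form_at_even_point:
  fixes c :: "nat \<Rightarrow> int"
  assumes f: "f = (\<Sum>i\<le>n. of_int (c i) * X_var ^ i * Y_var ^ (n - i))" and g: "g \<in> order_ge (Suc n)"
    and vanish: "poly2 (f - g) (of_int (- 2 * u)) (of_int (- 2 * v) :: complex) = 0"
  shows "even (\<Sum>i\<le>n. c i * u ^ i * v ^ (n - i))"
proof -
  obtain h :: int where h: "poly2 g (u * - 2) (v * - 2) = (- 2) ^ Suc n * h"
    using order_ge_dvd[OF g, of "- 2" u v] by (elim dvdE)
  have "of_int (poly2 (f - g) (- 2 * u) (- 2 * v)) = (0 :: complex)"
    unfolding vanish[symmetric] by (rule poly2_comp) simp_all
  then have "poly2 f (u * - 2) (v * - 2) = poly2 g (u * - 2) (v * - 2)"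
    by (simp add: mult.commute)
  moreover have "poly2 f (u * - 2) (v * - 2) = (- 2) ^ n * (\<Sum>i\<le>n. c i * u ^ i * v ^ (n - i))"
    unfolding f poly2_sum poly2_mult poly2_of_int poly2_power poly2_X_var poly2_Y_var sum_distrib_left
  proof (rule sum.cong[OF refl])
    fix i assume "i \<in> {..n}"
    then have "(- 2 :: int) ^ n = (- 2) ^ i * (- 2) ^ (n - i)" by (simp flip: power_add)
    then show "of_int (c i) * (u * - 2) ^ i * (v * - 2) ^ (n - i) = (- 2) ^ n * (c i * u ^ i * v ^ (n - i))"
      by (simp only: power_mult_distrib ac_simps of_int_eq_id id_apply)
  qed
  ultimately have "(- 2) ^ n * (\<Sum>i\<le>n. c i * u ^ i * v ^ (n - i)) = (- 2) ^ n * (- 2 * h)"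
    using h by simp
  then have "(\<Sum>i\<le>n. c i * u ^ i * v ^ (n - i)) = - 2 * h"
    by (subst (asm) mult_cancel_left) simp
  then show ?thesis by simp
qed

abbreviation relators :: "int poly poly set" where
  "relators \<equiv> {4 * X_var, 2 * Y_var, X_var * Y_var ^ 3 + X_var ^ 2 * Y_var ^ 2}"

lemma ZXY_ideal:
  assumes "ideal J ZXY"
  shows "p \<in> J \<Longrightarrow> q \<in> J \<Longrightarrow> p + q \<in> J" "p \<in> J \<Longrightarrow> r * p \<in> J" "0 \<in> J" "p \<in> J \<Longrightarrow> - p \<in> J"
    "p \<in> J \<Longrightarrow> q \<in> J \<Longrightarrow> p - q \<in> J" "(\<And>i. i \<in> A \<Longrightarrow> f i \<in> J) \<Longrightarrow> (\<Sum>i\<in>A. f i) \<in> J"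
proof -
  interpret ideal J ZXY by (rule assms)
  show add: "p + q \<in> J" if "p \<in> J" "q \<in> J" for p q using a_closed[OF that] by simp
  show mult: "r * p \<in> J" if "p \<in> J" for r p using I_l_closed[OF that, of r] by simp
  show 0: "0 \<in> J" using zero_closed by simp
  show "- p \<in> J" if "p \<in> J" for p using mult[OF that, of "- 1"] by simp
  then show "p - q \<in> J" if "p \<in> J" "q \<in> J" using add[of p "- q"] that by simp
  show "(\<Sum>i\<in>A. f i) \<in> J" if "\<And>i. i \<in> A \<Longrightarrow> f i \<in> J"
    using that by (induction A rule: infinite_finite_induct) (auto simp: 0 add)
qed

text \<open>For n \<ge> 3 the multiples of the quartic relator identify, modulo 2 y, all monomials
  x^i y^(n-i) with 0 < i \<le> n - 2. Outside this middle class there are x^n, killed by 4, and y^n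
  and x^(n-1) y, killed by 2. In the middle class only the sum of the coefficients counts; its
  parity is that of the total, since the outer coefficients are even.\<close>

lemma form_in_ideal:
  fixes c :: "nat \<Rightarrow> int"
  assumes J: "ideal J ZXY" and rel: "relators \<subseteq> J"
    and n: "n > 0" and cn: "4 dvd c n" and c0: "even (c 0)" and c1: "n \<ge> 2 \<Longrightarrow> even (c (n - 1))"
    and total: "even (\<Sum>i\<le>n. c i)"
  shows "(\<Sum>i\<le>n. of_int (c i) * X_var ^ i * Y_var ^ (n - i)) \<in> J"
proof -
  note I = ZXY_ideal[OF J]
  define m where "m = (\<lambda>i. X_var ^ i * Y_var ^ (n - i))"
  have x4: "of_int a * m n \<in> J" if a: "4 dvd a" for a
  proof -
    obtain b where "a = 4 * b" using a by (elim dvdE)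
    then have "of_int a * m n = (of_int b * X_var ^ (n - 1)) * (4 * X_var)"
      using n by (cases n) (simp_all add: m_def algebra_simps)
    then show ?thesis using rel I(2) by simp
  qed
  have y2: "of_int a * m i \<in> J" if a: "even a" and i: "i < n" for a i
  proof -
    obtain b where "a = 2 * b" using a by (elim dvdE)
    moreover have "n - i = Suc (n - i - 1)" using i by simp
    ultimately have "of_int a * m i = (of_int b * X_var ^ i * Y_var ^ (n - i - 1)) * (2 * Y_var)"
      unfolding m_def by (metis (no_types, opaque_lifting) mult.assoc mult.commute of_int_mult of_int_numeral power_Suc)
    then show ?thesis using rel I(2) by simp
  qed
  consider "n = 1" | "n = 2" | "n \<ge> 3" using n by linarith
  then show ?thesis
  proof cases
    case 1
    then show ?thesis using x4[of "c 1"] y2[of "c 0" 0] cn c0 I(1) by (simp add: m_def)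
  next
    case 2
    then show ?thesis using x4[of "c 2"] y2[of "c 0" 0] y2[of "c 1" 1] cn c0 c1 I(1)
      by (simp add: m_def numeral_2_eq_2 mult.assoc)
  next
    case 3
    let ?e = "m (n - 2)"
    have adjacent: "m i + m (Suc i) \<in> J" if i: "0 < i" "i < n - 2" for i
    proof -
      have "m i + m (Suc i) = (X_var ^ (i - 1) * Y_var ^ (n - i - 3)) * (X_var * Y_var ^ 3 + X_var ^ 2 * Y_var ^ 2)"
      proof -
        obtain j where j: "i = Suc j" using i by (cases i) auto
        have "i + 3 \<le> n" using i by linarith
        then obtain l where "n = i + 3 + l" using le_Suc_ex by blast
        then have l: "n = j + l + 4" using j by simp
        show ?thesis unfolding m_def j l
          by (simp add: algebra_simps power_add power2_eq_square power3_eq_cube)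
      qed
      then show ?thesis using rel I(2) by simp
    qed
    \<comment> \<open>Modulo the ideal a middle monomial is minus its neighbour, and twice a
      monomial containing y is 0, so the sign disappears. The induction descends from n - 2.\<close>
    have mid: "m i - ?e \<in> J" if "0 < i" "i \<le> n - 2" for i
      using that(2,1)
    proof (induction i rule: inc_induct)
      case base
      show ?case using I(3) by simp
    next
      case (step i)
      have "2 * m (Suc i) \<in> J" using y2[of 2 "Suc i"] step by simp
      then have "(m i + m (Suc i)) - 2 * m (Suc i) + (m (Suc i) - ?e) \<in> J"
        using step adjacent[of i] by (intro I(1)[OF I(5)]) auto
      then show ?case by simp
    qed
    \<comment> \<open>In the outer cases the two products lie in the ideal separately:
      \<open>c i\<close> is even (divisible by 4 for i = n) and \<open>?e\<close> contains
      y.\<close>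
    have "of_int (c i) * (m i - ?e) \<in> J" if i: "i \<le> n" for i
    proof -
      consider "i = n" | "i = n - 1" | "i = 0" | "0 < i" "i \<le> n - 2" using i by linarith
      then show ?thesis
      proof cases
        case 1
        then have "even (c i)" using cn by (auto intro: dvd_trans[of 2 4])
        then show ?thesis using 1 x4[of "c i"] y2[of "c i" "n - 2"] cn n 3 I(5)
          by (simp add: right_diff_distrib)
      next
        case 2
        then show ?thesis using y2[of "c i" i] y2[of "c i" "n - 2"] c1 n 3 I(5)
          by (simp add: right_diff_distrib)
      next
        case 3
        then show ?thesis using y2[of "c i" i] y2[of "c i" "n - 2"] c0 n \<open>n \<ge> 3\<close> I(5)
          by (simp add: right_diff_distrib)
      next
        case 4
        then show ?thesis using I(2)[OF mid] by simp
      qed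
    qed
    then have "(\<Sum>i\<le>n. of_int (c i) * (m i - ?e)) \<in> J" using I(6)[of "{..n}"] by simp
    moreover have "of_int (\<Sum>i\<le>n. c i) * ?e \<in> J" using total y2[of "\<Sum>i\<le>n. c i" "n - 2"] 3 by simp
    moreover have "(\<Sum>i\<le>n. of_int (c i) * X_var ^ i * Y_var ^ (n - i)) =
        (\<Sum>i\<le>n. of_int (c i) * (m i - ?e)) + of_int (\<Sum>i\<le>n. c i) * ?e"
      by (simp add: right_diff_distrib sum_subtractf sum_distrib_right m_def mult.assoc)
    ultimately show ?thesis using I(1) by simp
  qed
qed


section \<open>Presentations of associated graded rings\<close>

text \<open>The filtration is the image of the powers of the ideal (x, y) under a homomorphism from
  Z[x, y]. Every coset in the graded ring then has a polynomial representative, and all computations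
  can be made with polynomials.\<close>

locale filtered_evaluation = ring R
  for R :: "'a ring" (structure) +
  fixes F :: "nat \<Rightarrow> 'a set" and ev :: "int poly poly \<Rightarrow> 'a"
  assumes ev_closed: "ev p \<in> carrier R"
    and ev_add: "ev (p + q) = ev p \<oplus> ev q"
    and ev_mult: "ev (p * q) = ev p \<otimes> ev q"
    and ev_one: "ev 1 = \<one>"
    and filtration_eq: "F n = ev ` order_ge n"
begin

lemma ev_zero: "ev 0 = \<zero>"
  using ev_add[of 0 0] ev_closed by (metis add.r_cancel_one' add_0)

lemma ev_diff_zero_iff: "ev p = ev q \<longleftrightarrow> ev (p - q) = \<zero>"
  using ev_add[of "p - q" q] ev_closed[of q] ev_closed[of "p - q"] by auto

text \<open>This is an element of F n / F (n + 1) only for \<open>p\<close> in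
  \<open>order_ge n\<close>; admitting every \<open>p\<close> keeps the rules for equality and
  addition free of side conditions.\<close>

definition cls :: "nat \<Rightarrow> int poly poly \<Rightarrow> 'a set" where
  "cls n p = F (Suc n) +> ev p"

lemma coset_eq: "F (Suc n) +> ev p = {ev (p + m) | m. m \<in> order_ge (Suc n)}"
  by (auto simp: filtration_eq a_r_coset_def r_coset_def ev_add[symmetric] add.commute)

lemma cls_alt: "cls n p = {ev (p + m) | m. m \<in> order_ge (Suc n)}"
  by (simp add: cls_def coset_eq)

lemma cls_eqI: "ev p = ev (q + m) \<Longrightarrow> m \<in> order_ge (Suc n) \<Longrightarrow> cls n p = cls n q"
proof -
  assume eq: "ev p = ev (q + m)" and m: "m \<in> order_ge (Suc n)"
  have 1: "ev (p + k) = ev (q + (m + k))" for k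
    using eq by (simp add: ev_add add.assoc[symmetric])
  have 2: "ev (q + k) = ev (p + (k - m))" for k
    using 1[of "k - m"] by simp
  show ?thesis
    unfolding cls_alt by (auto, (metis 1 m order_ge_add), (metis 2 m order_ge_diff))
qed

lemma cls_eq_iff: "cls n p = cls n q \<longleftrightarrow> ev (p - q) \<in> F (Suc n)"
proof
  assume "cls n p = cls n q"
  moreover have "ev p \<in> cls n p"
    unfolding cls_alt using order_ge_zero by force
  ultimately obtain m where m: "ev p = ev (q + m)" "m \<in> order_ge (Suc n)" by (auto simp: cls_alt)
  have "ev (p - q) = ev m"
    using m(1) by (simp add: ev_diff_zero_iff[of p] ev_diff_zero_iff[of "p - q"] algebra_simps)
  then show "ev (p - q) \<in> F (Suc n)" using m(2) by (simp add: filtration_eq)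
next
  assume "ev (p - q) \<in> F (Suc n)"
  then obtain m where "ev (p - q) = ev m" "m \<in> order_ge (Suc n)" by (auto simp: filtration_eq)
  then show "cls n p = cls n q"
    by (intro cls_eqI[of p q m]) (simp_all add: ev_diff_zero_iff[of p] ev_diff_zero_iff[of "p - q"] algebra_simps)
qed

lemma cls_zero: "cls n 0 = F (Suc n)"
  by (auto simp: cls_alt filtration_eq)

lemma carrier_gr_component: "carrier (gr_component R F n) = cls n ` order_ge n"
  by (auto simp: gr_component_def FactGroup_def RCOSETS_def cls_def a_r_coset_def r_coset_def filtration_eq)

lemma one_gr_component: "\<one>\<^bsub>gr_component R F n\<^esub> = cls n 0"
  by (simp add: gr_component_def FactGroup_def cls_zero)

lemma mult_gr_component: "cls n p \<otimes>\<^bsub>gr_component R F n\<^esub> cls n q = cls n (p + q)"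
proof -
  have "cls n p \<otimes>\<^bsub>gr_component R F n\<^esub> cls n q = (\<Union>a\<in>cls n p. \<Union>b\<in>cls n q. {a \<oplus> b})"
    by (simp add: gr_component_def FactGroup_def set_mult_def)
  also have "\<dots> = {ev ((p + q) + (m + m')) | m m'. m \<in> order_ge (Suc n) \<and> m' \<in> order_ge (Suc n)}"
  proof -
    have "ev (p + m) \<oplus> ev (q + m') = ev ((p + q) + (m + m'))" for m m'
      by (simp add: ev_add[symmetric] algebra_simps)
    moreover have "(\<Union>a\<in>cls n p. \<Union>b\<in>cls n q. {a \<oplus> b}) =
        {ev (p + m) \<oplus> ev (q + m') | m m'. m \<in> order_ge (Suc n) \<and> m' \<in> order_ge (Suc n)}"
      unfolding cls_alt by blast
    ultimately show ?thesis by (simp only:)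
  qed
  also have "\<dots> = cls n (p + q)"
    unfolding cls_alt by (auto intro: order_ge_add) (metis add_0_right order_ge_zero)
  finally show ?thesis .
qed

lemma comm_group_gr_component: "comm_group (gr_component R F n)"
proof (rule comm_groupI)
  fix x assume "x \<in> carrier (gr_component R F n)"
  then obtain p where p: "x = cls n p" "p \<in> order_ge n" by (auto simp: carrier_gr_component)
  then show "\<exists>y\<in>carrier (gr_component R F n). y \<otimes>\<^bsub>gr_component R F n\<^esub> x = \<one>\<^bsub>gr_component R F n\<^esub>"
    by (intro bexI[of _ "cls n (- p)"])
      (auto simp: carrier_gr_component mult_gr_component one_gr_component order_ge_uminus)
qed (auto simp: carrier_gr_component mult_gr_component one_gr_component order_ge_add order_ge_zero algebra_simps)

text \<open>The difference (p + m) (q + m') - p q = p m' + m (q + m') has order above i + j.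
  \<open>rcoset_mult\<close> is a union over all pairs of representatives, so it is a nonempty union
  of equal cosets.\<close>

lemma rcoset_mult_cls:
  assumes p: "p \<in> order_ge i" and q: "q \<in> order_ge j"
  shows "rcoset_mult R (F (Suc (i + j))) (cls i p) (cls j q) = cls (i + j) (p * q)"
proof -
  have "cls (i + j) ((p + m) * (q + m')) = cls (i + j) (p * q)"
    if m: "m \<in> order_ge (Suc i)" and m': "m' \<in> order_ge (Suc j)" for m m'
  proof (rule cls_eqI)
    show "ev ((p + m) * (q + m')) = ev (p * q + (p * m' + m * (q + m')))"
      by (simp add: algebra_simps)
    have "q + m' \<in> order_ge j" using q order_ge_antimono[OF m', of j] by (intro order_ge_add) simp_all
    then show "p * m' + m * (q + m') \<in> order_ge (Suc (i + j))"
      using order_ge_mult[OF p m'] order_ge_mult[OF m, of "q + m'" j] by (auto intro: order_ge_add)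
  qed
  then have "F (Suc (i + j)) +> (a \<otimes> b) = cls (i + j) (p * q)" if "a \<in> cls i p" "b \<in> cls j q" for a b
    using that by (auto simp: cls_alt[of i] cls_alt[of j] ev_mult[symmetric] cls_def[symmetric])
  moreover have "cls i p \<noteq> {}" "cls j q \<noteq> {}" unfolding cls_alt using order_ge_zero by blast+
  ultimately show ?thesis unfolding rcoset_mult_def by auto
qed

lemma finprod_gr_component:
  assumes "finite A" "\<And>i. i \<in> A \<Longrightarrow> f i \<in> order_ge n"
  shows "finprod (gr_component R F n) (\<lambda>i. cls n (f i)) A = cls n (\<Sum>i\<in>A. f i)"
proof -
  interpret C: comm_group "gr_component R F n" by (rule comm_group_gr_component)
  show ?thesis
    using assms
  proof (induction A rule: finite_induct)
    case empty
    show ?case by (simp add: one_gr_component)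
  next
    case (insert a A)
    have "(\<lambda>i. cls n (f i)) \<in> A \<rightarrow> carrier (gr_component R F n)" "cls n (f a) \<in> carrier (gr_component R F n)"
      using insert.prems by (auto simp: carrier_gr_component)
    with insert show ?case by (simp add: C.finprod_insert mult_gr_component)
  qed
qed

section \<open>The map from polynomials to the graded ring and its kernel\<close>

definition symbol :: "int poly poly \<Rightarrow> nat \<Rightarrow> 'a set" where
  "symbol p = (\<lambda>n. cls n (hpart n p))"

lemma carrier_gr_ring: "carrier (gr_ring R F) = {x. (\<forall>n. x n \<in> cls n ` order_ge n) \<and> finite {n. x n \<noteq> cls n 0}}"
proof -
  have "group (gr_component R F n)" for n
    using comm_group_gr_component comm_group.axioms(2) by blast
  then show ?thesis
    by (auto simp: gr_ring_def carrier_sum_group carrier_gr_component one_gr_component)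
qed

lemma symbol_closed: "symbol p \<in> carrier (gr_ring R F)"
proof -
  have "{n. symbol p n \<noteq> cls n 0} \<subseteq> {..degree (graded_poly p)}"
    using hpart_eq_0[of p] by (force simp: symbol_def not_le[symmetric])
  then have "finite {n. symbol p n \<noteq> cls n 0}" using finite_subset by blast
  then show ?thesis by (auto simp: carrier_gr_ring symbol_def hpart_order_ge)
qed

text \<open>In each degree a homogeneous representative is chosen, namely 0 where the coset is
  trivial, and these are summed over the finite support. The second conjunct lets a homogeneous
  element come from a form, as needed for compatibility with degrees.\<close>

lemma symbol_surj:
  assumes "x \<in> carrier (gr_ring R F)"
  shows "\<exists>p. symbol p = x \<and> (\<forall>n. x n = cls n 0 \<longrightarrow> hpart n p = 0)"
proof -
  have "\<exists>p. hpart n p = p \<and> x n = cls n p \<and> (x n = cls n 0 \<longrightarrow> p = 0)" for n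
  proof (cases "x n = cls n 0")
    case True
    then show ?thesis by (intro exI[of _ 0]) simp
  next
    case False
    obtain q where q: "x n = cls n q" "q \<in> order_ge n"
      using assms by (auto simp: carrier_gr_ring)
    have "cls n q = cls n (hpart n q)"
      using diff_hpart_order_ge[OF q(2)] by (intro cls_eqI[of _ _ "q - hpart n q"]) auto
    then show ?thesis using q False by (intro exI[of _ "hpart n q"]) (auto simp: hpart_hpart)
  qed
  then obtain f where f: "\<And>n. hpart n (f n) = f n" "\<And>n. x n = cls n (f n)" "\<And>n. x n = cls n 0 \<Longrightarrow> f n = 0"
    by metis
  define S where "S = {n. x n \<noteq> cls n 0}"
  have S: "finite S" using assms by (simp add: S_def carrier_gr_ring)
  have hp: "hpart n (f k) = (if k = n then f n else 0)" for n k
    using hpart_hpart[of n k "f k"] f(1) by simp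
  have "hpart n (\<Sum>k\<in>S. f k) = f n" for n
    using S f(3)[of n] by (simp add: hpart_sum hp S_def)
  then show ?thesis using f by (intro exI[of _ "\<Sum>k\<in>S. f k"]) (auto simp: symbol_def)
qed

lemma symbol_eq_iff: "symbol p = symbol q \<longleftrightarrow> (\<forall>n. ev (hpart n (p - q)) \<in> F (Suc n))"
  by (simp add: symbol_def fun_eq_iff cls_eq_iff)

lemma symbol_add: "symbol p \<oplus>\<^bsub>gr_ring R F\<^esub> symbol q = symbol (p + q)"
  by (simp add: gr_ring_def symbol_def mult_gr_component fun_eq_iff)

lemma symbol_one: "\<one>\<^bsub>gr_ring R F\<^esub> = symbol 1"
proof -
  have "cls 0 1 = F 1 +> \<one>" by (simp add: cls_def ev_one)
  then show ?thesis by (auto simp: gr_ring_def symbol_def hpart_1 cls_zero fun_eq_iff)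
qed

lemma symbol_mult: "symbol p \<otimes>\<^bsub>gr_ring R F\<^esub> symbol q = symbol (p * q)"
proof
  fix n
  interpret C: comm_group "gr_component R F n" by (rule comm_group_gr_component)
  have prod: "hpart i p * hpart (n - i) q \<in> order_ge n" if "i \<le> n" for i
    using order_ge_mult[OF hpart_order_ge[of i p] hpart_order_ge[of "n - i" q]] that by simp
  have "(symbol p \<otimes>\<^bsub>gr_ring R F\<^esub> symbol q) n =
      finprod (gr_component R F n) (\<lambda>i. rcoset_mult R (F (Suc n)) (symbol p i) (symbol q (n - i))) {..n}"
    by (simp add: gr_ring_def)
  also have "\<dots> = finprod (gr_component R F n) (\<lambda>i. cls n (hpart i p * hpart (n - i) q)) {..n}"
  proof (rule C.finprod_cong')
    show "(\<lambda>i. cls n (hpart i p * hpart (n - i) q)) \<in> {..n} \<rightarrow> carrier (gr_component R F n)"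
      using prod by (auto simp: carrier_gr_component)
    show "rcoset_mult R (F (Suc n)) (symbol p i) (symbol q (n - i)) = cls n (hpart i p * hpart (n - i) q)"
      if "i \<in> {..n}" for i
      using rcoset_mult_cls[OF hpart_order_ge[of i p] hpart_order_ge[of "n - i" q]] that
      by (simp add: symbol_def)
  qed simp
  also have "\<dots> = symbol (p * q) n"
    using finprod_gr_component[of "{..n}" "\<lambda>i. hpart i p * hpart (n - i) q" n] prod
    by (simp add: symbol_def hpart_mult)
  finally show "(symbol p \<otimes>\<^bsub>gr_ring R F\<^esub> symbol q) n = symbol (p * q) n" .
qed

text \<open>A part of \<open>p\<close> of degree n - i has the value of some \<open>m\<close> of
  order n - i + 1, and multiplying \<open>m\<close> by a form of degree i gives order n + 1. Because
  this kernel of \<open>symbol\<close> is an ideal, it contains all relations once it contains the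
  relators.\<close>

lemma symbol_kernel_ideal: "ideal {p. \<forall>n. ev (hpart n p) \<in> F (Suc n)} ZXY"
proof -
  let ?K = "{p. \<forall>n. ev (hpart n p) \<in> F (Suc n)}"
  have add: "a \<oplus> b \<in> F n" if "a \<in> F n" "b \<in> F n" for a b n
    using that by (auto simp: filtration_eq ev_add[symmetric] intro!: imageI order_ge_add)
  have zero: "ev 0 \<in> F n" for n
    by (simp add: filtration_eq order_ge_zero)
  have sum: "ev (\<Sum>i\<in>A. f i) \<in> F n" if "\<And>i. i \<in> A \<Longrightarrow> ev (f i) \<in> F n" for f n and A :: "nat set"
    using that
  proof (induction A rule: infinite_finite_induct)
    case (insert x A)
    then show ?case by (simp add: ev_add add)
  qed (simp_all add: zero)
  have mult: "q * p \<in> ?K" if p: "p \<in> ?K" for p q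
  proof
    show "\<forall>n. ev (hpart n (q * p)) \<in> F (Suc n)"
    proof
      fix n
      have "ev (hpart i q * hpart (n - i) p) \<in> F (Suc n)" if "i \<in> {..n}" for i
      proof -
        obtain m where m: "m \<in> order_ge (Suc (n - i))" "ev (hpart (n - i) p) = ev m"
          using p by (auto simp: filtration_eq)
        have "ev (hpart i q * hpart (n - i) p) = ev (hpart i q * m)" by (simp add: ev_mult m)
        moreover have "hpart i q * m \<in> order_ge (Suc n)"
          using order_ge_mult[OF hpart_order_ge[of i q] m(1)] that by simp
        ultimately show ?thesis by (simp add: filtration_eq)
      qed
      then show "ev (hpart n (q * p)) \<in> F (Suc n)" unfolding hpart_mult by (rule sum)
    qed
  qed
  have "additive_subgroup ?K ZXY"
  proof (rule additive_subgroup.intro, rule subgroup.intro)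
    show "inv\<^bsub>add_monoid ZXY\<^esub> p \<in> ?K" if p: "p \<in> ?K" for p
    proof -
      have "inv\<^bsub>add_monoid ZXY\<^esub> p = \<ominus>\<^bsub>ZXY\<^esub> p" by (simp add: a_inv_def)
      also have "\<dots> = (- 1) * p" by (simp add: class_ring_simps)
      finally show ?thesis using mult[OF p, of "- 1"] by simp
    qed
  qed (auto simp: ev_add add zero)
  then show ?thesis
    using mult by (intro ideal.intro ideal_axioms.intro class_ring.ring_axioms) (auto simp: mult.commute)
qed

theorem graded_ring_iso_quotient:
  assumes J: "ideal J ZXY" and kernel: "\<And>p. p \<in> J \<longleftrightarrow> (\<forall>n. ev (hpart n p) \<in> F (Suc n))"
  shows "\<exists>\<phi>. \<phi> \<in> graded_ring_iso (gr_ring R F) (gr_degree R F) (ZXY Quot J) (quot_degree J)"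
proof -
  interpret J: ideal J ZXY by (rule J)
  have coset_eq: "J +>\<^bsub>ZXY\<^esub> p = J +>\<^bsub>ZXY\<^esub> q \<longleftrightarrow> p - q \<in> J" for p q
    using ring.quotient_eq_iff_same_a_r_cos[OF class_ring.ring_axioms J, of p q] by (simp add: class_ring_simps)
  \<comment> \<open>The inverse of the map induced by \<open>symbol\<close>. By the kernel condition
    another choice of \<open>p\<close> changes it by an element of \<open>J\<close>.\<close>
  define \<phi> where "\<phi> = (\<lambda>x. J +>\<^bsub>ZXY\<^esub> (SOME p. symbol p = x))"
  have \<phi>: "\<phi> (symbol p) = J +>\<^bsub>ZXY\<^esub> p" for p
  proof -
    have "symbol (SOME q. symbol q = symbol p) = symbol p" by (rule someI) (rule refl)
    then show ?thesis by (simp add: \<phi>_def coset_eq kernel symbol_eq_iff)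
  qed
  have surj: "\<exists>p. x = symbol p" if "x \<in> carrier (gr_ring R F)" for x
    using symbol_surj[OF that] by metis
  have carr: "carrier (ZXY Quot J) = range (\<lambda>p. J +>\<^bsub>ZXY\<^esub> p)"
    by (auto simp: FactRing_def A_RCOSETS_def')
  have "\<phi> \<in> Ring.ring_hom (gr_ring R F) (ZXY Quot J)"
  proof (rule ring_hom_memI)
    fix x assume "x \<in> carrier (gr_ring R F)"
    then obtain p where p: "x = symbol p" using surj by blast
    show "\<phi> x \<in> carrier (ZXY Quot J)" by (auto simp: p \<phi> carr)
    fix y assume "y \<in> carrier (gr_ring R F)"
    then obtain q where q: "y = symbol q" using surj by blast
    show "\<phi> (x \<otimes>\<^bsub>gr_ring R F\<^esub> y) = \<phi> x \<otimes>\<^bsub>ZXY Quot J\<^esub> \<phi> y"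
      using J.rcoset_mult_add[of p q] by (simp add: p q symbol_mult \<phi> FactRing_def)
    show "\<phi> (x \<oplus>\<^bsub>gr_ring R F\<^esub> y) = \<phi> x \<oplus>\<^bsub>ZXY Quot J\<^esub> \<phi> y"
      using J.a_rcos_sum[of p q] by (simp add: p q symbol_add \<phi> FactRing_def)
  next
    show "\<phi> \<one>\<^bsub>gr_ring R F\<^esub> = \<one>\<^bsub>ZXY Quot J\<^esub>"
      by (simp add: symbol_one \<phi> FactRing_def)
  qed
  moreover have "bij_betw \<phi> (carrier (gr_ring R F)) (carrier (ZXY Quot J))"
    unfolding bij_betw_def
  proof
    show "inj_on \<phi> (carrier (gr_ring R F))"
    proof (rule inj_onI)
      fix x y assume "x \<in> carrier (gr_ring R F)" "y \<in> carrier (gr_ring R F)" "\<phi> x = \<phi> y"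
      then show "x = y" using surj[of x] surj[of y] by (auto simp: \<phi> coset_eq kernel symbol_eq_iff)
    qed
    show "\<phi> ` carrier (gr_ring R F) = carrier (ZXY Quot J)"
    proof
      show "\<phi> ` carrier (gr_ring R F) \<subseteq> carrier (ZXY Quot J)"
        using surj by (force simp: \<phi> carr)
      show "carrier (ZXY Quot J) \<subseteq> \<phi> ` carrier (gr_ring R F)"
        unfolding carr using symbol_closed by (auto simp: \<phi>[symmetric])
    qed
  qed
  moreover have "\<phi> ` gr_degree R F n = quot_degree J n" for n
  proof
    show "\<phi> ` gr_degree R F n \<subseteq> quot_degree J n"
    proof
      fix y assume "y \<in> \<phi> ` gr_degree R F n"
      then obtain x where x: "x \<in> carrier (gr_ring R F)" "\<And>m. m \<noteq> n \<Longrightarrow> x m = cls m 0" "y = \<phi> x"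
        by (auto simp: gr_degree_def cls_zero)
      then obtain p where p: "symbol p = x" "\<And>m. x m = cls m 0 \<Longrightarrow> hpart m p = 0"
        using symbol_surj by blast
      have zero: "hpart m p = 0" if "m \<noteq> n" for m using p(2) x(2) that by blast
      have "p = (\<Sum>m\<le>degree (graded_poly p). hpart m p)" by (simp add: sum_hpart)
      also have "hpart n \<dots> = \<dots>"
        unfolding hpart_sum by (intro sum.cong refl) (metis hpart_hpart zero)
      finally have "hpart n p = p" by (simp add: sum_hpart)
      then have "p \<in> homogeneous_polys n" by (simp add: homogeneous_polys_iff)
      then show "y \<in> quot_degree J n" using x(3) p(1) \<phi>[of p] by (auto simp: quot_degree_def)
    qed
    show "quot_degree J n \<subseteq> \<phi> ` gr_degree R F n"
    proof
      fix y assume "y \<in> quot_degree J n"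
      then obtain p where p: "y = J +>\<^bsub>ZXY\<^esub> p" "hpart n p = p"
        by (auto simp: quot_degree_def homogeneous_polys_iff)
      have "symbol p m = F (Suc m)" if "m \<noteq> n" for m
        using hpart_hpart[of m n p] p(2) that by (simp add: symbol_def cls_zero)
      then have "symbol p \<in> gr_degree R F n" by (simp add: gr_degree_def symbol_closed)
      then show "y \<in> \<phi> ` gr_degree R F n" using p(1) \<phi> by (metis imageI)
    qed
  qed
  ultimately show ?thesis unfolding graded_ring_iso_def ring_iso_def by blast
qed

end


section \<open>Characters of finite abelian groups\<close>

lemma subspace_module_vec_iff:
  fixes W :: "'a :: field vec set"
  shows "VectorSpace.subspace class_ring W (module_vec TYPE('a) d) \<longleftrightarrow>
    W \<subseteq> carrier_vec d \<and> 0\<^sub>v d \<in> W \<and> (\<forall>v\<in>W. \<forall>w\<in>W. v + w \<in> W) \<and> (\<forall>c. \<forall>v\<in>W. c \<cdot>\<^sub>v v \<in> W)"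
  unfolding VectorSpace.subspace_def LinearCombinations.submodule_def
  using vec_vs[where 'a = 'a, of d] vec_module[where 'a = 'a, of d]
  by (auto simp: module_vec_def)

lemma eigenspace_subspace:
  fixes A :: "'a :: field mat"
  assumes A: "A \<in> carrier_mat d d"
  shows "VectorSpace.subspace class_ring {v \<in> carrier_vec d. A *\<^sub>v v = e \<cdot>\<^sub>v v} (module_vec TYPE('a) d)"
  unfolding subspace_module_vec_iff using A
  by (auto simp: mult_add_distrib_mat_vec[OF A] mult_mat_vec[OF A] smult_add_distrib_vec smult_smult_assoc mult.commute)

lemma line_subspace:
  fixes v :: "'a :: field vec"
  assumes "v \<in> carrier_vec d"
  shows "VectorSpace.subspace class_ring (range (\<lambda>c. c \<cdot>\<^sub>v v)) (module_vec TYPE('a) d)"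
  unfolding subspace_module_vec_iff
proof (intro conjI ballI allI)
  show "0\<^sub>v d \<in> range (\<lambda>c. c \<cdot>\<^sub>v v)"
    using assms by (intro image_eqI[of _ _ 0]) auto
  fix x assume "x \<in> range (\<lambda>c. c \<cdot>\<^sub>v v)"
  then obtain c where c: "x = c \<cdot>\<^sub>v v" by blast
  show "a \<cdot>\<^sub>v x \<in> range (\<lambda>c. c \<cdot>\<^sub>v v)" for a by (auto simp: c smult_smult_assoc)
  fix y assume "y \<in> range (\<lambda>c. c \<cdot>\<^sub>v v)"
  then obtain c' where "y = c' \<cdot>\<^sub>v v" by blast
  then show "x + y \<in> range (\<lambda>c. c \<cdot>\<^sub>v v)"
    using add_smult_distrib_vec[of c c' v] by (metis c rangeI)
qed (use assms in auto)

text \<open>By commutativity an eigenspace of one \<rho>(g) is invariant under the whole group, so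
  every \<rho>(g) is a scalar. Then the line through the first unit vector is invariant and must be
  everything.\<close>

lemma (in comm_group) irreducible_rep_dim_1:
  assumes irr: "irreducible_rep G d \<rho>"
  shows "d = 1"
proof -
  have \<rho>: "is_rep G d \<rho>" and d: "d > 0" using irr by (auto simp: irreducible_rep_def)
  have inv: "W = {0\<^sub>v d} \<or> W = carrier_vec d"
    if "VectorSpace.subspace class_ring W (module_vec TYPE(complex) d)" "\<And>g w. g \<in> carrier G \<Longrightarrow> w \<in> W \<Longrightarrow> \<rho> g *\<^sub>v w \<in> W" for W
    using irr that by (auto simp: irreducible_rep_def)
  note carr = is_rep_carrier[OF \<rho>]
  have scalar: "\<exists>e. \<forall>v\<in>carrier_vec d. \<rho> g *\<^sub>v v = e \<cdot>\<^sub>v v" if g: "g \<in> carrier G" for g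
  proof -
    obtain as where as: "char_poly (\<rho> g) = (\<Prod>a\<leftarrow>as. [:- a, 1:])" "length as = d"
      using char_poly_factorized[OF carr[OF g]] by blast
    with d obtain e as' where "as = e # as'" by (cases as) auto
    then have "poly (char_poly (\<rho> g)) e = 0" using as by simp
    then have "eigenvalue (\<rho> g) e" using eigenvalue_root_char_poly[OF carr[OF g]] by simp
    then obtain v where v: "v \<in> carrier_vec d" "v \<noteq> 0\<^sub>v d" "\<rho> g *\<^sub>v v = e \<cdot>\<^sub>v v"
      using carr[OF g] by (auto simp: eigenvalue_def eigenvector_def)
    let ?W = "{v \<in> carrier_vec d. \<rho> g *\<^sub>v v = e \<cdot>\<^sub>v v}"
    have "\<rho> h *\<^sub>v w \<in> ?W" if h: "h \<in> carrier G" and w: "w \<in> ?W" for h w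
    proof -
      have "\<rho> g *\<^sub>v (\<rho> h *\<^sub>v w) = \<rho> (g \<otimes> h) *\<^sub>v w"
        using w carr[OF g] carr[OF h] by (simp add: is_rep_mult[OF \<rho> g h])
      also have "\<dots> = \<rho> h *\<^sub>v (\<rho> g *\<^sub>v w)"
        using w carr[OF g] carr[OF h] by (simp add: m_comm[OF g h] is_rep_mult[OF \<rho> h g])
      also have "\<dots> = e \<cdot>\<^sub>v (\<rho> h *\<^sub>v w)"
        using w carr[OF h] by (simp add: mult_mat_vec)
      finally show ?thesis using carr[OF h] w by auto
    qed
    then have "?W = {0\<^sub>v d} \<or> ?W = carrier_vec d"
      by (intro inv[OF eigenspace_subspace[OF carr[OF g]]])
    then show ?thesis using v by blast
  qed
  let ?u = "unit_vec d 0 :: complex vec"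
  have "range (\<lambda>c. c \<cdot>\<^sub>v ?u) = {0\<^sub>v d} \<or> range (\<lambda>c. c \<cdot>\<^sub>v ?u) = carrier_vec d"
  proof (rule inv)
    show "VectorSpace.subspace class_ring (range (\<lambda>c. c \<cdot>\<^sub>v ?u)) (module_vec TYPE(complex) d)"
      by (rule line_subspace) simp
    fix g w assume g: "g \<in> carrier G" and "w \<in> range (\<lambda>c. c \<cdot>\<^sub>v ?u)"
    then obtain c where c: "w = c \<cdot>\<^sub>v ?u" by blast
    obtain e where "\<forall>v\<in>carrier_vec d. \<rho> g *\<^sub>v v = e \<cdot>\<^sub>v v" using scalar[OF g] by blast
    then have "\<rho> g *\<^sub>v w = (e * c) \<cdot>\<^sub>v ?u" by (simp add: c smult_smult_assoc)
    then show "\<rho> g *\<^sub>v w \<in> range (\<lambda>c. c \<cdot>\<^sub>v ?u)" by blast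
  qed
  moreover have "?u \<in> range (\<lambda>c. c \<cdot>\<^sub>v ?u)" by (intro image_eqI[of _ _ 1]) auto
  moreover have "?u \<noteq> 0\<^sub>v d" using d by (metis index_unit_vec(1) index_zero_vec(1) zero_neq_one)
  ultimately have all: "range (\<lambda>c. c \<cdot>\<^sub>v ?u) = carrier_vec d" by auto
  show ?thesis
  proof (rule ccontr)
    assume "d \<noteq> 1"
    with d have d2: "d \<ge> 2" by simp
    have "unit_vec d 1 \<in> range (\<lambda>c. c \<cdot>\<^sub>v ?u)" unfolding all by simp
    then obtain c where "unit_vec d 1 = c \<cdot>\<^sub>v ?u" by blast
    then have "unit_vec d 1 $ 1 = (c \<cdot>\<^sub>v ?u) $ 1" by simp
    then show False using d2 by simp
  qed
qed

lemma linear_rep_irreducible: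
  assumes "is_rep G 1 \<rho>"
  shows "irreducible_rep G 1 \<rho>"
  unfolding irreducible_rep_def
proof (intro conjI allI impI assms)
  fix W assume "VectorSpace.subspace class_ring W (module_vec TYPE(complex) 1) \<and>
      (\<forall>g\<in>carrier G. \<forall>w\<in>W. \<rho> g *\<^sub>v w \<in> W)"
  then have W: "W \<subseteq> carrier_vec 1" "0\<^sub>v 1 \<in> W" "\<And>c v. v \<in> W \<Longrightarrow> c \<cdot>\<^sub>v v \<in> W"
    by (auto simp: subspace_module_vec_iff)
  show "W = {0\<^sub>v 1} \<or> W = carrier_vec 1"
  proof (rule disjCI)
    assume "W \<noteq> carrier_vec 1"
    have "w = 0\<^sub>v 1" if w: "w \<in> W" for w
    proof (rule ccontr)
      assume "w \<noteq> 0\<^sub>v 1"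
      then have w0: "w $ 0 \<noteq> 0" using w W(1) by (auto intro!: eq_vecI)
      have "v = (v $ 0 / w $ 0) \<cdot>\<^sub>v w" if "v \<in> carrier_vec 1" for v
        using that w0 w W(1) by (intro eq_vecI) auto
      then have "carrier_vec 1 \<subseteq> W" using W(3)[OF w] by (metis subsetI)
      then show False using \<open>W \<noteq> carrier_vec 1\<close> W(1) by blast
    qed
    then show "W = {0\<^sub>v 1}" using W(2) by blast
  qed
qed simp

lemma (in group) linear_char_is_rep:
  assumes mult: "\<And>g h. g \<in> carrier G \<Longrightarrow> h \<in> carrier G \<Longrightarrow> \<chi> (g \<otimes> h) = \<chi> g * \<chi> h"
    and nonzero: "\<And>g. g \<in> carrier G \<Longrightarrow> \<chi> g \<noteq> 0"
  shows "is_rep G 1 (\<lambda>g. mat 1 1 (\<lambda>_. \<chi> g))"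
  unfolding is_rep_def hom_def
proof (intro CollectI conjI ballI)
  have prod: "mat 1 1 (\<lambda>_. a) * mat 1 1 (\<lambda>_. b) = mat 1 1 (\<lambda>_. a * b)" for a b :: complex
    by (intro eq_matI) (auto simp: scalar_prod_def)
  show "(\<lambda>g. mat 1 1 (\<lambda>_. \<chi> g)) \<in> carrier G \<rightarrow> carrier (GL 1)"
  proof
    fix g assume g: "g \<in> carrier G"
    have one: "mat 1 1 (\<lambda>_. 1) = (1\<^sub>m 1 :: complex mat)" by (intro eq_matI) auto
    have "mat 1 1 (\<lambda>_. inverse (\<chi> g)) * mat 1 1 (\<lambda>_. \<chi> g) = 1\<^sub>m 1"
      "mat 1 1 (\<lambda>_. \<chi> g) * mat 1 1 (\<lambda>_. inverse (\<chi> g)) = 1\<^sub>m 1"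
      unfolding prod one[symmetric] using nonzero[OF g] by simp_all
    then show "mat 1 1 (\<lambda>_. \<chi> g) \<in> carrier (GL 1)"
      by (auto simp: GL_def units_of_def Units_def ring_mat_simps intro!: bexI[of _ "mat 1 1 (\<lambda>_. inverse (\<chi> g))"])
  qed
  fix g h assume "g \<in> carrier G" "h \<in> carrier G"
  then show "mat 1 1 (\<lambda>_. \<chi> (g \<otimes> h)) = mat 1 1 (\<lambda>_. \<chi> g) \<otimes>\<^bsub>GL 1\<^esub> mat 1 1 (\<lambda>_. \<chi> h)"
    by (simp add: mult prod[unfolded One_nat_def] GL_def units_of_def ring_mat_simps)
qed

lemma (in group) linear_char_irr:
  assumes "\<And>g h. g \<in> carrier G \<Longrightarrow> h \<in> carrier G \<Longrightarrow> \<chi> (g \<otimes> h) = \<chi> g * \<chi> h"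
    and "\<And>g. g \<in> carrier G \<Longrightarrow> \<chi> g \<noteq> 0"
  shows "(\<lambda>g\<in>carrier G. \<chi> g) \<in> irr_chars G"
proof -
  have irr: "irreducible_rep G 1 (\<lambda>g. mat 1 1 (\<lambda>_. \<chi> g))"
    by (intro linear_rep_irreducible linear_char_is_rep assms)
  have char: "rep_char G (\<lambda>g. mat 1 1 (\<lambda>_. \<chi> g)) = (\<lambda>g\<in>carrier G. \<chi> g)"
    by (simp add: rep_char_def mat_trace_def)
  show ?thesis
    unfolding irr_chars_def mem_Collect_eq by (intro exI conjI) (rule char[symmetric], rule irr)
qed

lemma (in comm_group) irr_char_linear:
  assumes "\<chi> \<in> irr_chars G"
  shows "\<chi> \<in> extensional (carrier G)" "\<chi> \<one> = 1"
    "\<And>g h. g \<in> carrier G \<Longrightarrow> h \<in> carrier G \<Longrightarrow> \<chi> (g \<otimes> h) = \<chi> g * \<chi> h"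
proof -
  obtain d \<rho> where irr: "irreducible_rep G d \<rho>" and \<chi>: "\<chi> = rep_char G \<rho>"
    using assms by (auto simp: irr_chars_def)
  have "d = 1" by (rule irreducible_rep_dim_1[OF irr])
  then have \<rho>: "is_rep G 1 \<rho>" using irr by (simp add: irreducible_rep_def)
  note carr = is_rep_carrier[OF \<rho>]
  have val: "\<chi> g = \<rho> g $$ (0, 0)" if "g \<in> carrier G" for g
    using carr[OF that] that by (simp add: \<chi> rep_char_def mat_trace_def)
  show "\<chi> \<in> extensional (carrier G)" by (simp add: \<chi> rep_char_def)
  show "\<chi> \<one> = 1" by (simp add: val is_rep_one[OF \<rho>])
  show "\<chi> (g \<otimes> h) = \<chi> g * \<chi> h" if "g \<in> carrier G" "h \<in> carrier G" for g h
    using that carr[OF that(1)] carr[OF that(2)]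
    by (simp add: val is_rep_mult[OF \<rho>] scalar_prod_def)
qed

text \<open>The sum of the matrices \<open>\<psi>(h) \<rho>(h)\<close> is \<open>|G|\<close> times an idempotent, and the trace of an idempotent is its rank.\<close>

lemma (in group) multiplicity_integer:
  assumes fin: "finite (carrier G)" and \<rho>: "is_rep G d \<rho>"
    and mult: "\<And>g h. g \<in> carrier G \<Longrightarrow> h \<in> carrier G \<Longrightarrow> \<psi> (g \<otimes> h) = \<psi> g * \<psi> h"
  obtains m :: nat where "(\<Sum>h\<in>carrier G. \<psi> h * rep_char G \<rho> h) = of_nat m * of_nat (card (carrier G))"
proof -
  note carr = is_rep_carrier[OF \<rho>]
  define E where "E = mat d d (\<lambda>(r, c). \<Sum>h\<in>carrier G. \<psi> h * \<rho> h $$ (r, c))"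
  have E: "E \<in> carrier_mat d d" by (simp add: E_def)
  have "E * E = of_nat (card (carrier G)) \<cdot>\<^sub>m E"
  proof (rule eq_matI)
    fix r c assume "r < dim_row (of_nat (card (carrier G)) \<cdot>\<^sub>m E)" "c < dim_col (of_nat (card (carrier G)) \<cdot>\<^sub>m E)"
    then have rc: "r < d" "c < d" using E by auto
    have "(E * E) $$ (r, c) = (\<Sum>k<d. (\<Sum>g\<in>carrier G. \<psi> g * \<rho> g $$ (r, k)) * (\<Sum>h\<in>carrier G. \<psi> h * \<rho> h $$ (k, c)))"
      using rc by (simp add: E_def scalar_prod_def lessThan_atLeast0)
    also have "\<dots> = (\<Sum>k<d. \<Sum>g\<in>carrier G. \<Sum>h\<in>carrier G. \<psi> g * \<psi> h * (\<rho> g $$ (r, k) * \<rho> h $$ (k, c)))"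
      unfolding sum_product by (intro sum.cong refl) (simp only: ac_simps)
    also have "\<dots> = (\<Sum>g\<in>carrier G. \<Sum>k<d. \<Sum>h\<in>carrier G. \<psi> g * \<psi> h * (\<rho> g $$ (r, k) * \<rho> h $$ (k, c)))"
      by (rule sum.swap)
    also have "\<dots> = (\<Sum>g\<in>carrier G. \<Sum>h\<in>carrier G. \<Sum>k<d. \<psi> g * \<psi> h * (\<rho> g $$ (r, k) * \<rho> h $$ (k, c)))"
      by (intro sum.cong refl sum.swap)
    also have "\<dots> = (\<Sum>g\<in>carrier G. \<Sum>h\<in>carrier G. \<psi> (g \<otimes> h) * \<rho> (g \<otimes> h) $$ (r, c))"
    proof (intro sum.cong refl)
      fix g h assume gh: "g \<in> carrier G" "h \<in> carrier G"
      have "\<rho> (g \<otimes> h) $$ (r, c) = (\<Sum>k<d. \<rho> g $$ (r, k) * \<rho> h $$ (k, c))"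
        using carr[OF gh(1)] carr[OF gh(2)] rc
        by (simp add: is_rep_mult[OF \<rho> gh] scalar_prod_def lessThan_atLeast0)
      then show "(\<Sum>k<d. \<psi> g * \<psi> h * (\<rho> g $$ (r, k) * \<rho> h $$ (k, c))) = \<psi> (g \<otimes> h) * \<rho> (g \<otimes> h) $$ (r, c)"
        by (simp add: mult[OF gh] sum_distrib_left)
    qed
    \<comment> \<open>For fixed \<open>g\<close> left translation permutes the group, so each of the
      |G| inner sums is the same entry of \<open>E\<close>.\<close>
    also have "\<dots> = (\<Sum>g\<in>carrier G. \<Sum>h\<in>carrier G. \<psi> h * \<rho> h $$ (r, c))"
    proof (rule sum.cong[OF refl])
      fix g assume g: "g \<in> carrier G"
      have "bij_betw (\<lambda>h. g \<otimes> h) (carrier G) (carrier G)"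
        using g inj_on_cmult surj_const_mult by (auto simp: bij_betw_def)
      then show "(\<Sum>h\<in>carrier G. \<psi> (g \<otimes> h) * \<rho> (g \<otimes> h) $$ (r, c)) = (\<Sum>h\<in>carrier G. \<psi> h * \<rho> h $$ (r, c))"
        by (rule sum.reindex_bij_betw[of _ _ _ "\<lambda>h. \<psi> h * \<rho> h $$ (r, c)"])
    qed
    also have "\<dots> = (of_nat (card (carrier G)) \<cdot>\<^sub>m E) $$ (r, c)"
      using rc by (simp add: E_def)
    finally show "(E * E) $$ (r, c) = (of_nat (card (carrier G)) \<cdot>\<^sub>m E) $$ (r, c)" .
  qed (auto simp: E_def)
  then obtain m where "mat_trace E = of_nat m * of_nat (card (carrier G))"
    using mat_trace_scaled_idempotent[OF E] by metis
  moreover have "mat_trace E = (\<Sum>h\<in>carrier G. \<psi> h * rep_char G \<rho> h)"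
  proof -
    have "mat_trace E = (\<Sum>h\<in>carrier G. \<Sum>i<d. \<psi> h * \<rho> h $$ (i, i))"
      by (simp add: mat_trace_def E_def sum.swap[of _ "carrier G"])
    also have "\<dots> = (\<Sum>h\<in>carrier G. \<psi> h * rep_char G \<rho> h)"
    proof (rule sum.cong[OF refl])
      fix h assume h: "h \<in> carrier G"
      show "(\<Sum>i<d. \<psi> h * \<rho> h $$ (i, i)) = \<psi> h * rep_char G \<rho> h"
        using carr[OF h] h by (simp add: rep_char_def mat_trace_def sum_distrib_left)
    qed
    finally show ?thesis .
  qed
  ultimately have "(\<Sum>h\<in>carrier G. \<psi> h * rep_char G \<rho> h) = of_nat m * of_nat (card (carrier G))"
    by simp
  then show thesis by (rule that)
qed


section \<open>The group of order eight\<close>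

definition C4C2 :: "(int \<times> int) monoid" where
  "C4C2 = integer_mod_group 4 \<times>\<times> integer_mod_group 2"

lemma comm_group_C4C2: "comm_group C4C2"
proof -
  interpret A: comm_group "integer_mod_group 4" by simp
  interpret B: comm_group "integer_mod_group 2" by simp
  interpret group C4C2 unfolding C4C2_def by (rule DirProd_group) simp_all
  show ?thesis
    by (rule group_comm_groupI) (auto simp: C4C2_def add.commute)
qed

interpretation C: comm_group C4C2
  by (rule comm_group_C4C2)

lemma carrier_C4C2: "carrier C4C2 = {0, 1, 2, 3} \<times> {0, 1}"
proof -
  have "{0..<4} = {0, 1, 2, 3 :: int}" "{0..<2} = {0, 1 :: int}" by auto
  then show ?thesis by (simp add: C4C2_def carrier_integer_mod_group)
qed

lemma one_C4C2: "\<one>\<^bsub>C4C2\<^esub> = (0, 0)"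
  by (simp add: C4C2_def)

lemma mult_C4C2: "(k, l) \<otimes>\<^bsub>C4C2\<^esub> (k', l') = ((k + k') mod 4, (l + l') mod 2)"
  by (simp add: C4C2_def)

definition gen_a :: "int \<times> int \<Rightarrow> complex" where
  "gen_a g = \<i> ^ nat (fst g)"

definition gen_b :: "int \<times> int \<Rightarrow> complex" where
  "gen_b g = (- 1) ^ nat (snd g)"

lemma gen_mult:
  assumes "g \<in> carrier C4C2" "h \<in> carrier C4C2"
  shows "gen_a (g \<otimes>\<^bsub>C4C2\<^esub> h) = gen_a g * gen_a h" "gen_b (g \<otimes>\<^bsub>C4C2\<^esub> h) = gen_b g * gen_b h"
proof -
  have "nat 2 = 2" "nat 3 = 3" by simp_all
  then show "gen_a (g \<otimes>\<^bsub>C4C2\<^esub> h) = gen_a g * gen_a h" "gen_b (g \<otimes>\<^bsub>C4C2\<^esub> h) = gen_b g * gen_b h"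
    using assms unfolding carrier_C4C2
    by (auto simp: gen_a_def gen_b_def power2_eq_square power3_eq_cube mult_C4C2)
qed

lemma gen_one [simp]: "gen_a (0, 0) = 1" "gen_b (0, 0) = 1"
  by (simp_all add: gen_a_def gen_b_def)

lemma gen_values: "g \<in> carrier C4C2 \<Longrightarrow> gen_a g \<in> {1, \<i>, - 1, - \<i>} \<and> gen_b g \<in> {1, - 1}"
  by (auto simp: carrier_C4C2 gen_a_def gen_b_def power2_eq_square power3_eq_cube)

lemma gen_nonzero: "g \<in> carrier C4C2 \<Longrightarrow> gen_a g \<noteq> 0" "g \<in> carrier C4C2 \<Longrightarrow> gen_b g \<noteq> 0"
  using gen_values[of g] by auto

lemma pow_C4C2_closed: "g \<in> carrier C4C2 \<Longrightarrow> g [^]\<^bsub>C4C2\<^esub> (k :: nat) \<in> carrier C4C2"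
  by (rule C.nat_pow_closed)

lemma linear_char_pow:
  assumes "\<chi> \<one>\<^bsub>C4C2\<^esub> = 1" and mult: "\<And>g h. g \<in> carrier C4C2 \<Longrightarrow> h \<in> carrier C4C2 \<Longrightarrow> \<chi> (g \<otimes>\<^bsub>C4C2\<^esub> h) = \<chi> g * \<chi> h"
    and g: "g \<in> carrier C4C2"
  shows "\<chi> (g [^]\<^bsub>C4C2\<^esub> (k :: nat)) = (\<chi> g :: complex) ^ k"
proof (induction k)
  case 0
  show ?case using assms(1) by (simp only: C.nat_pow_0 power_0)
next
  case (Suc k)
  have "\<chi> (g [^]\<^bsub>C4C2\<^esub> Suc k) = \<chi> (g [^]\<^bsub>C4C2\<^esub> k) * \<chi> g"
    unfolding C.nat_pow_Suc by (rule mult[OF pow_C4C2_closed[OF g] g])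
  then show ?case using Suc by simp
qed

definition ev :: "int poly poly \<Rightarrow> int \<times> int \<Rightarrow> complex" where
  "ev p = (\<lambda>g\<in>carrier C4C2. poly2 p (gen_a g - 1) (gen_b g - 1))"

lemma ev_apply: "g \<in> carrier C4C2 \<Longrightarrow> ev p g = poly2 p (gen_a g - 1) (gen_b g - 1)"
  by (simp add: ev_def)

lemma ev_eqI:
  assumes "x \<in> extensional (carrier C4C2)"
    "\<And>g. g \<in> carrier C4C2 \<Longrightarrow> x g = poly2 p (gen_a g - 1) (gen_b g - 1)"
  shows "x = ev p"
  using assms by (intro extensionalityI[of _ "carrier C4C2"]) (auto simp: ev_def)

text \<open>The exponents are natural numbers rather than residues, so products of characters simply
  add exponents; each character occurs many times.\<close>

definition chi_poly :: "nat \<Rightarrow> nat \<Rightarrow> int poly poly" where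
  "chi_poly i j = (1 + X_var) ^ i * (1 + Y_var) ^ j"

lemma poly2_chi_poly: "poly2 (chi_poly i j) (a - 1) (b - 1) = a ^ i * b ^ j"
  by (simp add: chi_poly_def)

lemma ev_chi_poly_irr: "ev (chi_poly i j) \<in> irr_chars C4C2"
  unfolding ev_def poly2_chi_poly
  by (rule C.linear_char_irr) (simp_all only: gen_mult power_mult_distrib gen_nonzero mult_eq_0_iff power_eq_0_iff ac_simps, auto simp: gen_nonzero)

text \<open>A character is fixed by its values z and w at (1, 0) and (0, 1). From z^4 = 1 and w^2 =
  1 these are powers of \<i> and of -1.\<close>

lemma irr_chars_C4C2: "irr_chars C4C2 = {ev (chi_poly i j) | i j. True}"
proof
  show "{ev (chi_poly i j) | i j. True} \<subseteq> irr_chars C4C2" using ev_chi_poly_irr by blast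
  show "irr_chars C4C2 \<subseteq> {ev (chi_poly i j) | i j. True}"
  proof
    fix \<chi> assume "\<chi> \<in> irr_chars C4C2"
    note lin = C.irr_char_linear[OF this]
    note pow = linear_char_pow[OF lin(2,3)]
    have mult: "\<chi> ((k + k') mod 4, (l + l') mod 2) = \<chi> (k, l) * \<chi> (k', l')"
      if "(k, l) \<in> carrier C4C2" "(k', l') \<in> carrier C4C2" for k l k' l'
      using lin(3)[OF that] by (simp only: mult_C4C2)
    have one: "\<chi> (0, 0) = 1" using lin(2) by (simp only: one_C4C2)
    let ?z = "\<chi> (1, 0)" and ?w = "\<chi> (0, 1)"
    have a2: "\<chi> (2, 0) = ?z * ?z" using mult[of 1 0 1 0] by (simp add: carrier_C4C2)
    have a3: "\<chi> (3, 0) = ?z * ?z * ?z" using mult[of 2 0 1 0] a2 by (simp add: carrier_C4C2)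
    have a4: "?z * ?z * ?z * ?z = 1" using mult[of 3 0 1 0] a3 one by (simp add: carrier_C4C2)
    have b2: "?w * ?w = 1" using mult[of 0 1 0 1] one by (simp add: carrier_C4C2)
    have ab: "\<chi> (k, 1) = \<chi> (k, 0) * ?w" if "k \<in> {0, 1, 2, 3}" for k
      using mult[of k 0 0 1] that by (auto simp: carrier_C4C2)
    have "(?z - 1) * (?z + 1) * ((?z - \<i>) * (?z + \<i>)) = ?z * ?z * ?z * ?z - 1"
      by (simp add: algebra_simps)
    then have "?z = 1 \<or> ?z = - 1 \<or> ?z = \<i> \<or> ?z = - \<i>"
      using a4 by (simp add: eq_neg_iff_add_eq_0)
    then obtain i :: nat where i: "?z = \<i> ^ i"
      by (metis i_squared power_0 power_one_right power3_eq_cube mult_minus1 power2_eq_square)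
    have "(?w - 1) * (?w + 1) = 0" using b2 by (simp add: algebra_simps)
    then have "?w = 1 \<or> ?w = - 1" by (simp add: eq_neg_iff_add_eq_0)
    then obtain j :: nat where j: "?w = (- 1) ^ j"
      by (metis power_0 power_one_right)
    have "\<chi> = ev (chi_poly i j)"
    proof (rule ev_eqI[OF lin(1)])
      fix g assume "g \<in> carrier C4C2"
      then obtain k l where g: "g = (k, l)" "k \<in> {0, 1, 2, 3}" "l \<in> {0, 1}" unfolding carrier_C4C2 by blast
      have "\<chi> (k, 0) = ?z ^ nat k"
        using g(2) a2 a3 one by (auto simp: power2_eq_square power3_eq_cube)
      also have "\<dots> = gen_a (k, l) ^ i"
        by (simp add: gen_a_def i mult.commute flip: power_mult)
      finally have "\<chi> (k, 0) = gen_a (k, l) ^ i" .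
      moreover have "\<chi> (k, l) = \<chi> (k, 0) * gen_b (k, l) ^ j"
        using g(2,3) ab[of k] j by (auto simp: gen_b_def)
      ultimately show "\<chi> g = poly2 (chi_poly i j) (gen_a g - 1) (gen_b g - 1)"
        by (simp only: g poly2_chi_poly)
    qed
    then show "\<chi> \<in> {ev (chi_poly i j) | i j. True}" by blast
  qed
qed

lemma ev_zero: "ev 0 = (\<lambda>g\<in>carrier C4C2. 0)"
  and ev_add: "ev (p + q) = ev p \<oplus>\<^bsub>char_ring C4C2\<^esub> ev q"
  and ev_mult: "ev (p * q) = ev p \<otimes>\<^bsub>char_ring C4C2\<^esub> ev q"
  and ev_one: "ev 1 = \<one>\<^bsub>char_ring C4C2\<^esub>"
  and ev_uminus: "ev (- p) = (\<lambda>g\<in>carrier C4C2. - ev p g)"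
  by (auto simp: ev_def char_ring_simps fun_eq_iff)

lemma char_ring_generators_closed:
  shows "ev 0 \<in> carrier (char_ring C4C2)"
    and "x \<in> carrier (char_ring C4C2) \<Longrightarrow> y \<in> carrier (char_ring C4C2) \<Longrightarrow>
      (\<lambda>g\<in>carrier C4C2. x g + y g) \<in> carrier (char_ring C4C2)"
    and "\<chi> \<in> irr_chars C4C2 \<Longrightarrow> \<chi> \<in> carrier (char_ring C4C2)"
    and "\<chi> \<in> irr_chars C4C2 \<Longrightarrow> (\<lambda>g\<in>carrier C4C2. - \<chi> g) \<in> carrier (char_ring C4C2)"
proof -
  let ?G = "add_monoid (fun_ring C4C2)"
  show "ev 0 \<in> carrier (char_ring C4C2)"
    using generate.one[of ?G "irr_chars C4C2"] by (simp add: ev_zero char_ring_simps fun_ring_simps)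
  show "(\<lambda>g\<in>carrier C4C2. x g + y g) \<in> carrier (char_ring C4C2)"
    if "x \<in> carrier (char_ring C4C2)" "y \<in> carrier (char_ring C4C2)"
    using generate.eng[of x ?G "irr_chars C4C2" y] that by (simp add: char_ring_simps fun_ring_simps)
  show "\<chi> \<in> carrier (char_ring C4C2)" if "\<chi> \<in> irr_chars C4C2"
    unfolding char_ring_simps by (rule generate.incl[OF that])
  show "(\<lambda>g\<in>carrier C4C2. - \<chi> g) \<in> carrier (char_ring C4C2)" if "\<chi> \<in> irr_chars C4C2"
    using generate.inv[OF that, of ?G] irr_chars_subset[of C4C2] that
    unfolding char_ring_simps by (subst fun_ring_a_inv[symmetric]) auto
qed

text \<open>The carrier is a generated subgroup, so its closure under products has to be proved.
  Multiplication by an irreducible character permutes such characters, hence preserves the subgroup;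
  subtracting the identity gives multiplication by X and Y.\<close>

lemma carrier_char_ring: "carrier (char_ring C4C2) = range ev"
proof
  show "carrier (char_ring C4C2) \<subseteq> range ev"
  proof
    fix x assume "x \<in> carrier (char_ring C4C2)"
    then show "x \<in> range ev"
    proof (induction x rule: char_ring_induct)
      case zero
      show ?case unfolding ev_zero[symmetric] by simp
    next
      case (irr \<chi>)
      then show ?case by (auto simp: irr_chars_C4C2)
    next
      case (uminus \<chi>)
      then obtain i j where "\<chi> = ev (chi_poly i j)" by (auto simp: irr_chars_C4C2)
      then have "(\<lambda>g\<in>carrier C4C2. - \<chi> g) = ev (- chi_poly i j)" by (simp only: ev_uminus)
      then show ?case by (simp only: rangeI)
    next
      case (add x y)
      then obtain p q where "x = ev p" "y = ev q" by blast
      then have "(\<lambda>g\<in>carrier C4C2. x g + y g) = ev (p + q)" by (simp only: ev_add char_ring_simps)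
      then show ?case by (simp only: rangeI)
    qed
  qed
  let ?R = "carrier (char_ring C4C2)"
  have add: "ev (p + q) \<in> ?R" if "ev p \<in> ?R" "ev q \<in> ?R" for p q
    unfolding ev_add char_ring_simps(3) using char_ring_generators_closed(2)[OF that] .
  have char: "ev (chi_poly k l * p) \<in> ?R" if "ev p \<in> ?R" for k l p
  proof -
    let ?c = "\<lambda>x. \<lambda>g\<in>carrier C4C2. ev (chi_poly k l) g * x g"
    have mult: "?c (ev p) = ev (chi_poly k l * p)" for p
      by (simp add: ev_mult char_ring_simps)
    have chi: "chi_poly k l * chi_poly i j = chi_poly (k + i) (l + j)" for i j
      by (simp add: chi_poly_def power_add ac_simps)
    have "?c x \<in> ?R" if "x \<in> ?R" for x
      using that
    proof (induction x rule: char_ring_induct)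
      case zero
      show ?case unfolding ev_zero[symmetric] mult by (simp add: char_ring_generators_closed)
    next
      case (irr \<chi>)
      then obtain i j where "\<chi> = ev (chi_poly i j)" by (auto simp: irr_chars_C4C2)
      then show ?case by (simp only: mult chi char_ring_generators_closed(3)[OF ev_chi_poly_irr])
    next
      case (uminus \<chi>)
      then obtain i j where "\<chi> = ev (chi_poly i j)" by (auto simp: irr_chars_C4C2)
      then have "?c (\<lambda>g\<in>carrier C4C2. - \<chi> g) = (\<lambda>g\<in>carrier C4C2. - ev (chi_poly (k + i) (l + j)) g)"
        by (auto simp: ev_uminus[symmetric] mult simp flip: chi)
      then show ?case by (simp only: char_ring_generators_closed(4)[OF ev_chi_poly_irr])
    next
      case (add x y)
      have "?c (\<lambda>g\<in>carrier C4C2. x g + y g) = (\<lambda>g\<in>carrier C4C2. ?c x g + ?c y g)"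
        by (auto simp: algebra_simps)
      then show ?case using char_ring_generators_closed(2)[OF add(3,4)] by (simp only:)
    qed
    from this[OF that] show ?thesis by (simp only: mult)
  qed
  have minus: "ev (- p) \<in> ?R" if "ev p \<in> ?R" for p
  proof -
    have "(\<lambda>g\<in>carrier C4C2. - x g) \<in> ?R" if "x \<in> ?R" for x
      using that
    proof (induction x rule: char_ring_induct)
      case zero
      show ?case unfolding ev_zero[symmetric] ev_uminus[symmetric] by (simp add: char_ring_generators_closed)
    next
      case (irr \<chi>)
      then show ?case by (rule char_ring_generators_closed)
    next
      case (uminus \<chi>)
      then have "(\<lambda>g\<in>carrier C4C2. - (\<lambda>g\<in>carrier C4C2. - \<chi> g) g) = \<chi>"
        using C.irr_char_linear(1)[OF uminus] by (auto simp: fun_eq_iff extensional_def)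
      then show ?case using char_ring_generators_closed(3)[OF uminus] by (simp only:)
    next
      case (add x y)
      have "(\<lambda>g\<in>carrier C4C2. - (\<lambda>g\<in>carrier C4C2. x g + y g) g) =
          (\<lambda>g\<in>carrier C4C2. (\<lambda>g\<in>carrier C4C2. - x g) g + (\<lambda>g\<in>carrier C4C2. - y g) g)" by auto
      then show ?case using char_ring_generators_closed(2)[OF add(3,4)] by (simp only:)
    qed
    from this[OF that] show ?thesis by (simp only: ev_uminus)
  qed
  have X: "ev (X_var * p) \<in> ?R" if "ev p \<in> ?R" for p
    using add[OF char[OF that, of 1 0] minus[OF that]] by (simp add: chi_poly_def algebra_simps)
  have Y: "ev (Y_var * p) \<in> ?R" if "ev p \<in> ?R" for p
    using add[OF char[OF that, of 0 1] minus[OF that]] by (simp add: chi_poly_def algebra_simps)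
  have one: "ev 1 \<in> ?R"
    using char_ring_generators_closed(3)[OF ev_chi_poly_irr[of 0 0]] by (simp add: chi_poly_def)
  have int: "ev (of_int c) \<in> ?R" for c
  proof (induction c rule: int_induct[of _ 0])
    case base
    show ?case using char_ring_generators_closed(1) by simp
  next
    case (step1 i)
    then show ?case using add[OF _ one, of "of_int i"] by simp
  next
    case (step2 i)
    then show ?case using add[OF _ minus[OF one], of "of_int i"] by simp
  qed
  have "ev p \<in> ?R" for p
  proof (induction p rule: bipoly_induct)
    case (monom c i j)
    have "ev (X_var ^ i * of_int c) \<in> ?R"
      by (induction i) (simp_all add: int X mult.assoc)
    then have "ev (Y_var ^ j * (X_var ^ i * of_int c)) \<in> ?R"
      by (induction j) (simp_all add: Y mult.assoc)
    then show ?case by (simp only: ac_simps)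
  qed (rule add)
  then show "range ev \<subseteq> ?R" by blast
qed

text \<open>All axioms are inherited from Z[x, y] along the surjection \<open>ev\<close>.\<close>

lemma ring_char_ring: "ring (char_ring C4C2)"
proof (rule ringI)
  let ?R = "char_ring C4C2"
  have zero: "\<zero>\<^bsub>?R\<^esub> = ev 0" by (simp add: ev_zero char_ring_simps)
  show "abelian_group ?R"
  proof (rule abelian_groupI)
    fix x assume "x \<in> carrier ?R"
    then obtain p where p: "x = ev p" by (auto simp: carrier_char_ring)
    have "ev (- p) \<oplus>\<^bsub>?R\<^esub> x = \<zero>\<^bsub>?R\<^esub>" by (simp add: p zero ev_add[symmetric])
    then show "\<exists>y\<in>carrier ?R. y \<oplus>\<^bsub>?R\<^esub> x = \<zero>\<^bsub>?R\<^esub>" by (auto simp: carrier_char_ring)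
  qed (auto simp: carrier_char_ring zero ev_add[symmetric] algebra_simps)
  show "monoid ?R"
    by (rule monoidI) (auto simp: carrier_char_ring ev_mult[symmetric] ev_one[symmetric] algebra_simps)
qed (auto simp: carrier_char_ring ev_mult[symmetric] ev_add[symmetric] algebra_simps)

interpretation CR: ring "char_ring C4C2"
  by (rule ring_char_ring)

section \<open>Orthogonality and integral multiplicities\<close>

lemma sum_powers_cnj:
  assumes "k \<in> {0, 1, 2, 3 :: int}" "k' \<in> {0, 1, 2, 3}"
  shows "(\<Sum>i<4. (cnj (\<i> ^ nat k) * \<i> ^ nat k') ^ i) = (if k = k' then 4 else 0 :: complex)"
  using assms by (auto simp: eval_nat_numeral)

text \<open>Column orthogonality: the double sum factors into geometric sums of a fourth root of
  unity and of a sign. It recovers a function on the group from its inner products with the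
  characters.\<close>

lemma character_orthogonality:
  assumes "g \<in> carrier C4C2" "h \<in> carrier C4C2"
  shows "(\<Sum>i<4. \<Sum>j<2. cnj (ev (chi_poly i j) h) * ev (chi_poly i j) g) = (if g = h then 8 else 0)"
proof -
  have "(\<Sum>i<4. \<Sum>j<2. cnj (ev (chi_poly i j) h) * ev (chi_poly i j) g) =
    (\<Sum>i<4. (cnj (gen_a h) * gen_a g) ^ i) * (\<Sum>j<2. (cnj (gen_b h) * gen_b g) ^ j)"
    unfolding sum_product using assms
    by (intro sum.cong refl) (simp add: ev_apply poly2_chi_poly power_mult_distrib ac_simps)
  moreover have "(\<Sum>j<2. (cnj (gen_b h) * gen_b g) ^ j) = (if snd h = snd g then 2 else 0)"
    using assms by (auto simp: carrier_C4C2 gen_b_def eval_nat_numeral)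
  moreover have "(\<Sum>i<4. (cnj (gen_a h) * gen_a g) ^ i) = (if fst h = fst g then 4 else 0)"
    unfolding gen_a_def using assms by (intro sum_powers_cnj) (auto simp: carrier_C4C2)
  ultimately show ?thesis by (auto simp: prod_eq_iff)
qed

text \<open>The integers \<open>m i j\<close> are the multiplicities of the irreducible characters,
  known to be integers from the traces of idempotents. Column orthogonality reassembles the
  character from them, without decomposing the representation.\<close>

lemma rep_char_closed:
  assumes \<rho>: "is_rep C4C2 d \<rho>"
  shows "rep_char C4C2 \<rho> \<in> carrier (char_ring C4C2)"
proof -
  have fin: "finite (carrier C4C2)" and card: "card (carrier C4C2) = 8"
    by (simp_all add: carrier_C4C2 card_cartesian_product)
  have "\<exists>m. (\<Sum>h\<in>carrier C4C2. cnj (ev (chi_poly i j) h) * rep_char C4C2 \<rho> h) = of_int m * 8" for i j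
  proof -
    have "cnj (ev (chi_poly i j) (g \<otimes>\<^bsub>C4C2\<^esub> h)) = cnj (ev (chi_poly i j) g) * cnj (ev (chi_poly i j) h)"
      if "g \<in> carrier C4C2" "h \<in> carrier C4C2" for g h
      using C.irr_char_linear(3)[OF ev_chi_poly_irr that] by simp
    from C.multiplicity_integer[OF fin \<rho> this]
    obtain m where "(\<Sum>h\<in>carrier C4C2. cnj (ev (chi_poly i j) h) * rep_char C4C2 \<rho> h) =
      of_nat m * of_nat (card (carrier C4C2))" .
    then show ?thesis unfolding card by (intro exI[of _ "int m"]) simp
  qed
  then obtain m where m: "\<And>i j. (\<Sum>h\<in>carrier C4C2. cnj (ev (chi_poly i j) h) * rep_char C4C2 \<rho> h) = of_int (m i j) * 8"
    by metis
  have "rep_char C4C2 \<rho> = ev (\<Sum>i<4. \<Sum>j<2. of_int (m i j) * chi_poly i j)"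
  proof (rule ev_eqI)
    show "rep_char C4C2 \<rho> \<in> extensional (carrier C4C2)" by (simp add: rep_char_def)
    fix g assume g: "g \<in> carrier C4C2"
    have "8 * poly2 (\<Sum>i<4. \<Sum>j<2. of_int (m i j) * chi_poly i j) (gen_a g - 1) (gen_b g - 1) =
      (\<Sum>i<4. \<Sum>j<2. (of_int (m i j) * 8) * ev (chi_poly i j) g)"
      by (simp add: ev_apply[OF g] sum_distrib_left ac_simps)
    also have "\<dots> = (\<Sum>i<4. \<Sum>j<2. \<Sum>h\<in>carrier C4C2. rep_char C4C2 \<rho> h * (cnj (ev (chi_poly i j) h) * ev (chi_poly i j) g))"
      unfolding m[symmetric] by (intro sum.cong refl) (simp add: sum_distrib_left ac_simps)
    also have "\<dots> = (\<Sum>i<4. \<Sum>h\<in>carrier C4C2. \<Sum>j<2. rep_char C4C2 \<rho> h * (cnj (ev (chi_poly i j) h) * ev (chi_poly i j) g))"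
      by (intro sum.cong refl sum.swap)
    also have "\<dots> = (\<Sum>h\<in>carrier C4C2. \<Sum>i<4. \<Sum>j<2. rep_char C4C2 \<rho> h * (cnj (ev (chi_poly i j) h) * ev (chi_poly i j) g))"
      by (rule sum.swap)
    also have "\<dots> = (\<Sum>h\<in>carrier C4C2. rep_char C4C2 \<rho> h * (if g = h then 8 else 0))"
      using g by (intro sum.cong refl) (simp only: sum_distrib_left[symmetric] character_orthogonality)
    also have "\<dots> = rep_char C4C2 \<rho> g * 8"
      using fin g by (simp add: if_distrib cong: if_cong)
    finally show "rep_char C4C2 \<rho> g = poly2 (\<Sum>i<4. \<Sum>j<2. of_int (m i j) * chi_poly i j) (gen_a g - 1) (gen_b g - 1)"
      by simp
  qed
  then show ?thesis by (simp add: carrier_char_ring)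
qed

lemma irr_char_pow:
  assumes "\<chi> \<in> irr_chars C4C2" "g \<in> carrier C4C2"
  shows "\<chi> (g [^]\<^bsub>C4C2\<^esub> (k :: nat)) = \<chi> g ^ k"
  using C.irr_char_linear(2,3)[OF assms(1)] assms(2) by (rule linear_char_pow)

text \<open>The polynomial \<open>P n\<close> is chosen before \<open>g\<close>; this uniformity
  makes the coefficient a virtual character. Characters give 1 + \<chi> t, their negatives the
  powers of -\<chi>, and sums give Cauchy products.\<close>

lemma lambda_series_closed:
  assumes "x \<in> carrier (char_ring C4C2)"
  shows "(\<lambda>g\<in>carrier C4C2. fps_nth (C.lambda_series x g) n) \<in> carrier (char_ring C4C2)"
proof -
  have "\<exists>P. \<forall>g\<in>carrier C4C2. \<forall>n. fps_nth (C.lambda_series x g) n = poly2 (P n) (gen_a g - 1) (gen_b g - 1)"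
    using assms
  proof (induction x rule: char_ring_induct)
    case zero
    show ?case
      by (intro exI[of _ "\<lambda>n. if n = 0 then 1 else 0"] ballI allI) (simp only: C.lambda_series_zero, simp)
  next
    case (irr \<chi>)
    then obtain i j where \<chi>: "\<chi> = ev (chi_poly i j)" by (auto simp: irr_chars_C4C2)
    have "C.lambda_series \<chi> g = 1 + fps_const (\<chi> g) * fps_X" if "g \<in> carrier C4C2" for g
      unfolding C.lambda_series_def irr_char_pow[OF irr that] by (rule newton_series_power)
    then show ?case
      by (intro exI[of _ "\<lambda>n. if n = 0 then 1 else if n = 1 then chi_poly i j else 0"])
        (auto simp: \<chi> ev_apply)
  next
    case (uminus \<chi>)
    then obtain i j where \<chi>: "\<chi> = ev (chi_poly i j)" by (auto simp: irr_chars_C4C2)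
    have eq: "C.lambda_series (\<lambda>g\<in>carrier C4C2. - \<chi> g) g = Abs_fps (\<lambda>n. (- \<chi> g) ^ n)" if "g \<in> carrier C4C2" for g
      using that unfolding C.lambda_series_def
      by (simp add: irr_char_pow[OF uminus] newton_series_uminus_power)
    show ?case
      by (intro exI[of _ "\<lambda>n. (- chi_poly i j) ^ n"] ballI allI) (simp only: eq, simp add: \<chi> ev_apply)
  next
    case (add x y)
    then obtain P Q where
      "\<forall>g\<in>carrier C4C2. \<forall>n. fps_nth (C.lambda_series x g) n = poly2 (P n) (gen_a g - 1) (gen_b g - 1)"
      "\<forall>g\<in>carrier C4C2. \<forall>n. fps_nth (C.lambda_series y g) n = poly2 (Q n) (gen_a g - 1) (gen_b g - 1)"
      by blast
    then show ?case
      by (intro exI[of _ "\<lambda>n. \<Sum>i=0..n. P i * Q (n - i)"] ballI allI)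
        (simp only: C.lambda_series_add, simp add: fps_mult_nth)
  qed
  then obtain P where "\<forall>g\<in>carrier C4C2. \<forall>n. fps_nth (C.lambda_series x g) n = poly2 (P n) (gen_a g - 1) (gen_b g - 1)" ..
  then have "(\<lambda>g\<in>carrier C4C2. fps_nth (C.lambda_series x g) n) = ev (P n)"
    by (intro ev_eqI) auto
  then show ?thesis by (simp add: carrier_char_ring)
qed

lemma lambda_op_C4C2:
  "x \<in> carrier (char_ring C4C2) \<Longrightarrow>
    lambda_op C4C2 n x = (\<lambda>g\<in>carrier C4C2. fps_nth (C.lambda_series x g) n)"
  by (rule C.lambda_op_eq[OF ring_char_ring rep_char_closed lambda_series_closed])

section \<open>Identification of the \<gamma>-filtration\<close>

lemma chi_poly_order_ge: "chi_poly i j - 1 \<in> order_ge 1"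
proof -
  have mult: "p * q - 1 \<in> order_ge 1" if "p - 1 \<in> order_ge 1" "q - 1 \<in> order_ge 1" for p q
  proof -
    have eq: "p * q - 1 = (p - 1) * q + (q - 1)" by (simp add: algebra_simps)
    have "(p - 1) * q \<in> order_ge 1"
      using order_ge_mult[OF that(1) order_ge_0[of q]] by simp
    then show ?thesis unfolding eq using that(2) by (rule order_ge_add)
  qed
  have X: "(1 + X_var) ^ i - 1 \<in> order_ge 1" for i
  proof (induction i)
    case (Suc i)
    have "(1 + X_var) - 1 \<in> order_ge 1" using monom_order_ge[of 1 0] by simp
    from mult[OF this Suc] show ?case by simp
  qed (simp add: order_ge_zero)
  have Y: "(1 + Y_var) ^ j - 1 \<in> order_ge 1" for j
  proof (induction j)
    case (Suc j)
    have "(1 + Y_var) - 1 \<in> order_ge 1" using monom_order_ge[of 0 1] by simp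
    from mult[OF this Suc] show ?case by simp
  qed (simp add: order_ge_zero)
  show ?thesis unfolding chi_poly_def by (rule mult[OF X Y])
qed

lemma order_ge_power: "p \<in> order_ge 1 \<Longrightarrow> p ^ n \<in> order_ge n"
proof (induction n)
  case (Suc n)
  then show ?case using order_ge_mult[of p 1 "p ^ n" n] by simp
qed (rule order_ge_0)

text \<open>Characters are not in the augmentation ideal, so the induction runs over the whole ring
  with x - x(1) in place of x. Each irreducible character then contributes a line element \<chi> - 1
  or its negative, whose n-th coefficient has order at least n, and Cauchy products preserve
  this.\<close>

lemma gamma_series_order:
  assumes "x \<in> carrier (char_ring C4C2)"
  shows "\<exists>P. (\<forall>n. P n \<in> order_ge n) \<and> (\<forall>g\<in>carrier C4C2. \<forall>n.
    fps_nth (newton_series (\<lambda>k. x (g [^]\<^bsub>C4C2\<^esub> k) - x \<one>\<^bsub>C4C2\<^esub>) oo gamma_subst) n =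
      poly2 (P n) (gen_a g - 1) (gen_b g - 1))"
  using assms
proof (induction x rule: char_ring_induct)
  case zero
  have "newton_series (\<lambda>k. (\<lambda>g\<in>carrier C4C2. 0) (g [^]\<^bsub>C4C2\<^esub> k) - (\<lambda>g\<in>carrier C4C2. 0) \<one>\<^bsub>C4C2\<^esub>) = 1"
    if "g \<in> carrier C4C2" for g
    using that by (simp add: newton_series_zero)
  then show ?case
    by (intro exI[of _ "\<lambda>n. if n = 0 then 1 else 0"] conjI ballI allI)
      (simp add: order_ge_0 order_ge_zero, simp only: fps_compose_1, simp)
next
  case (irr \<chi>)
  then obtain i j where \<chi>: "\<chi> = ev (chi_poly i j)" by (auto simp: irr_chars_C4C2)
  have "newton_series (\<lambda>k. \<chi> (g [^]\<^bsub>C4C2\<^esub> k) - \<chi> \<one>\<^bsub>C4C2\<^esub>) oo gamma_subst = 1 + fps_const (\<chi> g - 1) * fps_X"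
    if "g \<in> carrier C4C2" for g
    unfolding irr_char_pow[OF irr that] C.irr_char_linear(2)[OF irr] by (rule gamma_series_line_element)
  then show ?case
    by (intro exI[of _ "\<lambda>n. if n = 0 then 1 else if n = 1 then chi_poly i j - 1 else 0"] conjI ballI allI)
      (use chi_poly_order_ge in \<open>auto simp: \<chi> ev_apply order_ge_0 order_ge_zero\<close>)
next
  case (uminus \<chi>)
  then obtain i j where \<chi>: "\<chi> = ev (chi_poly i j)" by (auto simp: irr_chars_C4C2)
  have "newton_series (\<lambda>k. (\<lambda>g\<in>carrier C4C2. - \<chi> g) (g [^]\<^bsub>C4C2\<^esub> k) - (\<lambda>g\<in>carrier C4C2. - \<chi> g) \<one>\<^bsub>C4C2\<^esub>) oo gamma_subst
      = Abs_fps (\<lambda>n. (1 - \<chi> g) ^ n)"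
    if "g \<in> carrier C4C2" for g
  proof -
    have "newton_series (\<lambda>k. (\<lambda>g\<in>carrier C4C2. - \<chi> g) (g [^]\<^bsub>C4C2\<^esub> k) - (\<lambda>g\<in>carrier C4C2. - \<chi> g) \<one>\<^bsub>C4C2\<^esub>) =
      newton_series (\<lambda>k. - (\<chi> g ^ k - 1))"
      using that by (simp add: irr_char_pow[OF uminus that] C.irr_char_linear(2)[OF uminus])
    then show ?thesis by (simp only: gamma_series_uminus_line_element)
  qed
  moreover have "(1 - chi_poly i j) ^ n \<in> order_ge n" for n
    using order_ge_power[OF order_ge_uminus[OF chi_poly_order_ge[of i j]]] by simp
  ultimately show ?case
    by (intro exI[of _ "\<lambda>n. (1 - chi_poly i j) ^ n"] conjI ballI allI) (simp only:, simp add: \<chi> ev_apply)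
next
  case (add x y)
  then obtain P Q where PQ: "\<And>n. P n \<in> order_ge n" "\<And>n. Q n \<in> order_ge n"
    and P: "\<And>g n. g \<in> carrier C4C2 \<Longrightarrow> fps_nth (newton_series (\<lambda>k. x (g [^]\<^bsub>C4C2\<^esub> k) - x \<one>\<^bsub>C4C2\<^esub>) oo gamma_subst) n =
      poly2 (P n) (gen_a g - 1) (gen_b g - 1)"
    and Q: "\<And>g n. g \<in> carrier C4C2 \<Longrightarrow> fps_nth (newton_series (\<lambda>k. y (g [^]\<^bsub>C4C2\<^esub> k) - y \<one>\<^bsub>C4C2\<^esub>) oo gamma_subst) n =
      poly2 (Q n) (gen_a g - 1) (gen_b g - 1)"
    by blast
  have g0: "fps_nth gamma_subst 0 = 0" by simp
  have eq: "newton_series (\<lambda>k. (\<lambda>g\<in>carrier C4C2. x g + y g) (g [^]\<^bsub>C4C2\<^esub> k) - (\<lambda>g\<in>carrier C4C2. x g + y g) \<one>\<^bsub>C4C2\<^esub>) oo gamma_subst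
    = (newton_series (\<lambda>k. x (g [^]\<^bsub>C4C2\<^esub> k) - x \<one>\<^bsub>C4C2\<^esub>) oo gamma_subst) *
      (newton_series (\<lambda>k. y (g [^]\<^bsub>C4C2\<^esub> k) - y \<one>\<^bsub>C4C2\<^esub>) oo gamma_subst)"
    if "g \<in> carrier C4C2" for g
  proof -
    have "newton_series (\<lambda>k. (\<lambda>g\<in>carrier C4C2. x g + y g) (g [^]\<^bsub>C4C2\<^esub> k) - (\<lambda>g\<in>carrier C4C2. x g + y g) \<one>\<^bsub>C4C2\<^esub>) =
      newton_series (\<lambda>k. (x (g [^]\<^bsub>C4C2\<^esub> k) - x \<one>\<^bsub>C4C2\<^esub>) + (y (g [^]\<^bsub>C4C2\<^esub> k) - y \<one>\<^bsub>C4C2\<^esub>))"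
      using that by (simp add: algebra_simps)
    then show ?thesis by (simp only: newton_series_add fps_compose_mult_distrib[OF g0])
  qed
  have "(\<Sum>i=0..n. P i * Q (n - i)) \<in> order_ge n" for n
  proof (rule order_ge_sum)
    fix i assume "i \<in> {0..n}"
    then show "P i * Q (n - i) \<in> order_ge n" using order_ge_mult[OF PQ(1)[of i] PQ(2)[of "n - i"]] by simp
  qed
  then show ?case
    by (intro exI[of _ "\<lambda>n. \<Sum>i=0..n. P i * Q (n - i)"] conjI ballI allI)
      (simp, simp only: eq, simp add: fps_mult_nth P Q)
qed

lemma add_pow_one:
  "add_pow (char_ring C4C2) (int n) \<one>\<^bsub>char_ring C4C2\<^esub> = (\<lambda>g\<in>carrier C4C2. of_nat n)"
proof -
  have "add_pow (char_ring C4C2) (n::nat) \<one>\<^bsub>char_ring C4C2\<^esub> = (\<lambda>g\<in>carrier C4C2. of_nat n)"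
  proof (induction n)
    case (Suc n)
    then show ?case by (simp add: CR.add.nat_pow_Suc char_ring_simps) (auto simp: fun_eq_iff)
  qed (simp add: char_ring_simps)
  then show ?thesis by (simp add: add_pow_int_ge)
qed

lemma augmentation_ideal_subset: "x \<in> augmentation_ideal C4C2 \<Longrightarrow> x \<in> carrier (char_ring C4C2)"
  by (simp add: augmentation_ideal_def)

text \<open>For n > 0 the shift n - 1 is a natural number, and adding that many trivial characters
  multiplies the \<lambda>-series by (1 + t)^(n-1).\<close>

lemma gamma_op_pos:
  assumes x: "x \<in> carrier (char_ring C4C2)" and n: "n > 0"
  shows "gamma_op C4C2 n x = (\<lambda>g\<in>carrier C4C2. fps_nth (C.lambda_series x g * (1 + fps_X) ^ (n - 1)) n)"
proof -
  have n': "int n - 1 = int (n - 1)" using n by simp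
  have "(\<lambda>g\<in>carrier C4C2. of_nat (n - 1)) = ev (of_nat (n - 1))"
    by (rule ev_eqI) (simp_all add: poly2_of_int[of "int (n - 1)", simplified])
  then have const: "(\<lambda>g\<in>carrier C4C2. of_nat (n - 1)) \<in> carrier (char_ring C4C2)"
    by (simp only: carrier_char_ring rangeI)
  have "gamma_op C4C2 n x = lambda_op C4C2 n (\<lambda>g\<in>carrier C4C2. x g + (\<lambda>g\<in>carrier C4C2. of_nat (n - 1)) g)"
    unfolding gamma_op_def n' add_pow_one char_ring_simps(3) ..
  also have "\<dots> = (\<lambda>g\<in>carrier C4C2. fps_nth (C.lambda_series
       (\<lambda>g\<in>carrier C4C2. x g + (\<lambda>g\<in>carrier C4C2. of_nat (n - 1)) g) g) n)"
    by (rule lambda_op_C4C2[OF char_ring_generators_closed(2)[OF x const]])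
  also have "\<dots> = (\<lambda>g\<in>carrier C4C2. fps_nth (C.lambda_series x g * (1 + fps_X) ^ (n - 1)) n)"
  proof (rule restrict_ext)
    fix g assume g: "g \<in> carrier C4C2"
    have "C.lambda_series (\<lambda>g\<in>carrier C4C2. of_nat (n - 1)) g = newton_series (\<lambda>k. of_nat (n - 1))"
      using g by (simp add: C.lambda_series_def)
    then show "fps_nth (C.lambda_series (\<lambda>g\<in>carrier C4C2. x g + (\<lambda>g\<in>carrier C4C2. of_nat (n - 1)) g) g) n =
      fps_nth (C.lambda_series x g * (1 + fps_X) ^ (n - 1)) n"
      by (simp only: C.lambda_series_add[OF g] newton_series_of_nat)
  qed
  finally show ?thesis .
qed

text \<open>Here the shift is -1, which is harmless because \<lambda>^0 is constantly 1.\<close>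

lemma gamma_op_0: "x \<in> carrier (char_ring C4C2) \<Longrightarrow> gamma_op C4C2 0 x = ev 1"
  unfolding gamma_op_def
  by (subst lambda_op_C4C2) (auto simp: C.lambda_series_def ev_def intro: CR.a_closed CR.add.int_pow_closed)

lemma gamma_op_1:
  assumes "x \<in> carrier (char_ring C4C2)"
  shows "gamma_op C4C2 1 x = x"
proof -
  have "x \<in> extensional (carrier C4C2)" using assms carrier_char_ring_subset by (auto simp: PiE_def)
  then show ?thesis
    using gamma_op_pos[OF assms, of 1] newton_series_nth_1
    by (auto simp: C.lambda_series_def fun_eq_iff extensional_def)
qed

lemma gamma_op_order:
  assumes x: "x \<in> augmentation_ideal C4C2"
  shows "gamma_op C4C2 n x \<in> ev ` order_ge n"
proof (cases "n = 0")
  case True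
  then show ?thesis using gamma_op_0[OF augmentation_ideal_subset[OF x]] by (auto simp: order_ge_0)
next
  case False
  obtain P where P: "\<And>n. P n \<in> order_ge n"
    "\<And>g n. g \<in> carrier C4C2 \<Longrightarrow> fps_nth (newton_series (\<lambda>k. x (g [^]\<^bsub>C4C2\<^esub> k) - x \<one>\<^bsub>C4C2\<^esub>) oo gamma_subst) n =
      poly2 (P n) (gen_a g - 1) (gen_b g - 1)"
    using gamma_series_order[OF augmentation_ideal_subset[OF x]] by blast
  have "gamma_op C4C2 n x = ev (P n)"
    unfolding gamma_op_pos[OF augmentation_ideal_subset[OF x] False[unfolded neq0_conv]]
  proof (rule ev_eqI)
    fix g assume g: "g \<in> carrier C4C2"
    have "x \<one>\<^bsub>C4C2\<^esub> = 0" using x by (simp add: augmentation_ideal_def)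
    then show "(\<lambda>g\<in>carrier C4C2. fps_nth (C.lambda_series x g * (1 + fps_X) ^ (n - 1)) n) g =
        poly2 (P n) (gen_a g - 1) (gen_b g - 1)"
      using P(2)[OF g, of n] False g by (simp add: fps_nth_compose_gamma_subst C.lambda_series_def)
  qed simp
  then show ?thesis using P(1) by blast
qed

lemma gamma_prod_order:
  "snd ` set ps \<subseteq> augmentation_ideal C4C2 \<Longrightarrow> gamma_prod C4C2 ps \<in> ev ` order_ge (sum_list (map fst ps))"
proof (induction ps)
  case Nil
  show ?case by (simp add: gamma_prod_def ev_one[symmetric] order_ge_0)
next
  case (Cons a ps)
  obtain i x where a: "a = (i, x)" by (cases a)
  obtain p where p: "gamma_op C4C2 i x = ev p" "p \<in> order_ge i"
    using gamma_op_order[of x i] Cons.prems a by auto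
  obtain q where q: "gamma_prod C4C2 ps = ev q" "q \<in> order_ge (sum_list (map fst ps))"
    using Cons by auto
  have "gamma_prod C4C2 (a # ps) = ev (p * q)"
    using p(1) q(1) by (simp add: gamma_prod_def a ev_mult)
  then show ?case using order_ge_mult[OF p(2) q(2)] by (simp add: a)
qed

lemma ev_var_augmentation: "ev X_var \<in> augmentation_ideal C4C2" "ev Y_var \<in> augmentation_ideal C4C2"
  by (simp_all add: augmentation_ideal_def carrier_char_ring ev_apply carrier_C4C2 one_C4C2)

text \<open>Since \<gamma>^1 is the identity, a monomial in X and Y is itself a product of
  \<gamma>-operations of its own total degree. This bounds the filtration from below.\<close>

lemma gamma_prod_monom:
  "gamma_prod C4C2 (replicate i (1, ev X_var) @ replicate j (1, ev Y_var)) = ev (X_var ^ i * Y_var ^ j)"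
proof -
  have Y: "gamma_prod C4C2 (replicate j (1, ev Y_var)) = ev (Y_var ^ j)"
    using gamma_op_1[of "ev Y_var"]
    by (induction j) (simp_all add: gamma_prod_def ev_one ev_mult carrier_char_ring)
  show ?thesis
    using gamma_op_1[of "ev X_var"] Y
    by (induction i) (simp_all add: gamma_prod_def ev_mult carrier_char_ring CR.m_assoc mult.assoc)
qed

lemma gamma_filtration_C4C2: "gamma_filtration C4C2 n = ev ` order_ge n"
proof
  let ?S = "{gamma_prod C4C2 ps | ps. snd ` set ps \<subseteq> augmentation_ideal C4C2 \<and> n \<le> sum_list (map fst ps)}"
  have S: "?S \<subseteq> ev ` order_ge n"
  proof
    fix x assume "x \<in> ?S"
    then obtain ps where ps: "x = gamma_prod C4C2 ps" "snd ` set ps \<subseteq> augmentation_ideal C4C2"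
      "n \<le> sum_list (map fst ps)" by (elim CollectE exE conjE)
    obtain p where "x = ev p" "p \<in> order_ge (sum_list (map fst ps))"
      using gamma_prod_order[OF ps(2)] ps(1) by (elim imageE) simp
    then show "x \<in> ev ` order_ge n" using order_ge_antimono[OF _ ps(3)] by blast
  qed
  have zero: "\<zero>\<^bsub>char_ring C4C2\<^esub> = ev 0" by (simp add: ev_zero char_ring_simps)
  have ev_inv: "inv\<^bsub>add_monoid (char_ring C4C2)\<^esub> ev p = ev (- p)" for p
  proof -
    have "\<ominus>\<^bsub>char_ring C4C2\<^esub> ev p = ev (- p)"
      by (rule CR.minus_equality) (simp_all add: zero carrier_char_ring ev_add[symmetric])
    then show ?thesis by (simp add: a_inv_def)
  qed
  show "gamma_filtration C4C2 n \<subseteq> ev ` order_ge n"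
  proof
    fix x assume "x \<in> gamma_filtration C4C2 n"
    then show "x \<in> ev ` order_ge n"
      unfolding gamma_filtration_def
    proof (induction rule: generate.induct)
      case one
      show ?case by (simp add: zero order_ge_zero)
    next
      case (incl h)
      then show ?case using S by blast
    next
      case (inv h)
      then obtain p where "h = ev p" "p \<in> order_ge n" using S by blast
      then show ?case using ev_inv order_ge_uminus by simp
    next
      case (eng h1 h2)
      then obtain p q where "h1 = ev p" "p \<in> order_ge n" "h2 = ev q" "q \<in> order_ge n" by blast
      then show ?case using order_ge_add by (auto simp: ev_add[symmetric])
    qed
  qed
  have add: "ev (p + q) \<in> gamma_filtration C4C2 n"
    if "ev p \<in> gamma_filtration C4C2 n" "ev q \<in> gamma_filtration C4C2 n" for p q
    using generate.eng[OF that[unfolded gamma_filtration_def]] by (simp add: ev_add gamma_filtration_def)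
  have zero': "ev 0 \<in> gamma_filtration C4C2 n"
    using generate.one[of "add_monoid (char_ring C4C2)" ?S] by (simp add: zero gamma_filtration_def)
  have monom: "ev (of_int c * (X_var ^ i * Y_var ^ j)) \<in> gamma_filtration C4C2 n" if "n \<le> i + j" for c i j
  proof -
    let ?m = "X_var ^ i * Y_var ^ j"
    have "ev ?m \<in> ?S"
      using ev_var_augmentation that
      by (intro CollectI exI[of _ "replicate i (1, ev X_var) @ replicate j (1, ev Y_var)"])
        (auto simp: gamma_prod_monom[symmetric] map_replicate_const sum_list_replicate)
    then have m: "ev ?m \<in> gamma_filtration C4C2 n" and m': "ev (- ?m) \<in> gamma_filtration C4C2 n"
      unfolding gamma_filtration_def ev_inv[symmetric] by (rule generate.incl, rule generate.inv)
    show ?thesis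
    proof (induction c rule: int_induct[of _ 0])
      case base
      show ?case using zero' by simp
    next
      case (step1 c)
      then show ?case using add[OF _ m, of "of_int c * ?m"] by (simp add: algebra_simps)
    next
      case (step2 c)
      then show ?case using add[OF _ m', of "of_int c * ?m"] by (simp add: algebra_simps)
    qed
  qed
  have sum: "ev (\<Sum>i\<in>A. f i) \<in> gamma_filtration C4C2 n" if "\<And>i. i \<in> A \<Longrightarrow> ev (f i) \<in> gamma_filtration C4C2 n" for f and A :: "nat set"
    using that by (induction A rule: infinite_finite_induct) (auto simp: zero' add)
  show "ev ` order_ge n \<subseteq> gamma_filtration C4C2 n"
  proof
    fix x assume "x \<in> ev ` order_ge n"
    then obtain p where p: "x = ev p" "p \<in> order_ge n" by blast
    have "ev (hpart k p) \<in> gamma_filtration C4C2 n" for k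
    proof (cases "k < n")
      case True
      then show ?thesis using p(2) zero' by (simp add: order_ge_def)
    next
      case False
      then show ?thesis unfolding hpart_expand mult.assoc by (intro sum monom) auto
    qed
    then have "ev (\<Sum>k\<le>degree (graded_poly p). hpart k p) \<in> gamma_filtration C4C2 n" by (intro sum)
    then show "x \<in> gamma_filtration C4C2 n" by (simp add: sum_hpart p)
  qed
qed

interpretation E: filtered_evaluation "char_ring C4C2" "gamma_filtration C4C2" ev
  by unfold_locales (auto simp: carrier_char_ring ev_add ev_mult ev_one gamma_filtration_C4C2)

section \<open>The ideal of relations\<close>

lemma ev_eq_iff: "ev p = ev q \<longleftrightarrow>
    (\<forall>a\<in>{1, \<i>, - 1, - \<i>}. \<forall>b\<in>{1, - 1}. poly2 (p - q) (a - 1) (b - 1) = 0)"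
proof -
  have "ev p = ev q \<longleftrightarrow> (\<forall>g\<in>carrier C4C2. poly2 (p - q) (gen_a g - 1) (gen_b g - 1) = 0)"
    unfolding ev_def by (auto simp: fun_eq_iff restrict_def)
  also have "\<dots> \<longleftrightarrow> (\<forall>a\<in>{1, \<i>, - 1, - \<i>}. \<forall>b\<in>{1, - 1}. poly2 (p - q) (a - 1) (b - 1) = 0)"
    by (simp add: carrier_C4C2 gen_a_def gen_b_def power2_eq_square power3_eq_cube) 
  finally show ?thesis .
qed

definition relation_ideal :: "int poly poly set" where
  "relation_ideal = Idl\<^bsub>ZXY\<^esub> relators"

lemma ideal_relation_ideal: "ideal relation_ideal ZXY"
  unfolding relation_ideal_def by (rule ring.genideal_ideal[OF class_ring.ring_axioms]) simp

lemma relators_subset: "relators \<subseteq> relation_ideal"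
  unfolding relation_ideal_def by (rule ring.genideal_self[OF class_ring.ring_axioms]) simp

text \<open>Each relator is a form of some degree m and has the same values on the group as a
  polynomial \<open>?s\<close> of order above m; its other homogeneous parts are 0.\<close>

lemma relators_symbol:
  assumes "r \<in> relators"
  shows "ev (hpart n r) \<in> gamma_filtration C4C2 (Suc n)"
proof -
  have hom: "ev (hpart n r) \<in> gamma_filtration C4C2 (Suc n)"
    if r: "hpart m r = r" and ev: "ev r = ev s" and s: "s \<in> order_ge (Suc m)" for m r s
  proof (cases "n = m")
    case True
    then show ?thesis using r ev s by (simp add: gamma_filtration_C4C2)
  next
    case False
    then have "hpart n r = 0" using hpart_hpart[of n m r] r by simp
    then show ?thesis using order_ge_zero[of "Suc n"] by (auto simp: gamma_filtration_C4C2)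
  qed
  have order: "of_int c * (X_var ^ i * Y_var ^ j) \<in> order_ge k" if "k \<le> i + j" for c i j k
    using order_ge_mult[OF order_ge_0 order_ge_antimono[OF monom_order_ge that], of "of_int c"] by simp
  consider "r = 4 * X_var" | "r = 2 * Y_var" | "r = X_var * Y_var ^ 3 + X_var ^ 2 * Y_var ^ 2"
    using assms by blast
  then show ?thesis
  proof cases
    case 1
    show ?thesis
    proof (rule hom)
      show "hpart 1 r = r" using hpart_monom[of 1 4 1 0] by (simp add: 1)
      \<comment> \<open>(1 + X)^4 = 1 solved for 4 X.\<close>
      let ?s = "of_int (- 6) * (X_var ^ 2 * Y_var ^ 0) + of_int (- 4) * (X_var ^ 3 * Y_var ^ 0) + of_int (- 1) * (X_var ^ 4 * Y_var ^ 0)"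
      show "ev r = ev ?s"
        unfolding ev_eq_iff 1 by (simp add: eval_nat_numeral algebra_simps)
      show "?s \<in> order_ge (Suc 1)" by (intro order_ge_add order) auto
    qed
  next
    case 2
    show ?thesis
    proof (rule hom)
      show "hpart 1 r = r" using hpart_monom[of 1 2 0 1] by (simp add: 2)
      let ?s = "of_int (- 1) * (X_var ^ 0 * Y_var ^ 2)"
      show "ev r = ev ?s"
        unfolding ev_eq_iff 2 by (simp add: eval_nat_numeral algebra_simps)
      show "?s \<in> order_ge (Suc 1)" by (intro order) auto
    qed
  next
    case 3
    show ?thesis
    proof (rule hom)
      show "hpart 4 r = r" using hpart_monom[of 4 1 1 3] hpart_monom[of 4 1 2 2] by (simp add: 3)
      \<comment> \<open>Multiply 4 X + 6 X^2 + 4 X^3 + X^4 = 0 by Y and use Y^2 = -2 Y, so that 4 Y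
        = Y^3 and 8 Y = -Y^4. Splitting 6 = 8 - 2 gives X Y^3 + X^2 Y^2 - X^2 Y^4 + X^3 Y^3 + X^4 Y
        = 0.\<close>
      let ?s = "of_int 1 * (X_var ^ 2 * Y_var ^ 4) + of_int (- 1) * (X_var ^ 3 * Y_var ^ 3) + of_int (- 1) * (X_var ^ 4 * Y_var ^ 1)"
      show "ev r = ev ?s"
        unfolding ev_eq_iff 3 by (simp add: eval_nat_numeral algebra_simps)
      show "?s \<in> order_ge (Suc 4)" by (intro order_ge_add order) auto
    qed
  qed
qed

lemma form_in_relation_ideal:
  assumes "ev (hpart n p) \<in> gamma_filtration C4C2 (Suc n)"
  shows "hpart n p \<in> relation_ideal"
proof -
  let ?f = "hpart n p"
  define c where "c = (\<lambda>i. coeff (coeff p (n - i)) i)"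
  have f: "?f = (\<Sum>i\<le>n. of_int (c i) * X_var ^ i * Y_var ^ (n - i))"
    unfolding c_def by (rule hpart_expand)
  obtain g where g: "g \<in> order_ge (Suc n)" and "ev ?f = ev g"
    using assms by (auto simp: gamma_filtration_C4C2)
  then have "\<forall>a\<in>{1, \<i>, - 1, - \<i>}. \<forall>b\<in>{1, - 1}. poly2 (?f - g) (a - 1) (b - 1) = 0"
    by (simp only: ev_eq_iff)
  then have vanish: "poly2 (?f - g) (a - 1) (b - 1) = 0" if "a \<in> {1, \<i>, - 1, - \<i>}" "b \<in> {1, - 1}" for a b
    using that by blast
  \<comment> \<open>The point (0, -2), where only the power of y survives; next the point (-2, -2),
    where all monomials count equally.\<close>
  have even1: "even (\<Sum>i\<le>n. c i * 0 ^ i * 1 ^ (n - i))"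
    using vanish[of 1 "- 1"] by (intro form_at_even_point[OF f g]) simp
  have even2: "even (\<Sum>i\<le>n. c i * 1 ^ i * 1 ^ (n - i))"
    using vanish[of "- 1" "- 1"] by (intro form_at_even_point[OF f g]) simp
  have curve1: "4 dvd (\<Sum>i\<le>n. c i * poly 0 0 ^ (n - i))"
    using vanish[of \<i> 1] vanish[of "- 1" 1] by (intro form_on_curve[OF f g]) simp_all
  \<comment> \<open>On the curve y = x (x + 2) the point x = \<i> - 1 has y = -2, that is b = -1,
    while x = -2 gives y = 0, that is b = 1.\<close>
  have "(\<i> - 1) * (\<i> + 1) = (- 2 :: complex)" by (simp add: algebra_simps)
  then have curve2: "4 dvd (\<Sum>i\<le>n. c i * poly [:2, 1:] 0 ^ (n - i))"
    using vanish[of \<i> "- 1"] vanish[of "- 1" 1]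
    by (intro form_on_curve[OF f g]) (simp_all add: Polynomial.map_poly_pCons add.commute)
  show ?thesis
  proof (cases "n = 0")
    case True
    have f0: "?f = of_int (c 0)" using f by (simp add: True)
    \<comment> \<open>With scale 0 this says that \<open>g\<close> vanishes at the origin, the point
      of the identity element. In degree 0 the constant must therefore be 0 itself.\<close>
    have "0 ^ Suc n dvd poly2 g (0 * 0) (0 * 0 :: complex)" by (rule order_ge_dvd[OF g])
    then have "of_int (c 0) = (0 :: complex)" using vanish[of 1 1] f0 by simp
    then have "?f = 0" using f0 by simp
    then show ?thesis using ZXY_ideal(3)[OF ideal_relation_ideal] by simp
  next
    case False
    have c0: "even (c 0)"
    proof -
      have "(\<Sum>i\<le>n. c i * 0 ^ i * 1 ^ (n - i)) = (\<Sum>i\<le>n. if i = 0 then c 0 else 0)"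
        by (intro sum.cong) auto
      then show ?thesis using even1 by simp
    qed
    have cn: "4 dvd c n"
    proof -
      have "(\<Sum>i\<le>n. c i * poly 0 0 ^ (n - i)) = (\<Sum>i\<le>n. if i = n then c n else 0)"
        by (intro sum.cong) auto
      then show ?thesis using curve1 by simp
    qed
    have c1: "even (c (n - 1))" if "n \<ge> 2"
    proof -
      define m where "m = n - 2"
      have n: "n = Suc (Suc m)" using that by (simp add: m_def)
      \<comment> \<open>Modulo 4 only 2 c_(n-1) + c_n is left of the second curve test, and 4
        divides c_n by the first.\<close>
      have "4 dvd (\<Sum>i\<le>m. c i * 2 ^ (n - i))"
      proof (rule dvd_sum)
        fix i assume "i \<in> {..m}"
        then have "2 ^ (n - i) = 4 * (2 :: int) ^ (m - i)" by (simp add: n Suc_diff_le)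
        then show "4 dvd c i * 2 ^ (n - i)" by simp
      qed
      moreover have "(\<Sum>i\<le>n. c i * poly [:2, 1:] 0 ^ (n - i)) =
          (\<Sum>i\<le>m. c i * 2 ^ (n - i)) + 2 * c (n - 1) + c n"
        by (simp add: n)
      ultimately have "4 dvd 2 * c (n - 1)" using curve2 cn by presburger
      then show ?thesis by presburger
    qed
    show ?thesis
      unfolding f using False c0 cn c1 even2
      by (intro form_in_ideal[OF ideal_relation_ideal relators_subset]) simp_all
  qed
qed

theorem proposition7p1:
  "let G = integer_mod_group 4 \<times>\<times> integer_mod_group 2;
       J = Idl\<^bsub>ZXY\<^esub> {4 * X_var, 2 * Y_var, X_var * Y_var ^ 3 + X_var ^ 2 * Y_var ^ 2}
   in \<exists>\<phi>. \<phi> \<in> graded_ring_iso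
            (graded_char_ring G) (graded_char_ring_degree G)
            (ZXY Quot J) (quot_degree J)"
proof -
  have "p \<in> relation_ideal \<longleftrightarrow> (\<forall>n. ev (hpart n p) \<in> gamma_filtration C4C2 (Suc n))" for p
  proof
    \<comment> \<open>The kernel is an ideal, so only the relators need checking. The converse
      treats the homogeneous parts of \<open>p\<close> one at a time.\<close>
    have "relation_ideal \<subseteq> {p. \<forall>n. ev (hpart n p) \<in> gamma_filtration C4C2 (Suc n)}"
      unfolding relation_ideal_def
      by (rule ring.genideal_minimal[OF class_ring.ring_axioms E.symbol_kernel_ideal]) (use relators_symbol in blast)
    then show "\<forall>n. ev (hpart n p) \<in> gamma_filtration C4C2 (Suc n)" if "p \<in> relation_ideal"
      using that by blast
    assume "\<forall>n. ev (hpart n p) \<in> gamma_filtration C4C2 (Suc n)"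
    then have "(\<Sum>n\<le>degree (graded_poly p). hpart n p) \<in> relation_ideal"
      using form_in_relation_ideal by (intro ZXY_ideal(6)[OF ideal_relation_ideal]) blast
    then show "p \<in> relation_ideal" by (simp add: sum_hpart)
  qed
  from E.graded_ring_iso_quotient[OF ideal_relation_ideal this]
  show ?thesis
    by (simp only: Let_def graded_char_ring_def graded_char_ring_degree_def C4C2_def relation_ideal_def)
qed

end
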